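(* Let $\lambda_a,\lambda_d,\lambda_g\ge 0$ be constants. Consider the open multi-agent system of variable size $n(t)$ described in the context, in which, when the system size is $n$, arrivals occur at rate $\lambda_a$, random departures at rate $n\lambda_d$ and gossip interactions at rate $n\lambda_g$ (and nothing else occurs). Then $$\frac{d}{dt}\,\mathbb{E}\,\mathrm{Var}(x(t))\le -\lambda_g\,\mathbb{E}\,\mathrm{Var}(x(t))+\mathbb{E}\left[\frac{\lambda_a}{n(t)+1}\right]\sigma^2 .$$
   Context: $\mathcal N(t)$ is the finite set of agents present at time $t$, $n(t)=|\mathcal N(t)|$, and each agent $i\in\mathcal N(t)$ holds a value $x_i(t)\in\mathbb{R}$; $x(t)\in\mathbb{R}^{n(t)}$ is the vector of these values. The values at time $0$ are drawn independently from a distribution $\mathcal D$ with bounded support, mean $0$ and variance $\sigma^2$ (independently of $n(0)$). The empirical variance is $\mathrm{Var}(x)=\frac1n\sum_{i\in\mathcal N}(x_i-\bar x)^2$ with $\bar x=\frac1n\sum_{i\in\mathcal N}x_i$; by convention $\mathrm{Var}(x)=0$ if $n=0$. The state $(n(t),x(t))$ only changes at the activation times of independent Poisson clocks with size-dependent rates (given in the claim): - Gossip interaction: two agents $i,j\in\mathcal N(t)$ are selected independently and uniformly at random (possibly $i=j$), and both values are replaced by $\frac{x_i+x_j}{2}$; other values and the size are unchanged. - Arrival: a new agent (never previously present) joins, with value drawn from $\mathcal D$, so $n$ becomes $n+1$; other values are unchanged. - Random departure (when $n>0$): an agent chosen uniformly at random in $\mathcal N(t)$ leaves the system for ever, so $n$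 becomes $n-1$; other values are unchanged. All clocks, random selections and draws from $\mathcal D$ are mutually independent. *)

theory Defs
  imports "HOL-Probability.Probability"
begin

section \<open>Empirical variance\<close>

definition emp_mean :: "'i set \<Rightarrow> ('i \<Rightarrow> real) \<Rightarrow> real" where
  "emp_mean N x = (\<Sum>i\<in>N. x i) / real (card N)"

text \<open>Since \<open>a / 0 = 0\<close>, the value is \<open>0\<close> for the empty system.\<close>

definition emp_var :: "'i set \<Rightarrow> ('i \<Rightarrow> real) \<Rightarrow> real" where
  "emp_var N x = (\<Sum>i\<in>N. (x i - emp_mean N x)\<^sup>2) / real (card N)"


section \<open>Trajectories as functions of the noise\<close>

text \<open>
  Agents are named by natural numbers. A configuration \<open>(N, x)\<close> consists of the set \<open>N\<close> of agents
  present and an assignment \<open>x\<close>, of which only the restriction to \<open>N\<close> is meaningful.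
\<close>

type_synonym config = "nat set \<times> (nat \<Rightarrow> real)"

datatype event = Arrival | Departure | Gossip

fun event_rate :: "real \<Rightarrow> real \<Rightarrow> real \<Rightarrow> event \<Rightarrow> nat \<Rightarrow> real" where
  "event_rate la ld lg Arrival n = la"
| "event_rate la ld lg Departure n = real n * ld"
| "event_rate la ld lg Gossip n = real n * lg"

text \<open>
  One realisation of all the randomness. The argument \<open>k\<close> of the later fields counts events:
  \<open>clock \<omega> e k\<close> (of unit mean) and the remaining fields at \<open>k\<close> are used only for the event
  number \<open>k\<close> (starting from 0). The selections \<open>leaver \<omega> k A\<close>, \<open>first_agent \<omega> k A\<close> and
  \<open>second_agent \<omega> k A\<close> are the agents drawn when the set of agents present is \<open>A\<close>.
\<close>

record noise =
  init_size :: nat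
  init_value :: "nat \<Rightarrow> real"
  clock :: "event \<Rightarrow> nat \<Rightarrow> real"
  new_value :: "nat \<Rightarrow> real"
  leaver :: "nat \<Rightarrow> nat set \<Rightarrow> nat"
  first_agent :: "nat \<Rightarrow> nat set \<Rightarrow> nat"
  second_agent :: "nat \<Rightarrow> nat set \<Rightarrow> nat"

text \<open>
  The time from the previous event until the clock of type \<open>e\<close> rings, in a system of size \<open>n\<close>: an
  exponential variable of rate \<open>r e n\<close>. By memorylessness all clocks may be started afresh after
  each event. A clock of rate \<open>0\<close> never rings.
\<close>

definition ring_delay :: "(event \<Rightarrow> nat \<Rightarrow> real) \<Rightarrow> noise \<Rightarrow> nat \<Rightarrow> nat \<Rightarrow> event \<Rightarrow> ereal" where
  "ring_delay r \<omega> k n e = (if r e n = 0 then \<infinity> else ereal (clock \<omega> e k / r e n))"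

definition holding_time :: "(event \<Rightarrow> nat \<Rightarrow> real) \<Rightarrow> noise \<Rightarrow> nat \<Rightarrow> nat \<Rightarrow> ereal" where
  "holding_time r \<omega> k n =
     min (ring_delay r \<omega> k n Arrival) (min (ring_delay r \<omega> k n Departure) (ring_delay r \<omega> k n Gossip))"

text \<open>
  The clock ringing first. Ties between finite delays have probability zero; if all delays are
  infinite, the event is placed at time \<open>\<infinity>\<close> and its type is irrelevant.
\<close>

definition next_event :: "(event \<Rightarrow> nat \<Rightarrow> real) \<Rightarrow> noise \<Rightarrow> nat \<Rightarrow> nat \<Rightarrow> event" where
  "next_event r \<omega> k n =
     (if ring_delay r \<omega> k n Arrival = holding_time r \<omega> k n then Arrival
      else if ring_delay r \<omega> k n Departure = holding_time r \<omega> k n then Departure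
      else Gossip)"

text \<open>
  The initial agents are \<open>0, \<dots>, init_size \<omega> - 1\<close>, so the name \<open>init_size \<omega> + k\<close> of an agent arriving
  at event \<open>k\<close> has never been used before.
\<close>

fun apply_event :: "noise \<Rightarrow> nat \<Rightarrow> event \<Rightarrow> config \<Rightarrow> config" where
  "apply_event \<omega> k Arrival (N, x) =
     (insert (init_size \<omega> + k) N, x(init_size \<omega> + k := new_value \<omega> k))"
| "apply_event \<omega> k Departure (N, x) = (N - {leaver \<omega> k N}, x)"
| "apply_event \<omega> k Gossip (N, x) =
     (let i = first_agent \<omega> k N; j = second_agent \<omega> k N; m = (x i + x j) / 2
      in (N, x(i := m, j := m)))"

primrec jump_chain :: "(event \<Rightarrow> nat \<Rightarrow> real) \<Rightarrow> noise \<Rightarrow> nat \<Rightarrow> config" where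
  "jump_chain r \<omega> 0 = ({..<init_size \<omega>}, init_value \<omega>)"
| "jump_chain r \<omega> (Suc k) =
     apply_event \<omega> k (next_event r \<omega> k (card (fst (jump_chain r \<omega> k)))) (jump_chain r \<omega> k)"

text \<open>\<open>jump_time r \<omega> (Suc k)\<close> is the time of event \<open>k\<close>.\<close>

primrec jump_time :: "(event \<Rightarrow> nat \<Rightarrow> real) \<Rightarrow> noise \<Rightarrow> nat \<Rightarrow> ereal" where
  "jump_time r \<omega> 0 = 0"
| "jump_time r \<omega> (Suc k) = jump_time r \<omega> k + holding_time r \<omega> k (card (fst (jump_chain r \<omega> k)))"

definition num_events :: "(event \<Rightarrow> nat \<Rightarrow> real) \<Rightarrow> noise \<Rightarrow> real \<Rightarrow> nat" where
  "num_events r \<omega> t = card {k. jump_time r \<omega> (Suc k) \<le> ereal t}"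

text \<open>
  If infinitely many events occurred up to time \<open>t\<close>, then \<open>num_events\<close> would be \<open>0\<close>. For the rates
  \<open>event_rate la ld lg\<close> this has probability zero: the size is at most the initial size plus a
  Poisson number of arrivals, and the total rate is affine in the size.
\<close>

definition config_at :: "(event \<Rightarrow> nat \<Rightarrow> real) \<Rightarrow> noise \<Rightarrow> real \<Rightarrow> config" where
  "config_at r \<omega> t = jump_chain r \<omega> (num_events r \<omega> t)"

definition agents_at :: "(event \<Rightarrow> nat \<Rightarrow> real) \<Rightarrow> noise \<Rightarrow> real \<Rightarrow> nat set" where
  "agents_at r \<omega> t = fst (config_at r \<omega> t)"

definition values_at :: "(event \<Rightarrow> nat \<Rightarrow> real) \<Rightarrow> noise \<Rightarrow> real \<Rightarrow> nat \<Rightarrow> real" where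
  "values_at r \<omega> t = snd (config_at r \<omega> t)"

definition size_at :: "(event \<Rightarrow> nat \<Rightarrow> real) \<Rightarrow> noise \<Rightarrow> real \<Rightarrow> nat" where
  "size_at r \<omega> t = card (agents_at r \<omega> t)"

definition variance_at :: "(event \<Rightarrow> nat \<Rightarrow> real) \<Rightarrow> noise \<Rightarrow> real \<Rightarrow> real" where
  "variance_at r \<omega> t = emp_var (agents_at r \<omega> t) (values_at r \<omega> t)"


section \<open>Law of the noise\<close>

locale value_distribution = real_distribution D for D :: "real measure" +
  fixes \<sigma> :: real
  assumes bounded_support: "\<exists>S. bounded S \<and> (AE v in D. v \<in> S)"
    and mean_zero: "expectation (\<lambda>v. v) = 0"
    and variance_eq: "variance (\<lambda>v. v) = \<sigma>\<^sup>2"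

text \<open>
  Names for the individual random variables contained in the noise. All of them are read as real
  numbers, so that their mutual independence can be stated for a single family.
\<close>

datatype source =
    Init_Size
  | Init_Value nat
  | Clock event nat
  | New_Value nat
  | Leaver nat "nat set"
  | First_Agent nat "nat set"
  | Second_Agent nat "nat set"

fun reading :: "noise \<Rightarrow> source \<Rightarrow> real" where
  "reading \<omega> Init_Size = real (init_size \<omega>)"
| "reading \<omega> (Init_Value i) = init_value \<omega> i"
| "reading \<omega> (Clock e k) = clock \<omega> e k"
| "reading \<omega> (New_Value k) = new_value \<omega> k"
| "reading \<omega> (Leaver k A) = real (leaver \<omega> k A)"
| "reading \<omega> (First_Agent k A) = real (first_agent \<omega> k A)"
| "reading \<omega> (Second_Agent k A) = real (second_agent \<omega> k A)"

definition selection_sets :: "nat set set" where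
  "selection_sets = {A. finite A \<and> A \<noteq> {}}"

definition sources :: "source set" where
  "sources = {Init_Size} \<union> range Init_Value \<union> range (case_prod Clock) \<union> range New_Value
     \<union> case_prod Leaver ` (UNIV \<times> selection_sets)
     \<union> case_prod First_Agent ` (UNIV \<times> selection_sets)
     \<union> case_prod Second_Agent ` (UNIV \<times> selection_sets)"

text \<open>The law of the initial size is left arbitrary.\<close>

locale driving_noise = prob_space M for M :: "'a measure" +
  fixes D :: "real measure" and W :: "'a \<Rightarrow> noise"
  assumes independent: "indep_vars (\<lambda>_. borel) (\<lambda>s \<omega>. reading (W \<omega>) s) sources"
    and init_value_law: "\<And>i. distr M borel (\<lambda>\<omega>. init_value (W \<omega>) i) = D"
    and new_value_law: "\<And>k. distr M borel (\<lambda>\<omega>. new_value (W \<omega>) k) = D"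
    and clock_law: "\<And>e k. distributed M lborel (\<lambda>\<omega>. clock (W \<omega>) e k) (exponential_density 1)"
    and leaver_law: "\<And>k A. A \<in> selection_sets \<Longrightarrow>
      distr M (count_space UNIV) (\<lambda>\<omega>. leaver (W \<omega>) k A) = measure_pmf (pmf_of_set A)"
    and first_agent_law: "\<And>k A. A \<in> selection_sets \<Longrightarrow>
      distr M (count_space UNIV) (\<lambda>\<omega>. first_agent (W \<omega>) k A) = measure_pmf (pmf_of_set A)"
    and second_agent_law: "\<And>k A. A \<in> selection_sets \<Longrightarrow>
      distr M (count_space UNIV) (\<lambda>\<omega>. second_agent (W \<omega>) k A) = measure_pmf (pmf_of_set A)"

end

(*
  Let n be the size, V the empirical variance and m the empirical mean of the configuration. Conditionally
  on the initial size and all clocks, E m^2 <= \<sigma>^2/n and E V <= \<sigma>^2 (n - 1)/n: this holds at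
  time 0, and each of the three kinds of events preserves the pair of bounds (neither bound alone suffices,
  since a departure turns E m^2 into E m^2 + E V/(n - 1)^2). Applied to V, the gossip part of the generator
  is -lg V, the departure part is nonpositive, and the arrival part is at most la n/(n + 1)^2 (\<sigma>^2 + m^2),
  whose mean is at most la \<sigma>^2/(n + 1) by the bound on m.

  That E V(t) has the mean of the generator as its derivative is Dynkin's formula. It is obtained without
  conditional expectations, by resampling some sources of the noise while all the others are frozen. The
  step from jumps to time integrals rests on one identity: an exponential variable X of mean 1 satisfies
  P(X <= a) = E (min X a), so the probability that the next event has type e and happens before t equals the
  rate of e times the mean time spent waiting for that event before t.
  The same identity shows that only finitely many events happen before t.
*)
theory Submission
  imports Defs
begin

section \<open>Deterministic algebra of one event, before and after averaging over uniformly chosen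
  agents\<close>

section \<open>Mean and variance under a single event\<close>

text \<open>The obstacle is that the initial size has an arbitrary law, so neither the size nor the
  event rates need be integrable. What saves the argument is that the growth of the rates is
  compensated in the product of rate and mean change of the variance: gossip loses V/n on average at
  rate n lg, a departure loses V/(n-1)^2 at rate n ld. Hence the generator is bounded and dominated
  convergence suffices; only the statements on event times need a cutoff at a bounded initial size.
  The bounds \<sigma>^2/n and \<sigma>^2 (n-1)/n are the exact second moments for n independent
  draws. Arrivals and departures reproduce them as equalities, while gossip only lowers the
  variance. The conditioning includes the clocks of the future as well: the number of events up to
  time t depends on the clocks of the event that is still to come, and the indicator of its value
  has to be an admissible weight. This is possible because, on a set of full measure, selections and
  values never affect sizes and event times.\<close>

lemma sum_fun_upd:
  fixes x :: "'i \<Rightarrow> real"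
  assumes "finite N" "i \<in> N"
  shows "(\<Sum>l\<in>N. f ((x(i := v)) l)) = (\<Sum>l\<in>N. f (x l)) - f (x i) + (f v :: real)"
proof -
  have "(\<Sum>l\<in>N - {i}. f ((x(i := v)) l)) = (\<Sum>l\<in>N - {i}. f (x l))"
    by (intro sum.cong) auto
  then show ?thesis
    using assms by (simp add: sum.remove[of N i])
qed

text \<open>The product form covers the empty system too, which spares later proofs a case.\<close>

lemma emp_mean_eq_sum: "finite N \<Longrightarrow> real (card N) * emp_mean N x = (\<Sum>i\<in>N. x i)"
  by (cases "N = {}") (auto simp: emp_mean_def)

lemma emp_var_eq:
  assumes "finite N"
  shows "emp_var N x = (\<Sum>i\<in>N. (x i)\<^sup>2) / real (card N) - (emp_mean N x)\<^sup>2"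
proof (cases "N = {}")
  case True
  then show ?thesis by (simp add: emp_var_def emp_mean_def)
next
  case False
  then have n: "real (card N) > 0" using assms by (simp add: card_gt_0_iff)
  have "(\<Sum>i\<in>N. (x i - emp_mean N x)\<^sup>2)
      = (\<Sum>i\<in>N. (x i)\<^sup>2) - 2 * emp_mean N x * (\<Sum>i\<in>N. x i) + real (card N) * (emp_mean N x)\<^sup>2"
    by (simp add: power2_diff sum.distrib sum_subtractf sum_distrib_left sum_distrib_right
        mult.commute mult.left_commute)
  also have "(\<Sum>i\<in>N. x i) = real (card N) * emp_mean N x"
    by (simp add: emp_mean_eq_sum assms)
  finally show ?thesis
    using n by (simp add: emp_var_def field_simps power2_eq_square)
qed

lemma sum_squares_eq:
  assumes "finite N"
  shows "(\<Sum>i\<in>N. (x i)\<^sup>2) = real (card N) * (emp_var N x + (emp_mean N x)\<^sup>2)"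
  using assms by (cases "N = {}") (auto simp: emp_var_eq)

lemma sum_square_deviations:
  assumes "finite N"
  shows "(\<Sum>i\<in>N. (x i - emp_mean N x)\<^sup>2) = real (card N) * emp_var N x"
  using assms by (cases "N = {}") (auto simp: emp_var_def)

lemma emp_var_nonneg: "0 \<le> emp_var N x"
  by (simp add: emp_var_def sum_nonneg)

lemma emp_mean_abs_le:
  assumes "finite N" "\<And>i. i \<in> N \<Longrightarrow> \<bar>x i\<bar> \<le> b" "0 \<le> b"
  shows "\<bar>emp_mean N x\<bar> \<le> b"
proof (cases "N = {}")
  case False
  have "\<bar>\<Sum>i\<in>N. x i\<bar> \<le> (\<Sum>i\<in>N. b)"
    by (rule order_trans[OF sum_abs sum_mono]) (use assms in auto)
  then show ?thesis
    using False assms(1) by (simp add: emp_mean_def abs_divide divide_le_eq card_gt_0_iff mult.commute)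
qed (use assms in \<open>auto simp: emp_mean_def\<close>)

lemma emp_var_le:
  assumes "finite N" "\<And>i. i \<in> N \<Longrightarrow> \<bar>x i\<bar> \<le> b"
  shows "emp_var N x \<le> b\<^sup>2"
proof (cases "N = {}")
  case False
  have "(\<Sum>i\<in>N. (x i)\<^sup>2) \<le> (\<Sum>i\<in>N. b\<^sup>2)"
    using assms(2) by (intro sum_mono) (auto simp: abs_le_square_iff[symmetric] intro: order_trans[OF _ abs_ge_self])
  then have "(\<Sum>i\<in>N. (x i)\<^sup>2) / real (card N) \<le> b\<^sup>2"
    using False assms(1) by (simp add: divide_le_eq card_gt_0_iff mult.commute)
  moreover have "0 \<le> (emp_mean N x)\<^sup>2"
    by simp
  ultimately show ?thesis
    unfolding emp_var_eq[OF assms(1)] by linarith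
qed (simp add: emp_var_def)

lemma emp_mean_arrival:
  assumes "finite N" "m \<notin> N"
  shows "emp_mean (insert m N) (x(m := v)) = (real (card N) * emp_mean N x + v) / (real (card N) + 1)"
proof -
  have "(\<Sum>i\<in>N. (x(m := v)) i) = (\<Sum>i\<in>N. x i)"
    using assms by (intro sum.cong) auto
  then show ?thesis
    using assms by (simp add: emp_mean_def[of "insert m N"] emp_mean_eq_sum add_ac)
qed

text \<open>Merging a group with a single point: the variance within the group is scaled by its
  share n/(n + 1), and the last term is the variance between the two. For n = 0 both terms are
  0.\<close>

lemma emp_var_arrival:
  assumes "finite N" "m \<notin> N"
  defines "n \<equiv> real (card N)"
  shows "emp_var (insert m N) (x(m := v))
    = n / (n + 1) * emp_var N x + n / (n + 1)\<^sup>2 * (v - emp_mean N x)\<^sup>2"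
proof -
  have d: "n + 1 \<noteq> 0" by (simp add: n_def add_nonneg_eq_0_iff)
  \<comment> \<open>A polynomial identity once everything stands over d^2 and n is replaced by d -
    1.\<close>
  have alg: "(n * (V + a\<^sup>2) + v\<^sup>2) / d - ((n * a + v) / d)\<^sup>2
      = n / d * V + n / d\<^sup>2 * (v - a)\<^sup>2"
    if "d \<noteq> 0" "n = d - 1" for a V d :: real
  proof -
    have "(n * (V + a\<^sup>2) + v\<^sup>2) / d - ((n * a + v) / d)\<^sup>2
        = ((n * (V + a\<^sup>2) + v\<^sup>2) * d - (n * a + v)\<^sup>2) / d\<^sup>2"
      using that(1) by (simp add: diff_divide_distrib power_divide power2_eq_square)
    also have "(n * (V + a\<^sup>2) + v\<^sup>2) * d - (n * a + v)\<^sup>2 = n * d * V + n * (v - a)\<^sup>2"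
      unfolding that(2) by (simp add: algebra_simps power2_eq_square)
    also have "(n * d * V + n * (v - a)\<^sup>2) / d\<^sup>2 = n / d * V + n / d\<^sup>2 * (v - a)\<^sup>2"
      using that(1) by (simp add: add_divide_distrib power2_eq_square)
    finally show ?thesis .
  qed
  have "(\<Sum>i\<in>N. ((x(m := v)) i)\<^sup>2) = (\<Sum>i\<in>N. (x i)\<^sup>2)"
    using assms(2) by (intro sum.cong) auto
  then have sq: "(\<Sum>i\<in>insert m N. ((x(m := v)) i)\<^sup>2) = n * (emp_var N x + (emp_mean N x)\<^sup>2) + v\<^sup>2"
    unfolding sum.insert[OF assms(1,2)] fun_upd_same n_def sum_squares_eq[OF assms(1), symmetric]
    by simp
  have card: "real (card (insert m N)) = n + 1"
    using assms(1,2) by (simp add: n_def)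
  have fin: "finite (insert m N)" using assms(1) by simp
  show ?thesis
    unfolding emp_var_eq[OF fin] sq card emp_mean_arrival[OF assms(1,2)] n_def[symmetric]
    by (rule alg[OF d]) simp
qed

lemma card_diff_real: "finite N \<Longrightarrow> i \<in> N \<Longrightarrow> real (card (N - {i})) = real (card N) - 1"
  by (cases "card N") auto

lemma emp_mean_departure:
  assumes "finite N" "i \<in> N" "card N \<ge> 2"
  shows "emp_mean (N - {i}) x = emp_mean N x - (x i - emp_mean N x) / (real (card N) - 1)"
proof -
  have n: "real (card N) - 1 \<noteq> 0" using assms(3) by linarith
  have "(\<Sum>j\<in>N - {i}. x j) = real (card N) * emp_mean N x - x i"
    using assms by (simp add: sum.remove[of N i] emp_mean_eq_sum)
  then show ?thesis
    using n assms by (simp add: emp_mean_def[of "N - {i}"] card_diff_real field_simps)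
qed

text \<open>Inverse of the arrival formula with the leaver as the newcomer, the deviation being
  measured from the mean before the departure.\<close>

lemma emp_var_departure:
  assumes "finite N" "i \<in> N" "card N \<ge> 2"
  defines "n \<equiv> real (card N)"
  shows "emp_var (N - {i}) x = n / (n - 1) * emp_var N x - n / (n - 1)\<^sup>2 * (x i - emp_mean N x)\<^sup>2"
proof -
  have n: "n - 1 \<noteq> 0" using assms(3) n_def by linarith
  have "(\<Sum>j\<in>N - {i}. (x j)\<^sup>2) = n * (emp_var N x + (emp_mean N x)\<^sup>2) - (x i)\<^sup>2"
    using sum_squares_eq[OF assms(1), of x] assms(1,2) by (simp add: sum.remove[of N i] n_def)
  then have "emp_var (N - {i}) x = (n * (emp_var N x + (emp_mean N x)\<^sup>2) - (x i)\<^sup>2) / (n - 1)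
      - (emp_mean N x - (x i - emp_mean N x) / (n - 1))\<^sup>2"
    using assms by (simp add: emp_var_eq[of "N - {i}"] card_diff_real emp_mean_departure)
  also have "\<dots> = n / (n - 1) * emp_var N x - n / (n - 1)\<^sup>2 * (x i - emp_mean N x)\<^sup>2"
    using n by (simp add: divide_simps) (simp add: algebra_simps power2_eq_square)
  finally show ?thesis .
qed

text \<open>Averaging turns the squared deviation into the variance, and n/(n-1) - n/(n-1)^2 = 1 -
  1/(n-1)^2. For at most one agent both sides are 0.\<close>

lemma avg_emp_var_departure:
  assumes "finite N"
  shows "(\<Sum>i\<in>N. emp_var (N - {i}) x) / real (card N)
    = emp_var N x - emp_var N x / (real (card N) - 1)\<^sup>2"
proof (cases "card N \<ge> 2")
  case True
  define n where "n = real (card N)"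
  have n: "n - 1 \<noteq> 0" "n \<noteq> 0" using True n_def by linarith+
  have "(\<Sum>i\<in>N. emp_var (N - {i}) x)
      = (\<Sum>i\<in>N. n / (n - 1) * emp_var N x - n / (n - 1)\<^sup>2 * (x i - emp_mean N x)\<^sup>2)"
    using True assms by (intro sum.cong) (auto simp: emp_var_departure n_def)
  also have "\<dots> = n * (n / (n - 1) * emp_var N x) - n / (n - 1)\<^sup>2 * (n * emp_var N x)"
    using assms by (simp only: sum_subtractf sum_square_deviations n_def sum_constant
        sum_distrib_left[symmetric])
  also have "\<dots> = n * (emp_var N x - emp_var N x / (n - 1)\<^sup>2)"
    using n by (simp add: divide_simps) (simp add: algebra_simps power2_eq_square)
  finally show ?thesis
    using n unfolding n_def[symmetric] by simp
next
  case False
  then consider "card N = 0" | "card N = 1" by linarith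
  then show ?thesis
  proof cases
    case 1
    then show ?thesis using assms by (simp add: emp_var_def)
  next
    case 2
    then obtain j where "N = {j}" by (auto simp: card_1_singleton_iff)
    then show ?thesis by (simp add: emp_var_def emp_mean_def)
  qed
qed

text \<open>Each departure shifts the mean by a multiple of the leaver's deviation; the deviations
  sum to 0, so only their squares survive. At size 1 the identity would break, the mean of the empty
  system being 0 by convention.\<close>

lemma avg_emp_mean_departure:
  assumes "finite N" "card N \<ge> 2"
  shows "(\<Sum>i\<in>N. (emp_mean (N - {i}) x)\<^sup>2) / real (card N)
    = (emp_mean N x)\<^sup>2 + emp_var N x / (real (card N) - 1)\<^sup>2"
proof -
  define n a where "n = real (card N)" and "a = emp_mean N x"
  have n: "n - 1 \<noteq> 0" "n \<noteq> 0" using assms(2) n_def by linarith+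
  have 0: "(\<Sum>i\<in>N. x i - a) = 0"
    using assms(1) by (simp add: sum_subtractf a_def emp_mean_eq_sum)
  have "(\<Sum>i\<in>N. (emp_mean (N - {i}) x)\<^sup>2)
      = (\<Sum>i\<in>N. a\<^sup>2 - 2 * a / (n - 1) * (x i - a) + (x i - a)\<^sup>2 / (n - 1)\<^sup>2)"
    using assms by (intro sum.cong)
      (auto simp: emp_mean_departure n_def a_def power2_diff power_divide)
  also have "\<dots> = n * a\<^sup>2 + n * emp_var N x / (n - 1)\<^sup>2"
    using 0 assms(1)
    by (simp add: sum.distrib sum_subtractf sum_square_deviations n_def a_def
        flip: sum_distrib_left sum_divide_distrib)
  finally show ?thesis
    using n unfolding n_def[symmetric] a_def[symmetric] by (simp add: add_divide_distrib)
qed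

text \<open>Averaging two values keeps their sum and lowers their sum of squares by half the squared
  difference. For i = j nothing moves.\<close>

lemma emp_mean_var_gossip:
  fixes x :: "'i \<Rightarrow> real"
  assumes "finite N" "i \<in> N" "j \<in> N"
  defines "m \<equiv> (x i + x j) / 2"
  shows "emp_mean N (x(i := m, j := m)) = emp_mean N x"
    and "emp_var N (x(i := m, j := m)) = emp_var N x - (x i - x j)\<^sup>2 / (2 * real (card N))"
proof -
  have "(\<Sum>l\<in>N. (x(i := m, j := m)) l) = (\<Sum>l\<in>N. x l)"
    using assms sum_fun_upd[of N i "\<lambda>z. z" x m] sum_fun_upd[of N j "\<lambda>z. z" "x(i := m)" m]
    by auto
  then show mean: "emp_mean N (x(i := m, j := m)) = emp_mean N x"
    by (simp add: emp_mean_def)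
  have "(\<Sum>l\<in>N. ((x(i := m, j := m)) l)\<^sup>2) = (\<Sum>l\<in>N. (x l)\<^sup>2) - (x i - x j)\<^sup>2 / 2"
  proof (cases "i = j")
    case False
    have "(\<Sum>l\<in>N. ((x(i := m, j := m)) l)\<^sup>2) = (\<Sum>l\<in>N. (x l)\<^sup>2) - (x i)\<^sup>2 + m\<^sup>2 - (x j)\<^sup>2 + m\<^sup>2"
      using False assms(1-3) sum_fun_upd[of N i "\<lambda>z. z\<^sup>2" x m]
        sum_fun_upd[of N j "\<lambda>z. z\<^sup>2" "x(i := m)" m]
      by simp
    also have "\<dots> = (\<Sum>l\<in>N. (x l)\<^sup>2) - (x i - x j)\<^sup>2 / 2"
      by (simp add: m_def power2_eq_square field_simps)
    finally show ?thesis .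
  qed (simp add: m_def)
  then show "emp_var N (x(i := m, j := m)) = emp_var N x - (x i - x j)\<^sup>2 / (2 * real (card N))"
    using assms(1) by (simp add: emp_var_eq mean diff_divide_distrib)
qed

text \<open>The squared differences over all ordered pairs, including i = j, sum to 2 n^2 V, so one
  gossip loses V/n on average. At rate n lg this becomes the decay rate lg of the theorem.\<close>

lemma avg_emp_var_gossip:
  fixes x :: "'i \<Rightarrow> real"
  assumes "finite N" "N \<noteq> {}"
  shows "(\<Sum>i\<in>N. (\<Sum>j\<in>N. emp_var N (x(i := (x i + x j) / 2, j := (x i + x j) / 2)))
      / real (card N)) / real (card N) = emp_var N x - emp_var N x / real (card N)"
proof -
  define n where "n = real (card N)"
  have n: "n > 0" using assms by (simp add: n_def card_gt_0_iff)
  have "(\<Sum>i\<in>N. \<Sum>j\<in>N. (x i - x j)\<^sup>2)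
      = (\<Sum>i\<in>N. n * (x i)\<^sup>2 - 2 * x i * (\<Sum>j\<in>N. x j) + (\<Sum>j\<in>N. (x j)\<^sup>2))"
    by (intro sum.cong refl)
       (simp add: power2_diff sum.distrib sum_subtractf n_def mult.assoc flip: sum_distrib_left)
  also have "\<dots> = 2 * n * (\<Sum>j\<in>N. (x j)\<^sup>2) - 2 * (\<Sum>j\<in>N. x j)\<^sup>2"
    by (simp add: sum.distrib sum_subtractf n_def power2_eq_square algebra_simps
        sum_distrib_left sum_distrib_right)
  also have "\<dots> = 2 * n\<^sup>2 * emp_var N x"
    unfolding sum_squares_eq[OF assms(1)] emp_mean_eq_sum[OF assms(1), symmetric] n_def[symmetric]
    by (simp add: algebra_simps power2_eq_square)
  finally have s: "(\<Sum>i\<in>N. \<Sum>j\<in>N. (x i - x j)\<^sup>2) = 2 * n\<^sup>2 * emp_var N x" .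
  have "(\<Sum>i\<in>N. (\<Sum>j\<in>N. emp_var N (x(i := (x i + x j) / 2, j := (x i + x j) / 2))) / n) / n
      = (\<Sum>i\<in>N. (\<Sum>j\<in>N. emp_var N x - (x i - x j)\<^sup>2 / (2 * n)) / n) / n"
    using assms(1) by (simp add: emp_mean_var_gossip n_def)
  also have "\<dots> = (n * (n * emp_var N x) - (\<Sum>i\<in>N. \<Sum>j\<in>N. (x i - x j)\<^sup>2) / (2 * n)) / (n * n)"
    by (simp only: sum_divide_distrib[symmetric] sum_subtractf sum_constant n_def[symmetric]
        divide_divide_eq_left)
  also have "\<dots> = emp_var N x - emp_var N x / n"
    unfolding s using n by (simp add: field_simps power2_eq_square)
  finally show ?thesis unfolding n_def .
qed

section \<open>The sigma-algebra generated by the readings\<close>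

section \<open>The space of noise realisations\<close>

text \<open>Restricted to \<open>sources\<close>: selections from empty or infinite sets have no
  prescribed law and stay invisible.\<close>

definition readings :: "noise \<Rightarrow> source \<Rightarrow> real" where
  "readings w = (\<lambda>s\<in>sources. reading w s)"

text \<open>The coarsest sigma-algebra for which all readings are measurable, so that the records
  themselves serve as sample points.\<close>

definition noise_space :: "noise measure" where
  "noise_space = vimage_algebra UNIV readings (PiM sources (\<lambda>_. borel))"

lemma space_noise_space [simp]: "space noise_space = UNIV"
  by (simp add: noise_space_def)

lemma readings_in_space: "readings w \<in> space (PiM sources (\<lambda>_. borel))"
  by (simp add: readings_def space_PiM)

lemma measurable_readings: "readings \<in> noise_space \<rightarrow>\<^sub>M PiM sources (\<lambda>_. borel)"
  unfolding noise_space_def by (rule measurable_vimage_algebra1) (use readings_in_space in auto)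

lemma readings_vimage_emb:
  assumes "J \<subseteq> sources"
  shows "readings -` prod_emb sources (\<lambda>_. borel) J (Pi\<^sub>E J A) = {w. \<forall>s\<in>J. reading w s \<in> A s}"
proof -
  have "restrict (readings w) J = restrict (reading w) J" for w
    using assms by (auto simp: readings_def fun_eq_iff)
  then show ?thesis
    using readings_in_space by (auto simp: prod_emb_def PiE_iff space_PiM)
qed

lemma measurable_reading:
  assumes "s \<in> sources"
  shows "(\<lambda>w. reading w s) \<in> borel_measurable noise_space"
proof -
  have "(\<lambda>w. readings w s) \<in> borel_measurable noise_space"
    using assms by (intro measurable_compose[OF measurable_readings measurable_component_singleton])
  then show ?thesis
    using assms by (simp add: readings_def)
qed

lemma measurable_into_noise_space:
  assumes "\<And>s. s \<in> sources \<Longrightarrow> (\<lambda>x. reading (g x) s) \<in> borel_measurable N"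
  shows "g \<in> N \<rightarrow>\<^sub>M noise_space"
  unfolding noise_space_def
proof (rule measurable_vimage_algebra2)
  show "(\<lambda>x. readings (g x)) \<in> N \<rightarrow>\<^sub>M PiM sources (\<lambda>_. borel)"
    unfolding readings_def using assms by (intro measurable_restrict) auto
qed simp

lemma sources_simps [simp, intro]:
  "Init_Size \<in> sources" "Init_Value i \<in> sources" "Clock e k \<in> sources" "New_Value k \<in> sources"
  "A \<in> selection_sets \<Longrightarrow> Leaver k A \<in> sources"
  "A \<in> selection_sets \<Longrightarrow> First_Agent k A \<in> sources"
  "A \<in> selection_sets \<Longrightarrow> Second_Agent k A \<in> sources"
  by (auto simp: sources_def image_iff)

text \<open>A natural number is recovered from its real reading by rounding down.\<close>

lemma measurable_nat_of_reading:
  assumes "s \<in> sources" "\<And>w. reading w s = real (f w)"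
  shows "f \<in> noise_space \<rightarrow>\<^sub>M count_space UNIV"
proof -
  have "(\<lambda>w. nat \<lfloor>reading w s\<rfloor>) \<in> noise_space \<rightarrow>\<^sub>M count_space UNIV"
    using measurable_reading[OF assms(1)] by measurable
  then show ?thesis
    by (simp add: assms(2))
qed

lemma measurable_noise [measurable]:
  "init_size \<in> noise_space \<rightarrow>\<^sub>M count_space UNIV"
  "(\<lambda>w. init_value w i) \<in> borel_measurable noise_space"
  "(\<lambda>w. clock w e k) \<in> borel_measurable noise_space"
  "(\<lambda>w. new_value w k) \<in> borel_measurable noise_space"
  using measurable_nat_of_reading[of Init_Size] measurable_reading[of "Init_Value i"]
    measurable_reading[of "Clock e k"] measurable_reading[of "New_Value k"] by auto

lemma measurable_selections:
  assumes "A \<in> selection_sets"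
  shows "(\<lambda>w. leaver w k A) \<in> noise_space \<rightarrow>\<^sub>M count_space UNIV"
    "(\<lambda>w. first_agent w k A) \<in> noise_space \<rightarrow>\<^sub>M count_space UNIV"
    "(\<lambda>w. second_agent w k A) \<in> noise_space \<rightarrow>\<^sub>M count_space UNIV"
  using assms measurable_nat_of_reading[of "Leaver k A"] measurable_nat_of_reading[of "First_Agent k A"]
    measurable_nat_of_reading[of "Second_Agent k A"] by auto


section \<open>Integration over an independent copy of some sources, in place of conditional
  expectation\<close>

section \<open>Resampling a set of sources\<close>

text \<open>The sources in \<open>S\<close> come from the second realisation, all others from the
  first. With \<open>w'\<close> fixed, integrating over \<open>w\<close> plays the role of the
  conditional expectation given the sources outside \<open>S\<close>.\<close>

definition mix :: "source set \<Rightarrow> noise \<Rightarrow> noise \<Rightarrow> noise" where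
  "mix S w' w = \<lparr>
     init_size = init_size (if Init_Size \<in> S then w else w'),
     init_value = (\<lambda>i. init_value (if Init_Value i \<in> S then w else w') i),
     clock = (\<lambda>e k. clock (if Clock e k \<in> S then w else w') e k),
     new_value = (\<lambda>k. new_value (if New_Value k \<in> S then w else w') k),
     leaver = (\<lambda>k A. leaver (if Leaver k A \<in> S then w else w') k A),
     first_agent = (\<lambda>k A. first_agent (if First_Agent k A \<in> S then w else w') k A),
     second_agent = (\<lambda>k A. second_agent (if Second_Agent k A \<in> S then w else w') k A)\<rparr>"

lemma reading_mix: "reading (mix S w' w) s = reading (if s \<in> S then w else w') s"
  by (cases s) (auto simp: mix_def)

lemma measurable_mix: "(\<lambda>p. mix S (fst p) (snd p)) \<in> noise_space \<Otimes>\<^sub>M noise_space \<rightarrow>\<^sub>M noise_space"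
proof (rule measurable_into_noise_space)
  fix s assume [simp]: "s \<in> sources"
  note [measurable] = measurable_reading[of s]
  show "(\<lambda>p. reading (mix S (fst p) (snd p)) s) \<in> borel_measurable (noise_space \<Otimes>\<^sub>M noise_space)"
    unfolding reading_mix by (cases "s \<in> S") simp_all
qed

text \<open>The law of the whole noise on the space of records. Independence takes the form that the
  joint law of the readings is the product of their laws, which makes the probability of a box of
  readings a product.\<close>

locale noise_law = prob_space Q for Q :: "noise measure" +
  fixes D :: "real measure" and \<sigma> :: real
  assumes sets_Q: "sets Q = sets noise_space"
    and value_law: "value_distribution D \<sigma>"
    and independent: "distr Q (PiM sources (\<lambda>_. borel)) readings
      = PiM sources (\<lambda>s. distr Q borel (\<lambda>w. reading w s))"
    and init_value_law: "\<And>i. distr Q borel (\<lambda>w. init_value w i) = D"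
    and new_value_law: "\<And>k. distr Q borel (\<lambda>w. new_value w k) = D"
    and clock_law: "\<And>e k. distributed Q lborel (\<lambda>w. clock w e k) (exponential_density 1)"
    and leaver_law: "\<And>k A. A \<in> selection_sets \<Longrightarrow>
      distr Q (count_space UNIV) (\<lambda>w. leaver w k A) = measure_pmf (pmf_of_set A)"
    and first_agent_law: "\<And>k A. A \<in> selection_sets \<Longrightarrow>
      distr Q (count_space UNIV) (\<lambda>w. first_agent w k A) = measure_pmf (pmf_of_set A)"
    and second_agent_law: "\<And>k A. A \<in> selection_sets \<Longrightarrow>
      distr Q (count_space UNIV) (\<lambda>w. second_agent w k A) = measure_pmf (pmf_of_set A)"
begin

lemma space_Q [simp]: "space Q = UNIV"
  using sets_eq_imp_space_eq[OF sets_Q] by simp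

lemma measurable_Q [simp]: "measurable Q N = measurable noise_space N"
  using sets_Q by (intro measurable_cong_sets) auto

lemma emeasure_box:
  assumes "finite J" "J \<subseteq> sources" "\<And>s. s \<in> J \<Longrightarrow> A s \<in> sets borel"
  shows "emeasure Q {w. \<forall>s\<in>J. reading w s \<in> A s}
    = (\<Prod>s\<in>J. emeasure (distr Q borel (\<lambda>w. reading w s)) (A s))"
proof -
  have "(\<Prod>s\<in>J. emeasure (distr Q borel (\<lambda>w. reading w s)) (A s))
      = emeasure (PiM sources (\<lambda>s. distr Q borel (\<lambda>w. reading w s)))
          (prod_emb sources (\<lambda>s. distr Q borel (\<lambda>w. reading w s)) J (Pi\<^sub>E J A))"
    using assms by (intro emeasure_PiM_emb[symmetric] prob_space_distr)
      (auto simp: measurable_reading)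
  also have "\<dots> = emeasure (distr Q (PiM sources (\<lambda>_. borel)) readings)
          (prod_emb sources (\<lambda>_. borel) J (Pi\<^sub>E J A))"
    by (simp add: independent prod_emb_def)
  also have "\<dots> = emeasure Q (readings -` prod_emb sources (\<lambda>_. borel) J (Pi\<^sub>E J A) \<inter> space Q)"
    using assms by (intro emeasure_distr sets_PiM_I) (auto simp: measurable_readings)
  also have "readings -` prod_emb sources (\<lambda>_. borel) J (Pi\<^sub>E J A) \<inter> space Q
      = {w. \<forall>s\<in>J. reading w s \<in> A s}"
    using assms(2) by (simp add: readings_vimage_emb)
  finally show ?thesis by simp
qed

text \<open>A box of readings splits into a condition on the first copy (sources outside
  \<open>S\<close>) and one on the second (sources in \<open>S\<close>); by independence both laws
  give it the same product, and boxes determine a finite measure on the product space.\<close>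

lemma distr_mix: "distr (Q \<Otimes>\<^sub>M Q) noise_space (\<lambda>p. mix S (fst p) (snd p)) = Q" (is "?P = Q")
proof -
  interpret QQ: pair_prob_space Q Q ..
  have Q_sets: "measurable (Q \<Otimes>\<^sub>M Q) N = measurable (noise_space \<Otimes>\<^sub>M noise_space) N" for N :: "'c measure"
    by (intro measurable_cong_sets sets_pair_measure_cong) (auto simp: sets_Q)
  have mix: "(\<lambda>p. mix S (fst p) (snd p)) \<in> Q \<Otimes>\<^sub>M Q \<rightarrow>\<^sub>M noise_space"
    unfolding Q_sets by (rule measurable_mix)
  have eq: "distr ?P (PiM sources (\<lambda>_. borel)) readings = distr Q (PiM sources (\<lambda>_. borel)) readings"
  proof (rule measure_eqI_PiM_infinite[where I = sources and M = "\<lambda>_. borel"])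
    show "finite_measure (distr ?P (PiM sources (\<lambda>_. borel)) readings)"
    proof -
      interpret P: prob_space ?P
        by (rule QQ.prob_space_distr[OF mix])
      show ?thesis
        using measurable_readings by (intro prob_space.finite_measure P.prob_space_distr) simp
    qed
    fix A and J :: "source set"
    assume J: "finite J" "J \<subseteq> sources" and A: "\<And>s. s \<in> J \<Longrightarrow> A s \<in> sets (borel :: real measure)"
    define B where "B = prod_emb sources (\<lambda>_. borel :: real measure) J (Pi\<^sub>E J A)"
    have B: "B \<in> sets (PiM sources (\<lambda>_. borel))"
      unfolding B_def using J A by (intro sets_PiM_I) auto
    have pre: "readings -` B = {w. \<forall>s\<in>J. reading w s \<in> A s}"
      using J(2) by (simp add: B_def readings_vimage_emb)
    have box: "{w. \<forall>s\<in>I. reading w s \<in> A s} \<in> sets Q" if "I \<subseteq> J" for I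
    proof -
      have "readings -` prod_emb sources (\<lambda>_. borel) I (Pi\<^sub>E I A) \<inter> space noise_space \<in> sets noise_space"
        using that J A finite_subset[OF that J(1)]
        by (intro measurable_sets[OF measurable_readings] sets_PiM_I) auto
      then show ?thesis
        using that J(2) by (simp add: sets_Q readings_vimage_emb)
    qed
    have "emeasure (distr ?P (PiM sources (\<lambda>_. borel)) readings) B
        = emeasure (Q \<Otimes>\<^sub>M Q) ({w. \<forall>s\<in>J - S. reading w s \<in> A s} \<times> {w. \<forall>s\<in>J \<inter> S. reading w s \<in> A s})"
    proof -
      have "readings -` B \<in> sets noise_space"
        using measurable_sets[OF measurable_readings B] by simp
      then show ?thesis
        using mix measurable_readings B
        by (simp add: emeasure_distr)
           (auto simp: pre reading_mix space_pair_measure intro!: arg_cong2[where f = emeasure])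
    qed
    also have "\<dots> = emeasure Q {w. \<forall>s\<in>J - S. reading w s \<in> A s} * emeasure Q {w. \<forall>s\<in>J \<inter> S. reading w s \<in> A s}"
      by (intro emeasure_pair_measure_Times box) auto
    also have "\<dots> = (\<Prod>s\<in>J - S. emeasure (distr Q borel (\<lambda>w. reading w s)) (A s))
        * (\<Prod>s\<in>J \<inter> S. emeasure (distr Q borel (\<lambda>w. reading w s)) (A s))"
      using J A by (subst (1 2) emeasure_box) auto
    also have "\<dots> = (\<Prod>s\<in>J. emeasure (distr Q borel (\<lambda>w. reading w s)) (A s))"
      using J(1) by (subst prod.union_disjoint[symmetric]) (auto intro!: prod.cong)
    also have "\<dots> = emeasure Q {w. \<forall>s\<in>J. reading w s \<in> A s}"
      using J A by (intro emeasure_box[symmetric]) auto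
    also have "\<dots> = emeasure (distr Q (PiM sources (\<lambda>_. borel)) readings) B"
      using measurable_readings B by (simp add: emeasure_distr pre)
    finally show "emeasure (distr ?P (PiM sources (\<lambda>_. borel)) readings) (prod_emb sources (\<lambda>_. borel) J (Pi\<^sub>E J A))
      = emeasure (distr Q (PiM sources (\<lambda>_. borel)) readings) (prod_emb sources (\<lambda>_. borel) J (Pi\<^sub>E J A))"
      by (simp add: B_def)
  qed simp_all
  \<comment> \<open>Every measurable set of records is the preimage under \<open>readings\<close> of
    a set in the product space, so equality of the image laws is enough.\<close>
  show ?thesis
  proof (rule measure_eqI)
    fix X assume "X \<in> sets ?P"
    then have "X \<in> {readings -` B \<inter> UNIV |B. B \<in> sets (PiM sources (\<lambda>_. borel))}"
      using readings_in_space
      by (simp add: noise_space_def sets_vimage_algebra2 image_subset_iff Pi_iff)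
    then obtain B where X: "X = readings -` B" and B: "B \<in> sets (PiM sources (\<lambda>_. borel))"
      by auto
    have "emeasure ?P X = emeasure (distr ?P (PiM sources (\<lambda>_. borel)) readings) B"
      using measurable_readings B by (simp add: emeasure_distr[of readings ?P] X)
    also have "\<dots> = emeasure Q X"
      unfolding eq using measurable_readings B by (simp add: emeasure_distr X)
    finally show "emeasure ?P X = emeasure Q X" .
  qed (simp add: sets_Q)
qed

text \<open>The tower property: Fubini together with the invariance of the law under mixing.\<close>

lemma integral_mix:
  fixes f :: "noise \<Rightarrow> real"
  assumes "integrable Q f"
  shows "(\<integral>w'. (\<integral>w. f (mix S w' w) \<partial>Q) \<partial>Q) = (\<integral>w. f w \<partial>Q)"
proof -
  interpret QQ: pair_prob_space Q Q ..
  have mix: "(\<lambda>p. mix S (fst p) (snd p)) \<in> Q \<Otimes>\<^sub>M Q \<rightarrow>\<^sub>M noise_space"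
    using measurable_mix by (subst measurable_cong_sets[OF sets_pair_measure_cong refl]) (auto simp: sets_Q)
  have f: "f \<in> borel_measurable noise_space"
    using assms by auto
  have "integrable (Q \<Otimes>\<^sub>M Q) (\<lambda>p. f (mix S (fst p) (snd p)))"
    using assms integrable_distr_eq[OF mix f] by (simp add: distr_mix)
  from QQ.integral_fst'[OF this]
  have "(\<integral>w'. (\<integral>w. f (mix S w' w) \<partial>Q) \<partial>Q) = (\<integral>p. f (mix S (fst p) (snd p)) \<partial>(Q \<Otimes>\<^sub>M Q))"
    by simp
  also have "\<dots> = (\<integral>w. f w \<partial>Q)"
    using integral_distr[OF mix f] by (simp add: distr_mix)
  finally show ?thesis .
qed

text \<open>Stands in for a comparison of conditional expectations: the two integrands need only be
  compared with the other sources held fixed, for almost every choice of these.\<close>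

lemma integral_eq_by_resampling:
  fixes f g :: "noise \<Rightarrow> real"
  assumes "integrable Q f" "integrable Q g"
    and "AE w' in Q. (\<integral>w. f (mix S w' w) \<partial>Q) = (\<integral>w. g (mix S w' w) \<partial>Q)"
  shows "(\<integral>w. f w \<partial>Q) = (\<integral>w. g w \<partial>Q)"
proof -
  have mix: "(\<lambda>p. mix S (fst p) (snd p)) \<in> Q \<Otimes>\<^sub>M Q \<rightarrow>\<^sub>M noise_space"
    using measurable_mix by (subst measurable_cong_sets[OF sets_pair_measure_cong refl]) (auto simp: sets_Q)
  have "(\<lambda>w'. \<integral>w. h (mix S w' w) \<partial>Q) \<in> borel_measurable Q"
    if "integrable Q h" for h :: "noise \<Rightarrow> real"
  proof (rule borel_measurable_lebesgue_integral)
    show "(\<lambda>(w', w). h (mix S w' w)) \<in> borel_measurable (Q \<Otimes>\<^sub>M Q)"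
      using measurable_compose[OF mix, of h] borel_measurable_integrable[OF that]
      by (simp add: case_prod_unfold)
  qed
  then have "(\<integral>w'. (\<integral>w. f (mix S w' w) \<partial>Q) \<partial>Q) = (\<integral>w'. (\<integral>w. g (mix S w' w) \<partial>Q) \<partial>Q)"
    using assms by (intro integral_cong_AE) auto
  then show ?thesis
    using assms(1,2) by (simp add: integral_mix)
qed

end

section \<open>The chain as a function of the noise, and which sources each of its steps
  reads\<close>

section \<open>The embedded chain\<close>

lemma UNIV_event: "(UNIV :: event set) = {Arrival, Departure, Gossip}"
  by (auto intro: event.exhaust)

instance event :: finite
  by standard (simp add: UNIV_event)

text \<open>What event number \<open>k\<close> may consult. Resampling these leaves the
  configuration before event \<open>k\<close> and the time \<open>T w k\<close> untouched.\<close>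

definition level_sources :: "nat \<Rightarrow> source set" where
  "level_sources k = range (\<lambda>e. Clock e k) \<union> {New_Value k} \<union> range (Leaver k)
     \<union> range (First_Agent k) \<union> range (Second_Agent k)"

text \<open>All other sources only influence the values and the names of the agents present, not the
  sizes and the event times.\<close>

definition history_sources :: "source set" where
  "history_sources = insert Init_Size (range (case_prod Clock))"

text \<open>The path properties that hold almost surely. Isolating them allows the chain to be
  studied path by path, and \<open>mix\<close> preserves them.\<close>

definition good :: "real \<Rightarrow> noise \<Rightarrow> bool" where
  "good b w \<longleftrightarrow> (\<forall>i. \<bar>init_value w i\<bar> \<le> b) \<and> (\<forall>k. \<bar>new_value w k\<bar> \<le> b) \<and> (\<forall>e k. 0 < clock w e k) \<and>
     (\<forall>k. \<forall>A\<in>selection_sets. leaver w k A \<in> A \<and> first_agent w k A \<in> A \<and> second_agent w k A \<in> A)"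

lemma good_mix: "good b w' \<Longrightarrow> good b w \<Longrightarrow> good b (mix S w' w)"
  by (auto simp: good_def mix_def)

lemma apply_event_mix:
  assumes "S \<subseteq> level_sources k" "j \<noteq> k"
  shows "apply_event (mix S w' w) j e c = apply_event w' j e c"
proof -
  have "Init_Size \<notin> S" "New_Value j \<notin> S" "Leaver j A \<notin> S" "First_Agent j A \<notin> S" "Second_Agent j A \<notin> S" for A
    using assms by (auto simp: level_sources_def)
  then show ?thesis
    by (cases c; cases e) (auto simp: mix_def)
qed

locale event_rates =
  fixes la ld lg :: real
  assumes rates_nonneg: "0 \<le> la" "0 \<le> ld" "0 \<le> lg"
begin

abbreviation "rate \<equiv> event_rate la ld lg"

abbreviation chain :: "noise \<Rightarrow> nat \<Rightarrow> config" where
  "chain \<equiv> jump_chain rate"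

definition present :: "noise \<Rightarrow> nat \<Rightarrow> nat set" where
  "present w k = fst (chain w k)"

definition vals :: "noise \<Rightarrow> nat \<Rightarrow> nat \<Rightarrow> real" where
  "vals w k = snd (chain w k)"

definition size_of :: "noise \<Rightarrow> nat \<Rightarrow> nat" where
  "size_of w k = card (present w k)"

definition ev :: "noise \<Rightarrow> nat \<Rightarrow> event" where
  "ev w k = next_event rate w k (size_of w k)"

definition T :: "noise \<Rightarrow> nat \<Rightarrow> ereal" where
  "T w k = jump_time rate w k"

definition hold :: "noise \<Rightarrow> nat \<Rightarrow> ereal" where
  "hold w k = holding_time rate w k (size_of w k)"

lemma rate_nonneg: "0 \<le> rate e n"
  using rates_nonneg by (cases e) auto

lemma T_simps: "T w 0 = 0" "T w (Suc k) = T w k + hold w k"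
  by (simp_all add: T_def hold_def size_of_def present_def)

lemma chain_0: "present w 0 = {..<init_size w}" "vals w 0 = init_value w" "size_of w 0 = init_size w"
  by (simp_all add: present_def vals_def size_of_def)

lemma chain_Suc: "chain w (Suc k) = apply_event w k (ev w k) (present w k, vals w k)"
  by (simp add: ev_def size_of_def present_def vals_def)

lemma chain_Arrival:
  assumes "ev w k = Arrival"
  shows "present w (Suc k) = insert (init_size w + k) (present w k)"
    "vals w (Suc k) = (vals w k)(init_size w + k := new_value w k)"
  unfolding present_def[of w "Suc k"] vals_def[of w "Suc k"] chain_Suc assms by simp_all

lemma chain_Departure:
  assumes "ev w k = Departure"
  shows "present w (Suc k) = present w k - {leaver w k (present w k)}" "vals w (Suc k) = vals w k"
  unfolding present_def[of w "Suc k"] vals_def[of w "Suc k"] chain_Suc assms by simp_all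

lemma chain_Gossip:
  assumes "ev w k = Gossip"
  defines "i \<equiv> first_agent w k (present w k)" and "j \<equiv> second_agent w k (present w k)"
  shows "present w (Suc k) = present w k"
    "vals w (Suc k) = (vals w k)(i := (vals w k i + vals w k j) / 2, j := (vals w k i + vals w k j) / 2)"
  unfolding present_def[of w "Suc k"] vals_def[of w "Suc k"] chain_Suc assms by (simp_all add: Let_def)

text \<open>Initial agents and arrivals before event \<open>k\<close> carry names below this bound,
  hence a newcomer at event \<open>k\<close> has a fresh name.\<close>

lemma present_bounded: "present w k \<subseteq> {..<init_size w + k}"
proof (induction k)
  case (Suc k)
  then show ?case
    by (cases "ev w k") (auto simp: chain_Arrival chain_Departure chain_Gossip less_Suc_eq)
qed (simp add: chain_0)

lemma finite_present [simp]: "finite (present w k)"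
  using present_bounded finite_subset by blast

lemma fresh_name: "init_size w + k \<notin> present w k"
  using present_bounded[of w k] by auto

text \<open>In an empty system departures and gossip have rate 0 and infinite delay. The type is
  then \<open>Arrival\<close>, even if no clock rings at all, because this type is tested
  first.\<close>

lemma present_nonempty: "ev w k \<noteq> Arrival \<Longrightarrow> present w k \<in> selection_sets"
proof -
  have "next_event rate w k 0 = Arrival"
  proof -
    have "ring_delay rate w k 0 Departure = \<infinity>" "ring_delay rate w k 0 Gossip = \<infinity>"
      by (simp_all add: ring_delay_def)
    then show ?thesis by (simp add: next_event_def holding_time_def min_def)
  qed
  then show "ev w k \<noteq> Arrival \<Longrightarrow> present w k \<in> selection_sets"
    by (auto simp: ev_def size_of_def selection_sets_def)
qed

text \<open>The reported type attains the minimal delay; if its rate is 0, that minimum is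
  infinite.\<close>

lemma rate_0_not_ringing:
  assumes "rate (ev w k) (size_of w k) = 0"
  shows "hold w k = \<infinity>"
proof -
  have "hold w k = ring_delay rate w k (size_of w k) (ev w k)"
    by (simp add: hold_def ev_def next_event_def holding_time_def min_def)
  then show ?thesis
    using assms by (simp add: ring_delay_def)
qed

text \<open>Steps before event \<open>k\<close> read neither the clocks nor the selections nor the
  new value belonging to event \<open>k\<close>.\<close>

lemma chain_mix:
  assumes "S \<subseteq> level_sources k" "j \<le> k"
  shows "chain (mix S w' w) j = chain w' j \<and> T (mix S w' w) j = T w' j"
  using assms(2)
proof (induction j)
  case 0
  have "Init_Size \<notin> S" "Init_Value i \<notin> S" for i
    using assms(1) by (auto simp: level_sources_def)
  then show ?case by (simp add: mix_def T_simps)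
next
  case (Suc j)
  have "Clock e j \<notin> S" for e
    using assms(1) Suc.prems by (auto simp: level_sources_def)
  then have "ring_delay rate (mix S w' w) j n e = ring_delay rate w' j n e" for n e
    by (simp add: mix_def ring_delay_def)
  moreover have "apply_event (mix S w' w) j e c = apply_event w' j e c" for e c
    using assms(1) Suc.prems by (intro apply_event_mix) auto
  ultimately show ?case
    using Suc by (simp add: next_event_def holding_time_def T_simps hold_def size_of_def present_def)
qed

lemma level_mix:
  assumes "S \<subseteq> level_sources k"
  shows "present (mix S w' w) k = present w' k" "vals (mix S w' w) k = vals w' k"
    "size_of (mix S w' w) k = size_of w' k" "T (mix S w' w) k = T w' k"
    "init_size (mix S w' w) = init_size w'"
proof -
  show "init_size (mix S w' w) = init_size w'"
    using assms by (auto simp: mix_def level_sources_def)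
qed (use chain_mix[OF assms, of k] in \<open>simp_all add: present_def vals_def size_of_def\<close>)

lemma level_mix_marks:
  assumes "S \<subseteq> level_sources k" "S \<inter> history_sources = {}"
  shows "ev (mix S w' w) k = ev w' k" "T (mix S w' w) (Suc k) = T w' (Suc k)"
proof -
  have "Clock e j \<notin> S" for e j
    using assms(2) by (auto simp: history_sources_def)
  then have [simp]: "ring_delay rate (mix S w' w) j n e = ring_delay rate w' j n e" for j n e
    by (simp add: mix_def ring_delay_def)
  show "ev (mix S w' w) k = ev w' k" "T (mix S w' w) (Suc k) = T w' (Suc k)"
    by (simp_all add: ev_def T_simps hold_def level_mix[OF assms(1)] next_event_def holding_time_def)
qed

lemma ring_delay_pos: "good b w \<Longrightarrow> 0 < ring_delay rate w k n e"
  using rate_nonneg[of e n] by (auto simp: ring_delay_def good_def less_le intro!: divide_pos_pos)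

lemma hold_pos: "good b w \<Longrightarrow> 0 < hold w k"
  by (simp add: hold_def holding_time_def ring_delay_pos)

lemma T_Suc_ge: "good b w \<Longrightarrow> T w k \<le> T w (Suc k)"
  using hold_pos[of b w k] by (simp add: T_simps ereal_le_add_self less_imp_le)

lemma T_mono: "good b w \<Longrightarrow> j \<le> k \<Longrightarrow> T w j \<le> T w k"
  using T_Suc_ge lift_Suc_mono_le by blast

lemma T_nonneg: "good b w \<Longrightarrow> 0 \<le> T w k"
  using T_mono[of b w 0 k] by (simp add: T_simps)

lemma vals_bounded:
  assumes "good b w" "i \<in> present w k"
  shows "\<bar>vals w k i\<bar> \<le> b"
  using assms(2)
proof (induction k arbitrary: i)
  case 0
  then show ?case using assms(1) by (auto simp: chain_0 good_def)
next
  case (Suc k)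
  show ?case
  proof (cases "ev w k")
    case Arrival
    then show ?thesis using Suc assms(1) by (auto simp: chain_Arrival good_def)
  next
    case Departure
    then show ?thesis using Suc by (auto simp: chain_Departure)
  next
    case Gossip
    then have "present w k \<in> selection_sets" by (intro present_nonempty) simp
    then have "first_agent w k (present w k) \<in> present w k" "second_agent w k (present w k) \<in> present w k"
      using assms(1) by (auto simp: good_def)
    then have "\<bar>vals w k (first_agent w k (present w k))\<bar> \<le> b" "\<bar>vals w k (second_agent w k (present w k))\<bar> \<le> b"
      using Suc.IH by auto
    then have "\<bar>(vals w k (first_agent w k (present w k)) + vals w k (second_agent w k (present w k))) / 2\<bar> \<le> b"
      by (simp add: abs_le_iff)
    then show ?thesis using Suc Gossip by (simp add: chain_Gossip)
  qed
qed

lemma size_of_Suc: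
  assumes "good b w"
  shows "size_of w (Suc k) = (case ev w k of Arrival \<Rightarrow> Suc (size_of w k)
    | Departure \<Rightarrow> size_of w k - 1 | Gossip \<Rightarrow> size_of w k)"
proof (cases "ev w k")
  case Departure
  then have "leaver w k (present w k) \<in> present w k"
    using present_nonempty[of w k] assms by (auto simp: good_def)
  then show ?thesis using Departure by (simp add: size_of_def chain_Departure)
qed (simp_all add: size_of_def chain_Arrival chain_Gossip fresh_name)

lemma size_of_le: "size_of w k \<le> init_size w + k"
  unfolding size_of_def using card_mono[OF _ present_bounded[of w k]] by simp

text \<open>Only arrivals raise the size. As they have a constant rate, this is the handle on
  non-explosion.\<close>

lemma size_of_le_arrivals:
  "size_of w k \<le> init_size w + (\<Sum>j<k. if ev w j = Arrival then 1 else 0)"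
proof (induction k)
  case (Suc k)
  have "size_of w (Suc k) \<le> size_of w k + (if ev w k = Arrival then 1 else 0)"
    by (cases "ev w k")
       (auto simp: size_of_def chain_Arrival chain_Departure chain_Gossip fresh_name intro: card_mono)
  then show ?case using Suc by simp
qed (simp add: chain_0)

text \<open>On a good path the leaver is always a present agent, so a departure lowers the size by
  exactly one, whoever leaves. Weights that depend on sizes and times can therefore be held fixed
  while values and selections are averaged.\<close>

lemma history_determined:
  assumes "good b w" "good b w'" "init_size w = init_size w'" "clock w = clock w'"
  shows "size_of w k = size_of w' k" "ev w k = ev w' k" "T w k = T w' k"
proof -
  have [simp]: "ring_delay rate w k n e = ring_delay rate w' k n e" for k n e
    using assms(4) by (simp add: ring_delay_def)
  have ev: "ev w k = ev w' k" if "size_of w k = size_of w' k" for k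
    using that by (simp add: ev_def next_event_def holding_time_def)
  have *: "size_of w k = size_of w' k \<and> T w k = T w' k" for k
  proof (induction k)
    case 0
    then show ?case using assms(3) by (simp add: chain_0 T_simps)
  next
    case (Suc k)
    then show ?case
      using ev[of k] assms(1,2)
      by (simp add: size_of_Suc T_simps hold_def holding_time_def split: event.split)
  qed
  show "size_of w k = size_of w' k" "ev w k = ev w' k" "T w k = T w' k"
    using * ev by auto
qed

subsection \<open>Measurability\<close>

lemma countable_finite_sets: "countable {A :: nat set. finite A}"
  using countable_Collect_finite by simp


lemma measurable_ring_delay [measurable]: "(\<lambda>w. ring_delay r w k n e) \<in> borel_measurable noise_space"
  unfolding ring_delay_def by measurable

lemma measurable_holding_time [measurable]: "(\<lambda>w. holding_time r w k n) \<in> borel_measurable noise_space"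
  unfolding holding_time_def by measurable

lemma measurable_next_event [measurable]: "(\<lambda>w. next_event r w k n) \<in> noise_space \<rightarrow>\<^sub>M count_space UNIV"
  unfolding next_event_def by measurable

text \<open>A selection is indexed by the random set of agents present. This set takes only
  countably many values, so each step can be treated separately for every value.\<close>

lemma measurable_chain:
  "(\<lambda>w. present w k) \<in> noise_space \<rightarrow>\<^sub>M count_space {A. finite A} \<and>
   (\<forall>i. (\<lambda>w. vals w k i) \<in> borel_measurable noise_space)"
proof (induction k)
  case 0
  have "(\<lambda>w. {..<init_size w}) \<in> noise_space \<rightarrow>\<^sub>M count_space {A. finite A}"
    by (rule measurable_compose[OF measurable_noise(1)]) simp
  then show ?case by (simp add: chain_0)
next
  case (Suc k)
  note P = Suc[THEN conjunct1] and V [measurable] = Suc[THEN conjunct2, rule_format]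
  note byP = measurable_compose_countable'[OF _ P countable_finite_sets]
  have ev: "(\<lambda>w. ev w k) \<in> noise_space \<rightarrow>\<^sub>M count_space UNIV"
    unfolding ev_def size_of_def
    by (rule byP[where f = "\<lambda>A w. next_event rate w k (card A)"]) (rule measurable_next_event)
  \<comment> \<open>Readings exist only for nonempty finite sets, so the default 0 covers the empty
    one. It changes nothing: removing an agent from the empty set has no effect, and gossip never
    occurs in an empty system.\<close>
  have sel: "(\<lambda>w. if present w k = {} then 0 else f w k (present w k)) \<in> noise_space \<rightarrow>\<^sub>M count_space UNIV"
    if "\<And>A. A \<in> selection_sets \<Longrightarrow> (\<lambda>w. f w k A) \<in> noise_space \<rightarrow>\<^sub>M count_space UNIV"
    for f :: "noise \<Rightarrow> nat \<Rightarrow> nat set \<Rightarrow> nat"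
  proof (rule byP[where f = "\<lambda>A w. if A = {} then 0 else f w k A"])
    fix A :: "nat set" assume "A \<in> {A. finite A}"
    then show "(\<lambda>w. if A = {} then 0 else f w k A) \<in> noise_space \<rightarrow>\<^sub>M count_space UNIV"
      using that[of A] by (cases "A = {}") (auto simp: selection_sets_def)
  qed
  define l where "l w = (if present w k = {} then 0 else leaver w k (present w k))" for w
  define p where "p w = (if present w k = {} then 0 else first_agent w k (present w k))" for w
  define q where "q w = (if present w k = {} then 0 else second_agent w k (present w k))" for w
  have [measurable]: "l \<in> noise_space \<rightarrow>\<^sub>M count_space UNIV"
    unfolding l_def by (rule sel[of leaver], rule measurable_selections(1))
  have [measurable]: "p \<in> noise_space \<rightarrow>\<^sub>M count_space UNIV"
    unfolding p_def by (rule sel[of first_agent], rule measurable_selections(2))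
  have [measurable]: "q \<in> noise_space \<rightarrow>\<^sub>M count_space UNIV"
    unfolding q_def by (rule sel[of second_agent], rule measurable_selections(3))
  have present: "present w (Suc k) = (case ev w k of Arrival \<Rightarrow> insert (init_size w + k) (present w k)
      | Departure \<Rightarrow> present w k - {l w} | Gossip \<Rightarrow> present w k)" for w
    by (cases "ev w k") (auto simp: chain_Arrival chain_Departure chain_Gossip l_def)
  have vals: "vals w (Suc k) i = (case ev w k of
        Arrival \<Rightarrow> if i = init_size w + k then new_value w k else vals w k i
      | Departure \<Rightarrow> vals w k i
      | Gossip \<Rightarrow> if i = p w \<or> i = q w then (vals w k (p w) + vals w k (q w)) / 2 else vals w k i)" for w i
    using present_nonempty[of w k]
    by (cases "ev w k") (auto simp: chain_Arrival chain_Departure chain_Gossip p_def q_def selection_sets_def)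
  have "(\<lambda>w. present w (Suc k)) \<in> noise_space \<rightarrow>\<^sub>M count_space {A. finite A}"
    unfolding present
  proof (rule measurable_compose_countable[OF _ ev])
    fix e
    have upd: "(\<lambda>w. insert (init_size w + k) A) \<in> noise_space \<rightarrow>\<^sub>M count_space {A. finite A}"
      "(\<lambda>w. A - {l w}) \<in> noise_space \<rightarrow>\<^sub>M count_space {A. finite A}" if "finite A" for A
    proof -
      have "(\<lambda>m. insert (m + k) A) \<in> count_space UNIV \<rightarrow>\<^sub>M count_space {A. finite A}"
        "(\<lambda>m. A - {m}) \<in> count_space UNIV \<rightarrow>\<^sub>M count_space {A. finite A}"
        using that by simp_all
      then show "(\<lambda>w. insert (init_size w + k) A) \<in> noise_space \<rightarrow>\<^sub>M count_space {A. finite A}"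
        "(\<lambda>w. A - {l w}) \<in> noise_space \<rightarrow>\<^sub>M count_space {A. finite A}"
        by measurable
    qed
    have "(\<lambda>w. insert (init_size w + k) (present w k)) \<in> noise_space \<rightarrow>\<^sub>M count_space {A. finite A}"
      by (rule byP[where f = "\<lambda>A w. insert (init_size w + k) A"]) (use upd in simp)
    moreover have "(\<lambda>w. present w k - {l w}) \<in> noise_space \<rightarrow>\<^sub>M count_space {A. finite A}"
      by (rule byP[where f = "\<lambda>A w. A - {l w}"]) (use upd in simp)
    ultimately show "(\<lambda>w. case e of Arrival \<Rightarrow> insert (init_size w + k) (present w k)
      | Departure \<Rightarrow> present w k - {l w} | Gossip \<Rightarrow> present w k) \<in> noise_space \<rightarrow>\<^sub>M count_space {A. finite A}"
      using P by (cases e) auto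
  qed
  moreover have "(\<lambda>w. vals w (Suc k) i) \<in> borel_measurable noise_space" for i
    unfolding vals
  proof (rule measurable_compose_countable[OF _ ev])
    fix e
    have [measurable]: "(\<lambda>w. vals w k (f w)) \<in> borel_measurable noise_space"
      if "f \<in> noise_space \<rightarrow>\<^sub>M count_space UNIV" for f :: "noise \<Rightarrow> nat"
      by (rule measurable_compose_countable[where f = "\<lambda>i w. vals w k i", OF V that])
    show "(\<lambda>w. case e of Arrival \<Rightarrow> if i = init_size w + k then new_value w k else vals w k i
      | Departure \<Rightarrow> vals w k i
      | Gossip \<Rightarrow> if i = p w \<or> i = q w then (vals w k (p w) + vals w k (q w)) / 2 else vals w k i)
      \<in> borel_measurable noise_space"
      by (cases e) simp_all
  qed
  ultimately show ?case by blast
qed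

lemma measurable_of_chain:
  assumes "\<And>A. finite A \<Longrightarrow> (\<lambda>w. f A w) \<in> noise_space \<rightarrow>\<^sub>M N"
  shows "(\<lambda>w. f (present w k) w) \<in> noise_space \<rightarrow>\<^sub>M N"
  by (rule measurable_compose_countable'[OF _ measurable_chain[THEN conjunct1] countable_finite_sets])
     (use assms in simp)

lemma measurable_vals [measurable]: "(\<lambda>w. vals w k i) \<in> borel_measurable noise_space"
  using measurable_chain by blast

lemma measurable_size_of [measurable]: "(\<lambda>w. size_of w k) \<in> noise_space \<rightarrow>\<^sub>M count_space UNIV"
  unfolding size_of_def by (rule measurable_of_chain) simp

lemma measurable_ev [measurable]: "(\<lambda>w. ev w k) \<in> noise_space \<rightarrow>\<^sub>M count_space UNIV"
  unfolding ev_def size_of_def by (rule measurable_of_chain) measurable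

lemma measurable_hold [measurable]: "(\<lambda>w. hold w k) \<in> borel_measurable noise_space"
  unfolding hold_def size_of_def by (rule measurable_of_chain) measurable

lemma measurable_T [measurable]: "(\<lambda>w. T w k) \<in> borel_measurable noise_space"
  by (induction k) (simp_all add: T_simps)

definition var :: "noise \<Rightarrow> nat \<Rightarrow> real" where
  "var w k = emp_var (present w k) (vals w k)"

definition mean :: "noise \<Rightarrow> nat \<Rightarrow> real" where
  "mean w k = emp_mean (present w k) (vals w k)"

lemma measurable_mean [measurable]: "(\<lambda>w. mean w k) \<in> borel_measurable noise_space"
  unfolding mean_def by (rule measurable_of_chain) (simp add: emp_mean_def)

lemma measurable_var [measurable]: "(\<lambda>w. var w k) \<in> borel_measurable noise_space"
  unfolding var_def by (rule measurable_of_chain) (simp add: emp_var_def emp_mean_def)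

end

section \<open>Exponential clocks, and properties of almost every noise\<close>

section \<open>Laws of the individual sources\<close>

text \<open>Both sides equal 1 - exp(-a). In probabilistic terms the hazard rate is 1, so the time
  at risk before \<open>a\<close> has the same mean as the indicator of a ring before
  \<open>a\<close>.\<close>

lemma (in prob_space) exponential_truncated_mean:
  assumes X: "distributed M lborel X (exponential_density 1)" and a: "0 \<le> a"
  shows "expectation (\<lambda>x. min (X x) a) = prob {x \<in> space M. X x \<le> a}"
proof -
  have X_meas [measurable]: "X \<in> borel_measurable M"
    using distributed_measurable[OF X] by simp
  have "((\<lambda>x. - (x + 1) * exp (- x)) has_real_derivative x * exp (- x)) (at x)" for x :: real
    by (auto intro!: derivative_eq_intros simp: algebra_simps)
  from has_bochner_integral_FTC_Icc_nonneg[of "\<lambda>x. x * exp (- x)" 0 a "\<lambda>x. - (x + 1) * exp (- x)", OF _ this]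
  have I: "has_bochner_integral lborel (\<lambda>x. x * exp (- x) * indicator {0..a} x) (1 - (a + 1) * exp (- a))"
    using a by (simp add: algebra_simps)
  have "expectation (\<lambda>x. X x * indicator {0..a} (X x))
      = (\<integral>x. exponential_density 1 x * (x * indicator {0..a} x) \<partial>lborel)"
    by (intro distributed_integral[OF X, symmetric]) (auto simp: exponential_density_def)
  also have "\<dots> = (\<integral>x. x * exp (- x) * indicator {0..a} x \<partial>lborel)"
    by (intro Bochner_Integration.integral_cong) (auto simp: exponential_density_def indicator_def)
  also have "\<dots> = 1 - (a + 1) * exp (- a)"
    using I by (rule has_bochner_integral_integral_eq)
  finally have body: "expectation (\<lambda>x. X x * indicator {0..a} (X x)) = 1 - (a + 1) * exp (- a)" .
  have pos: "AE x in M. 0 < X x"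
    using AE_prob_1[of "{x \<in> space M. 0 < X x}"] exponential_distributedD_gt[OF X, of 0]
    by (auto elim: eventually_mono)
  have "expectation (\<lambda>x. min (X x) a)
      = expectation (\<lambda>x. X x * indicator {0..a} (X x) + a * indicator {x \<in> space M. a < X x} x)"
    using pos by (intro integral_cong_AE) (auto elim!: eventually_mono simp: indicator_def)
  also have "\<dots> = 1 - (a + 1) * exp (- a) + a * prob {x \<in> space M. a < X x}"
  proof (subst Bochner_Integration.integral_add)
    show "integrable M (\<lambda>x. X x * indicator {0..a} (X x))"
      using a by (intro integrable_const_bound[of _ a]) (auto simp: indicator_def)
    show "integrable M (\<lambda>x. a * indicator {x \<in> space M. a < X x} x)"
      using a by (intro integrable_const_bound[of _ a]) (auto simp: indicator_def)
  qed (auto simp: body)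
  also have "\<dots> = prob {x \<in> space M. X x \<le> a}"
    using exponential_distributedD_gt[OF X a] exponential_distributedD_le[OF X a]
    by (simp add: algebra_simps)
  finally show ?thesis .
qed

lemma (in prob_space) exponential_no_atom:
  assumes X: "distributed M lborel X (exponential_density 1)"
  shows "AE x in M. X x \<noteq> a"
proof (rule AE_distrD[of X M lborel])
  show "X \<in> M \<rightarrow>\<^sub>M lborel"
    using distributed_measurable[OF X] .
  have "AE x in density lborel (\<lambda>x. ennreal (exponential_density 1 x)). x \<noteq> a"
    using distributed_borel_measurable[OF X] AE_lborel_singleton[of a]
    by (subst AE_density) (auto elim!: eventually_mono)
  then show "AE x in distr M lborel X. x \<noteq> a"
    by (subst distributed_distr_eq_density[OF X])
qed

lemma measurable_mix_right [measurable]: "mix S w' \<in> noise_space \<rightarrow>\<^sub>M noise_space"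
proof (rule measurable_into_noise_space)
  fix s assume "s \<in> sources"
  then show "(\<lambda>w. reading (mix S w' w) s) \<in> borel_measurable noise_space"
    unfolding reading_mix by (cases "s \<in> S") (simp_all add: measurable_reading)
qed

lemma countable_selection_sets: "countable selection_sets"
  by (rule countable_subset[OF _ countable_Collect_finite]) (auto simp: selection_sets_def)

text \<open>\<open>b\<close> bounds the support. On good paths it bounds the values of all agents
  present, so mean and variance are bounded uniformly in the size.\<close>

locale gossip_system = noise_law Q D \<sigma> + event_rates la ld lg
  for Q :: "noise measure" and D :: "real measure" and \<sigma> la ld lg :: real +
  fixes b :: real
  assumes b_nonneg: "0 \<le> b" and support: "AE v in D. \<bar>v\<bar> \<le> b"
begin

text \<open>A countable conjunction of almost sure statements, there being only countably many
  finite sets to select from.\<close>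

lemma AE_good: "AE w in Q. good b w"
proof -
  have "AE w in Q. \<bar>f w\<bar> \<le> b"
    if "f \<in> borel_measurable noise_space" "distr Q borel f = D" for f :: "noise \<Rightarrow> real"
    using support that(1) by (intro AE_distrD[of f Q borel]) (simp, simp only: that(2))
  then have "AE w in Q. \<forall>i. \<bar>init_value w i\<bar> \<le> b" "AE w in Q. \<forall>k. \<bar>new_value w k\<bar> \<le> b"
    unfolding AE_all_countable using init_value_law new_value_law by simp_all
  moreover have "AE w in Q. \<forall>e k. 0 < clock w e k"
    unfolding AE_all_countable
  proof (intro allI)
    fix e k
    show "AE w in Q. 0 < clock w e k"
      using AE_prob_1[of "{w. 0 < clock w e k}"] exponential_distributedD_gt[OF clock_law, of 0 e k] by simp
  qed
  moreover have "AE w in Q. f w k A \<in> A"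
    if "A \<in> selection_sets" "(\<lambda>w. f w k A) \<in> noise_space \<rightarrow>\<^sub>M count_space UNIV"
      "distr Q (count_space UNIV) (\<lambda>w. f w k A) = measure_pmf (pmf_of_set A)"
    for f :: "noise \<Rightarrow> nat \<Rightarrow> nat set \<Rightarrow> nat" and k A
  proof (rule AE_distrD[of "\<lambda>w. f w k A" Q "count_space UNIV"])
    show "AE i in distr Q (count_space UNIV) (\<lambda>w. f w k A). i \<in> A"
      unfolding that(3) using that(1) by (simp add: AE_measure_pmf_iff selection_sets_def)
  qed (use that(2) in simp)
  then have "AE w in Q. \<forall>k. \<forall>A\<in>selection_sets. leaver w k A \<in> A"
    "AE w in Q. \<forall>k. \<forall>A\<in>selection_sets. first_agent w k A \<in> A"
    "AE w in Q. \<forall>k. \<forall>A\<in>selection_sets. second_agent w k A \<in> A"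
    unfolding AE_all_countable AE_ball_countable[OF countable_selection_sets]
    by (auto intro: measurable_selections leaver_law first_agent_law second_agent_law)
  ultimately show ?thesis
    unfolding good_def by eventually_elim blast
qed

lemma integrable_good:
  fixes f :: "noise \<Rightarrow> real"
  assumes "f \<in> borel_measurable noise_space" "\<And>w. good b w \<Longrightarrow> \<bar>f w\<bar> \<le> B"
  shows "integrable Q f"
  using AE_good assms by (intro integrable_const_bound[of _ B]) (auto elim!: eventually_mono)

lemma integral_good_cong:
  fixes f g :: "noise \<Rightarrow> real"
  assumes "f \<in> borel_measurable noise_space" "g \<in> borel_measurable noise_space"
    and "\<And>w. good b w \<Longrightarrow> f w = g w"
  shows "(\<integral>w. f w \<partial>Q) = (\<integral>w. g w \<partial>Q)"
  using AE_good assms by (intro integral_cong_AE) (auto elim!: eventually_mono)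

lemma integral_good_mono:
  assumes "integrable Q f" "integrable Q g" "\<And>w. good b w \<Longrightarrow> f w \<le> (g w :: real)"
  shows "(\<integral>w. f w \<partial>Q) \<le> (\<integral>w. g w \<partial>Q)"
  using AE_good assms by (intro integral_mono_AE) (auto elim!: eventually_mono)

lemma integral_selections:
  assumes "A \<in> selection_sets"
  shows "(\<integral>w. h (leaver w k A) \<partial>Q) = (\<Sum>i\<in>A. h i) / (card A :: real)" (is ?thesis1)
    "(\<integral>w. h (first_agent w k A) \<partial>Q) = (\<Sum>i\<in>A. h i) / (card A :: real)" (is ?thesis2)
    "(\<integral>w. h (second_agent w k A) \<partial>Q) = (\<Sum>i\<in>A. h i) / (card A :: real)" (is ?thesis3)
proof -
  have *: "(\<integral>w. h (f w) \<partial>Q) = (\<Sum>i\<in>A. h i) / (card A :: real)"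
    if "f \<in> noise_space \<rightarrow>\<^sub>M count_space UNIV"
      "distr Q (count_space UNIV) f = measure_pmf (pmf_of_set A)" for f :: "noise \<Rightarrow> nat"
  proof -
    have "(\<integral>w. h (f w) \<partial>Q) = (\<integral>i. h i \<partial>distr Q (count_space UNIV) f)"
      using that by (intro integral_distr[symmetric]) auto
    then show ?thesis
      using assms by (simp add: that integral_pmf_of_set selection_sets_def)
  qed
  show ?thesis1 ?thesis2 ?thesis3
    by (rule *, rule measurable_selections, rule assms, rule leaver_law first_agent_law second_agent_law, rule assms)+
qed

lemma D_moments:
  "integrable D (\<lambda>v. v)" "(\<integral>v. v \<partial>D) = 0" "integrable D (\<lambda>v. v\<^sup>2)" "(\<integral>v. v\<^sup>2 \<partial>D) = \<sigma>\<^sup>2"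
proof -
  interpret V: value_distribution D \<sigma> by (rule value_law)
  have [measurable_cong]: "sets D = sets borel" by simp
  show "integrable D (\<lambda>v. v)"
    using support by (intro V.integrable_const_bound[of _ b]) auto
  show "(\<integral>v. v \<partial>D) = 0" by (rule V.mean_zero)
  show "integrable D (\<lambda>v. v\<^sup>2)"
    using support by (intro V.integrable_const_bound[of _ "b\<^sup>2"])
      (auto elim!: eventually_mono simp: abs_le_square_iff[symmetric])
  show "(\<integral>v. v\<^sup>2 \<partial>D) = \<sigma>\<^sup>2"
    using V.variance_eq by (simp add: V.mean_zero)
qed

section \<open>The law of one clock turns event probabilities into expected waiting times\<close>

section \<open>The clock identity\<close>

text \<open>On good paths, the length of the part of the waiting period of event \<open>k\<close>
  that lies before time \<open>t\<close>. The cap at \<open>t\<close> also makes infinite event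
  times harmless.\<close>

definition overlap :: "noise \<Rightarrow> nat \<Rightarrow> real \<Rightarrow> real" where
  "overlap w k t = real_of_ereal (min (T w (Suc k)) (ereal t)) - real_of_ereal (min (T w k) (ereal t))"

lemma overlap_mono:
  assumes w: "good b w" and s: "0 \<le> s" "s \<le> t"
  shows "overlap w k s \<le> overlap w k t" "overlap w k t - overlap w k s \<le> t - s"
  using T_nonneg[OF w, of k] T_nonneg[OF w, of "Suc k"] T_Suc_ge[OF w, of k] s
  by (cases "T w k"; cases "T w (Suc k)"; auto simp: overlap_def min_def)+

lemma measurable_overlap [measurable]: "(\<lambda>w. overlap w k t) \<in> borel_measurable noise_space"
  unfolding overlap_def by measurable

text \<open>The delay of the earliest competitor of the clock \<open>e\<close>: it stays fixed while
  that clock is resampled.\<close>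

definition other_delay :: "noise \<Rightarrow> nat \<Rightarrow> nat \<Rightarrow> event \<Rightarrow> ereal" where
  "other_delay w k n e = (case e of
     Arrival \<Rightarrow> min (ring_delay rate w k n Departure) (ring_delay rate w k n Gossip)
   | Departure \<Rightarrow> min (ring_delay rate w k n Arrival) (ring_delay rate w k n Gossip)
   | Gossip \<Rightarrow> min (ring_delay rate w k n Arrival) (ring_delay rate w k n Departure))"

lemma holding_time_eq: "holding_time rate w k n = min (ring_delay rate w k n e) (other_delay w k n e)"
  by (cases e) (simp_all add: holding_time_def other_delay_def min.commute min.left_commute)

lemma ring_delay_next_event: "ring_delay rate w k n (next_event rate w k n) = holding_time rate w k n"
  by (simp add: next_event_def holding_time_def min_def)

text \<open>Ties are resolved by a fixed order of the types, hence the strict inequality.\<close>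

lemma next_event_eqI:
  assumes "ring_delay rate w k n e < other_delay w k n e"
  shows "next_event rate w k n = e"
  using assms ring_delay_next_event[of w k n]
  unfolding holding_time_eq[of w k n e]
  by (cases e; cases "next_event rate w k n") (auto simp: other_delay_def min_def split: if_splits)

lemma other_delay_mix: "other_delay (mix {Clock e k} w' w) k n e = other_delay w' k n e"
  by (cases e) (simp_all add: other_delay_def ring_delay_def mix_def)

lemma ring_delay_mix: "ring_delay rate (mix {Clock e k} w' w) k n e = ring_delay rate w k n e"
  by (simp add: ring_delay_def mix_def)

lemma integral_clock:
  assumes "0 \<le> a"
  shows "(\<integral>w. of_bool (clock w e k \<le> a) \<partial>Q) = (\<integral>w. min (clock w e k) a \<partial>Q)"
proof -
  have "{w \<in> space noise_space. clock w e k \<le> a} \<in> sets noise_space"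
    by measurable
  then have "measure Q {w. clock w e k \<le> a} = (\<integral>w. indicator {w. clock w e k \<le> a} w \<partial>Q)"
    by (subst Bochner_Integration.integral_indicator) (simp_all add: sets_Q)
  also have "\<dots> = (\<integral>w. of_bool (clock w e k \<le> a) \<partial>Q)"
    by (intro Bochner_Integration.integral_cong) (simp_all add: indicator_def)
  finally show ?thesis
    using exponential_truncated_mean[OF clock_law assms] by simp
qed

text \<open>With all else frozen, an event of type \<open>e\<close> occurs by time \<open>t\<close>
  exactly if its clock stays below a threshold (up to a tie), and rate times waiting time is the
  clock truncated at the same threshold. The truncated mean of the exponential law equates the
  two.\<close>

lemma clock_identity_frozen:
  fixes e :: event and k :: nat
  assumes w': "good b w'" and t: "0 \<le> t"
  defines "W \<equiv> mix {Clock e k} w'"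
  shows "(\<integral>w. of_bool (ev (W w) k = e \<and> T (W w) (Suc k) \<le> ereal t) \<partial>Q)
    = (\<integral>w. rate e (size_of w' k) * overlap (W w) k t \<partial>Q)"
proof -
  have lev: "{Clock e k} \<subseteq> level_sources k" by (auto simp: level_sources_def)
  define n r m where "n = size_of w' k" and "r = rate e n" and "m = other_delay w' k n e"
  have W: "size_of (W w) k = n" "T (W w) k = T w' k" for w
    using level_mix[OF lev] by (simp_all add: W_def n_def)
  have T_Suc: "T (W w) (Suc k) = T w' k + hold (W w) k" for w
    by (simp add: T_simps W)
  have hold: "hold (W w) k = min (ring_delay rate w k n e) m" for w
    unfolding hold_def W holding_time_eq[of "W w" k n e] by (simp add: W_def ring_delay_mix other_delay_mix m_def)
  have ev_le: "ring_delay rate w k n e \<le> m" if "ev (W w) k = e" for w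
    using ring_delay_next_event[of "W w" k n] that
    by (simp add: ev_def W holding_time_eq[of "W w" k n e]) (simp add: W_def ring_delay_mix other_delay_mix m_def min_def split: if_splits)
  have ev_eq: "ev (W w) k = e" if "ring_delay rate w k n e < m" for w
    unfolding ev_def W using that
    by (intro next_event_eqI) (simp add: W_def ring_delay_mix other_delay_mix m_def)
  have m_pos: "0 < m"
    using ring_delay_pos[OF w'] by (cases e) (simp_all add: m_def other_delay_def)
  have d_pos: "0 < ring_delay rate w k n e" if "good b w" for w
    using ring_delay_pos[OF that] .
  have T0: "0 \<le> T w' k" by (rule T_nonneg[OF w'])
  have [measurable]: "W \<in> noise_space \<rightarrow>\<^sub>M noise_space"
    unfolding W_def by (rule measurable_mix_right)
  show ?thesis
  proof (cases "r = 0 \<or> ereal t \<le> T w' k")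
    \<comment> \<open>Degenerate case: type \<open>e\<close> has rate 0, or the waiting does not
      start before \<open>t\<close>. Both integrands vanish on good paths.\<close>
    case True
    have zero: "\<not> (ev (W w) k = e \<and> T (W w) (Suc k) \<le> ereal t)" "r * overlap (W w) k t = 0" if "good b w" for w
    proof -
      have h: "0 < hold (W w) k"
        using m_pos d_pos[OF that] by (simp add: hold)
      show "\<not> (ev (W w) k = e \<and> T (W w) (Suc k) \<le> ereal t)"
      proof
        assume *: "ev (W w) k = e \<and> T (W w) (Suc k) \<le> ereal t"
        show False
        proof (cases "r = 0")
          case True
          then have "hold (W w) k = \<infinity>"
            using * by (intro rate_0_not_ringing) (simp add: W r_def)
          then show False using * T0 by (simp add: T_Suc)
        next
          case False
          then have "ereal t \<le> T w' k" using \<open>r = 0 \<or> _\<close> by simp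
          then show False using * h T0
            by (cases "T w' k"; cases "hold (W w) k") (auto simp: T_Suc)
        qed
      qed
      show "r * overlap (W w) k t = 0"
      proof (cases "r = 0")
        case False
        then have "ereal t \<le> T w' k" using \<open>r = 0 \<or> _\<close> by simp
        moreover have "T w' k \<le> T (W w) (Suc k)"
          using h by (simp add: T_Suc ereal_le_add_self less_imp_le)
        ultimately have "min (T (W w) (Suc k)) (ereal t) = ereal t" "min (T (W w) k) (ereal t) = ereal t"
          by (auto simp: W min_def)
        then show ?thesis by (simp add: overlap_def)
      qed simp
    qed
    have "(\<integral>w. of_bool (ev (W w) k = e \<and> T (W w) (Suc k) \<le> ereal t) \<partial>Q)
        = (\<integral>w. r * overlap (W w) k t \<partial>Q)"
    proof (rule integral_good_cong)
      fix w assume "good b w"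
      from zero[OF this] show "of_bool (ev (W w) k = e \<and> T (W w) (Suc k) \<le> ereal t) = r * overlap (W w) k t"
        by auto
    qed measurable
    then show ?thesis by (simp add: r_def n_def)
  next
    case False
    then obtain x where x: "T w' k = ereal x" "0 \<le> x" "x < t"
      using T0 by (cases "T w' k") auto
    have r: "0 < r" using False rate_nonneg[of e n] by (simp add: r_def less_le)
    have d: "ring_delay rate w k n e = ereal (clock w e k / r)" for w
      using r by (simp add: ring_delay_def r_def)
    \<comment> \<open>\<open>c\<close> is the time available to the clock: until the horizon
      \<open>t\<close> or until a competitor rings, whichever comes first.\<close>
    obtain c where c: "ereal c = min (ereal (t - x)) m" "0 < c"
    proof (cases "min (ereal (t - x)) m")
      case (real c)
      moreover have "0 < min (ereal (t - x)) m"
        using m_pos x by simp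
      ultimately show ?thesis using that[of c] by simp
    next
      case PInf
      then show ?thesis by (simp add: min_def split: if_splits)
    next
      case MInf
      then show ?thesis using m_pos by (simp add: min_def split: if_splits)
    qed
    \<comment> \<open>At \<open>clock w e k = r * c\<close> the tie rule might pick another type;
      the exponential law has no atom there.\<close>
    have ind: "AE w in Q. of_bool (ev (W w) k = e \<and> T (W w) (Suc k) \<le> ereal t)
        = (of_bool (clock w e k \<le> r * c) :: real)"
      using exponential_no_atom[OF clock_law[of e k], of "r * c"]
    proof eventually_elim
      case (elim w)
      have "ev (W w) k = e \<and> T (W w) (Suc k) \<le> ereal t \<longleftrightarrow> clock w e k \<le> r * c"
      proof
        assume *: "ev (W w) k = e \<and> T (W w) (Suc k) \<le> ereal t"
        then have le: "ereal (clock w e k / r) \<le> m" using ev_le[of w] d by simp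
        then have "T (W w) (Suc k) = ereal (x + clock w e k / r)"
          by (simp add: T_Suc x hold d min_absorb1)
        then have "ereal (clock w e k / r) \<le> ereal (t - x)" using * by simp
        with le have "clock w e k / r \<le> c" unfolding c(1)[symmetric] ereal_less_eq(3)[symmetric] by (simp add: c(1))
        then show "clock w e k \<le> r * c" using r by (simp add: field_simps)
      next
        assume "clock w e k \<le> r * c"
        with elim r have "ereal (clock w e k / r) < ereal c" by (simp add: field_simps)
        then have lt: "ereal (clock w e k / r) < m" "ereal (clock w e k / r) < ereal (t - x)"
          unfolding c(1) by (simp_all only: min_less_iff_conj)
        then have "T (W w) (Suc k) = ereal (x + clock w e k / r)"
          by (simp add: T_Suc x hold d min_absorb1 less_imp_le)
        then show "ev (W w) k = e \<and> T (W w) (Suc k) \<le> ereal t"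
          using lt ev_eq[of w] d by simp
      qed
      then show ?case by simp
    qed
    have ov: "r * overlap (W w) k t = min (clock w e k) (r * c)" for w
    proof -
      have "min (T (W w) (Suc k)) (ereal t) = ereal x + min (ereal (clock w e k / r)) (ereal c)"
        unfolding T_Suc hold d x(1) c(1)
        using x by (cases m) (auto simp: min_def)
      then have "overlap (W w) k t = min (clock w e k / r) c"
        using x by (simp add: overlap_def W flip: ereal_min)
      then show ?thesis
        using r by (simp add: min_def field_simps)
    qed
    have "(\<integral>w. of_bool (ev (W w) k = e \<and> T (W w) (Suc k) \<le> ereal t) \<partial>Q)
        = (\<integral>w. (of_bool (clock w e k \<le> r * c) :: real) \<partial>Q)"
    proof (rule integral_cong_AE)
      show "AE w in Q. of_bool (ev (W w) k = e \<and> T (W w) (Suc k) \<le> ereal t)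
          = (of_bool (clock w e k \<le> r * c) :: real)"
        by (rule ind)
    qed (simp_all only: measurable_Q, measurable)
    also have "\<dots> = (\<integral>w. r * overlap (W w) k t \<partial>Q)"
      using r c by (simp add: ov integral_clock)
    finally show ?thesis by (simp add: r_def n_def)
  qed
qed

lemma overlap_nonneg: "good b w \<Longrightarrow> 0 \<le> t \<Longrightarrow> 0 \<le> overlap w k t"
  using T_nonneg[of b w k] T_nonneg[of b w "Suc k"] T_Suc_ge[of b w k]
  by (cases "T w k"; cases "T w (Suc k)") (auto simp: overlap_def min_def)

text \<open>The waiting periods tile the time axis, so the sum telescopes.\<close>

lemma sum_overlap:
  "good b w \<Longrightarrow> 0 \<le> t \<Longrightarrow> (\<Sum>k<K. overlap w k t) = real_of_ereal (min (T w K) (ereal t))"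
  unfolding overlap_def by (subst sum_lessThan_telescope) (simp add: T_simps min_def)

lemma sum_overlap_le: "good b w \<Longrightarrow> 0 \<le> t \<Longrightarrow> (\<Sum>k<K. overlap w k t) \<le> t"
  using T_nonneg[of b w K] by (cases "T w K") (auto simp: sum_overlap min_def)

lemma overlap_le: "good b w \<Longrightarrow> 0 \<le> t \<Longrightarrow> overlap w k t \<le> t"
  using sum_overlap_le[of w t "Suc k"] sum_nonneg[of "{..<k}" "\<lambda>k. overlap w k t"] overlap_nonneg[of w t]
  by simp

theorem clock_identity:
  assumes Z: "Z \<in> borel_measurable noise_space"
    and bound: "\<And>w. good b w \<Longrightarrow> \<bar>Z w\<bar> \<le> B" "\<And>w. good b w \<Longrightarrow> \<bar>Z w * rate e (size_of w k)\<bar> \<le> B"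
    and inv: "\<And>w w'. good b w \<Longrightarrow> good b w' \<Longrightarrow> Z (mix {Clock e k} w' w) = Z w'"
    and t: "0 \<le> t"
  shows "(\<integral>w. Z w * of_bool (ev w k = e \<and> T w (Suc k) \<le> ereal t) \<partial>Q)
    = (\<integral>w. Z w * rate e (size_of w k) * overlap w k t \<partial>Q)"
proof (rule integral_eq_by_resampling[where S = "{Clock e k}"])
  note [measurable] = Z
  have [measurable]: "(\<lambda>w. rate e (size_of w k)) \<in> borel_measurable noise_space"
    by measurable
  show "integrable Q (\<lambda>w. Z w * of_bool (ev w k = e \<and> T w (Suc k) \<le> ereal t))"
    using bound(1) by (intro integrable_good[of _ B]) (auto simp: of_bool_def intro: order_trans[OF abs_ge_zero])
  have "\<bar>Z w * rate e (size_of w k) * overlap w k t\<bar> \<le> B * t" if "good b w" for w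
    using bound(2)[OF that] overlap_nonneg[OF that t] overlap_le[OF that t]
    unfolding abs_mult[of _ "overlap w k t"]
    by (intro mult_mono) (auto intro: order_trans[OF abs_ge_zero])
  then show "integrable Q (\<lambda>w. Z w * rate e (size_of w k) * overlap w k t)"
    by (intro integrable_good[of _ "B * t"]) auto
  have lev: "{Clock e k} \<subseteq> level_sources k" by (auto simp: level_sources_def)
  let ?W = "mix {Clock e k}"
  show "AE w' in Q. (\<integral>w. Z (?W w' w) * of_bool (ev (?W w' w) k = e \<and> T (?W w' w) (Suc k) \<le> ereal t) \<partial>Q)
      = (\<integral>w. Z (?W w' w) * rate e (size_of (?W w' w) k) * overlap (?W w' w) k t \<partial>Q)"
    using AE_good
  proof eventually_elim
    case (elim w')
    have "(\<integral>w. Z (?W w' w) * of_bool (ev (?W w' w) k = e \<and> T (?W w' w) (Suc k) \<le> ereal t) \<partial>Q)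
        = (\<integral>w. Z w' * of_bool (ev (?W w' w) k = e \<and> T (?W w' w) (Suc k) \<le> ereal t) \<partial>Q)"
      using inv elim by (intro integral_good_cong) auto
    also have "\<dots> = (\<integral>w. Z w' * (rate e (size_of w' k) * overlap (?W w' w) k t) \<partial>Q)"
      using clock_identity_frozen[OF elim t, of e k] by simp
    also have "\<dots> = (\<integral>w. Z (?W w' w) * rate e (size_of (?W w' w) k) * overlap (?W w' w) k t \<partial>Q)"
      using inv elim by (intro integral_good_cong) (auto simp: level_mix[OF lev])
    finally show ?case .
  qed
qed

section \<open>Mean change of the variance when the random choices of one event are averaged
  out\<close>

section \<open>Expected effect of an event\<close>

lemma var_nonneg: "0 \<le> var w k"
  by (simp add: var_def emp_var_nonneg)

lemma var_le: "good b w \<Longrightarrow> var w k \<le> b\<^sup>2"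
  unfolding var_def by (intro emp_var_le vals_bounded) auto

lemma mean_square_le: "good b w \<Longrightarrow> (mean w k)\<^sup>2 \<le> b\<^sup>2"
  unfolding mean_def using b_nonneg
  by (intro abs_le_square_iff[THEN iffD1]) (auto intro!: emp_mean_abs_le vals_bounded)

lemma var_size_0: "size_of w k = 0 \<Longrightarrow> var w k = 0"
  by (simp add: var_def size_of_def emp_var_def)

lemma mean_size_0: "size_of w k = 0 \<Longrightarrow> mean w k = 0"
  by (simp add: mean_def size_of_def emp_mean_def)

lemma level_mix_var_mean:
  assumes "S \<subseteq> level_sources k"
  shows "var (mix S w' w) k = var w' k" "mean (mix S w' w) k = mean w' k"
  using level_mix[OF assms] by (simp_all add: var_def mean_def)

text \<open>The cross term drops out because the distribution has mean 0.\<close>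

lemma integral_affine_square:
  assumes [measurable]: "f \<in> borel_measurable noise_space" and "distr Q borel f = D"
  shows "(\<integral>w. a + c * (f w + d)\<^sup>2 \<partial>Q) = a + c * (\<sigma>\<^sup>2 + d\<^sup>2)"
proof -
  interpret V: value_distribution D \<sigma> by (rule value_law)
  have "(\<integral>w. a + c * (f w + d)\<^sup>2 \<partial>Q) = (\<integral>v. a + c * (v + d)\<^sup>2 \<partial>D)"
    unfolding assms(2)[symmetric] by (intro integral_distr[symmetric]) auto
  also have "\<dots> = (\<integral>v. (a + c * d\<^sup>2) + (c * v\<^sup>2 + 2 * c * d * v) \<partial>D)"
    by (simp add: power2_sum algebra_simps)
  also have "\<dots> = (a + c * d\<^sup>2) + (c * \<sigma>\<^sup>2 + 2 * c * d * 0)"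
    using D_moments V.prob_space by simp
  finally show ?thesis by (simp add: algebra_simps)
qed

lemma integral_square_shift:
  assumes "f \<in> borel_measurable noise_space" and "distr Q borel f = D"
  shows "(\<integral>w. (f w + c)\<^sup>2 \<partial>Q) = \<sigma>\<^sup>2 + c\<^sup>2"
  using integral_affine_square[OF assms, of 0 1 c] by simp

text \<open>Resampling only the second selection makes the first one a constant; this is where the
  independence of the two agents enters.\<close>

lemma integral_two_selections:
  assumes A: "A \<in> selection_sets"
  shows "(\<integral>w. h (first_agent w k A) (second_agent w k A) \<partial>Q)
    = (\<Sum>i\<in>A. (\<Sum>j\<in>A. h i j) / card A) / (card A :: real)"
proof -
  define f where "f w = h (first_agent w k A) (second_agent w k A)" for w :: noise
  note [measurable] = measurable_selections[OF A]
  have [measurable]: "f \<in> borel_measurable noise_space"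
    unfolding f_def
    by (rule measurable_compose_countable[OF measurable_compose_countable[where f = "\<lambda>j w. h _ j"]]) measurable
  have "\<bar>f w\<bar> \<le> (\<Sum>i\<in>A. \<Sum>j\<in>A. \<bar>h i j\<bar>)" if "good b w" for w
  proof -
    have fin: "finite A" and ij: "first_agent w k A \<in> A" "second_agent w k A \<in> A"
      using A that by (auto simp: selection_sets_def good_def)
    have "\<bar>f w\<bar> \<le> (\<Sum>j\<in>A. \<bar>h (first_agent w k A) j\<bar>)"
      unfolding f_def using fin ij by (intro member_le_sum) auto
    also have "\<dots> \<le> (\<Sum>i\<in>A. \<Sum>j\<in>A. \<bar>h i j\<bar>)"
      using fin ij by (intro member_le_sum[of "first_agent w k A"]) (auto intro: sum_nonneg)
    finally show ?thesis .
  qed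
  then have "integrable Q f"
    by (intro integrable_good) auto
  from integral_mix[OF this, of "range (Second_Agent k)"]
  have "(\<integral>w. f w \<partial>Q) = (\<integral>w'. (\<integral>w. h (first_agent w' k A) (second_agent w k A) \<partial>Q) \<partial>Q)"
    by (simp add: f_def mix_def image_iff)
  also have "\<dots> = (\<Sum>i\<in>A. (\<Sum>j\<in>A. h i j) / card A) / card A"
    unfolding integral_selections(3)[OF A] by (rule integral_selections(2)[OF A])
  finally show ?thesis by (simp add: f_def)
qed

lemma integral_by_resampling_marks:
  fixes Z F G :: "noise \<Rightarrow> real"
  assumes S: "S \<subseteq> level_sources k" "S \<inter> history_sources = {}"
    and [measurable]: "Z \<in> borel_measurable noise_space" "F \<in> borel_measurable noise_space"
      "G \<in> borel_measurable noise_space"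
    and Z: "\<And>w. good b w \<Longrightarrow> \<bar>Z w\<bar> \<le> B" "\<And>w w'. good b w \<Longrightarrow> good b w' \<Longrightarrow> Z (mix S w' w) = Z w'"
    and F: "\<And>w. good b w \<Longrightarrow> \<bar>F w\<bar> \<le> B'"
    and G: "\<And>w. good b w \<Longrightarrow> \<bar>G w\<bar> \<le> B'" "\<And>w w'. good b w \<Longrightarrow> good b w' \<Longrightarrow> G (mix S w' w) = G w'"
    and frozen: "\<And>w'. good b w' \<Longrightarrow> ev w' k = e \<Longrightarrow> Z w' \<noteq> 0 \<Longrightarrow> (\<integral>w. F (mix S w' w) \<partial>Q) = G w'"
  shows "(\<integral>w. Z w * of_bool (ev w k = e) * F w \<partial>Q) = (\<integral>w. Z w * of_bool (ev w k = e) * G w \<partial>Q)"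
proof (rule integral_eq_by_resampling[where S = S])
  have bd: "\<bar>Z w * of_bool (ev w k = e) * H w\<bar> \<le> B * B'" if "good b w" "\<bar>H w\<bar> \<le> B'" for H :: "noise \<Rightarrow> real" and w
    using Z(1)[OF that(1)] that(2) unfolding abs_mult
    by (intro mult_mono) (auto intro: order_trans[OF abs_ge_zero])
  show "integrable Q (\<lambda>w. Z w * of_bool (ev w k = e) * F w)" "integrable Q (\<lambda>w. Z w * of_bool (ev w k = e) * G w)"
    using F G(1) by (intro integrable_good[OF _ bd]; simp)+
  show "AE w' in Q. (\<integral>w. Z (mix S w' w) * of_bool (ev (mix S w' w) k = e) * F (mix S w' w) \<partial>Q)
      = (\<integral>w. Z (mix S w' w) * of_bool (ev (mix S w' w) k = e) * G (mix S w' w) \<partial>Q)"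
    using AE_good
  proof eventually_elim
    case (elim w')
    have "(\<integral>w. Z (mix S w' w) * of_bool (ev (mix S w' w) k = e) * F (mix S w' w) \<partial>Q)
        = (\<integral>w. Z w' * of_bool (ev w' k = e) * F (mix S w' w) \<partial>Q)"
      using elim by (intro integral_good_cong) (simp_all add: Z(2) level_mix_marks[OF S])
    also have "\<dots> = Z w' * of_bool (ev w' k = e) * G w'"
      using frozen[OF elim] by (cases "Z w' = 0 \<or> ev w' k \<noteq> e") auto
    also have "\<dots> = (\<integral>w. Z w' * of_bool (ev w' k = e) * G w' \<partial>Q)"
      using prob_space by simp
    also have "\<dots> = (\<integral>w. Z (mix S w' w) * of_bool (ev (mix S w' w) k = e) * G (mix S w' w) \<partial>Q)"
      using elim by (intro integral_good_cong) (simp_all add: Z(2) G(2) level_mix_marks[OF S])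
    finally show ?case .
  qed
qed

text \<open>Everything that decides what event \<open>k\<close> does once its type and time are
  given.\<close>

definition marks :: "nat \<Rightarrow> source set" where
  "marks k = level_sources k - history_sources"

lemma marks_subsets:
  "{New_Value k} \<subseteq> marks k" "range (Leaver k) \<subseteq> marks k"
  "range (First_Agent k) \<union> range (Second_Agent k) \<subseteq> marks k"
  by (auto simp: marks_def level_sources_def history_sources_def)

text \<open>For \<open>n = 1\<close> the departure term is \<open>0\<close> because the variance is \<open>0\<close>.\<close>

definition drift :: "event \<Rightarrow> noise \<Rightarrow> nat \<Rightarrow> real" where
  "drift e w k = (let n = real (size_of w k) in case e of
     Arrival \<Rightarrow> n / (n + 1)\<^sup>2 * (\<sigma>\<^sup>2 + (mean w k)\<^sup>2) - var w k / (n + 1)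
   | Departure \<Rightarrow> - (var w k / (n - 1)\<^sup>2)
   | Gossip \<Rightarrow> - (var w k / n))"

lemma measurable_drift [measurable]: "(\<lambda>w. drift e w k) \<in> borel_measurable noise_space"
  unfolding drift_def Let_def by (cases e) simp_all

text \<open>In the arrival drift the first term is at most \<sigma>^2 + b^2 and the subtracted one
  at most b^2; departures and gossip stay below b^2.\<close>

definition drift_bound :: real where
  "drift_bound = \<sigma>\<^sup>2 + 2 * b\<^sup>2"

lemma drift_bound_nonneg: "0 \<le> drift_bound"
  by (simp add: drift_bound_def)

lemma abs_jump_le: "good b w \<Longrightarrow> \<bar>var w (Suc k) - var w k\<bar> \<le> drift_bound"
  using var_nonneg[of w k] var_nonneg[of w "Suc k"] var_le[of w k] var_le[of w "Suc k"]
    zero_le_power2[of b] zero_le_power2[of \<sigma>]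
  unfolding drift_bound_def abs_le_iff by linarith

lemma weight_le_1: "0 \<le> x \<Longrightarrow> x / (x + 1)\<^sup>2 \<le> 1" for x :: real
  by (simp add: divide_le_eq_1 power2_eq_square algebra_simps add_pos_nonneg)

text \<open>The second bound is the crucial one, as the rates may be unbounded. For gossip the size
  cancels; for departures n <= 2 (n-1)^2 when n >= 2, whence the factor 2, and at smaller sizes the
  departure term is 0.\<close>

lemma abs_drift_le:
  assumes "good b w"
  shows "\<bar>drift e w k\<bar> \<le> drift_bound" "\<bar>drift e w k * rate e (size_of w k)\<bar> \<le> drift_bound * (la + 2 * ld + lg)"
proof -
  define n V m where "n = real (size_of w k)" and "V = var w k" and "m = (mean w k)\<^sup>2"
  have n: "0 \<le> n" and V: "0 \<le> V" "V \<le> b\<^sup>2" and m: "0 \<le> m" "m \<le> b\<^sup>2"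
    using var_nonneg var_le[OF assms] mean_square_le[OF assms] by (simp_all add: n_def V_def m_def)
  have V0: "V = 0" if "n = 0" using that var_size_0 by (simp add: n_def V_def)
  have n_cases: "n = 0 \<or> n = 1 \<or> 2 \<le> n"
    by (cases "size_of w k"; cases "size_of w k - 1") (auto simp: n_def)
  have b2: "b\<^sup>2 \<le> drift_bound" "0 \<le> b\<^sup>2" by (simp_all add: drift_bound_def)
  have arr: "\<bar>drift Arrival w k\<bar> \<le> drift_bound"
  proof -
    have "n / (n + 1)\<^sup>2 * (\<sigma>\<^sup>2 + m) \<le> 1 * (\<sigma>\<^sup>2 + b\<^sup>2)"
      using weight_le_1[OF n] m by (intro mult_mono) auto
    moreover have "0 \<le> n / (n + 1)\<^sup>2 * (\<sigma>\<^sup>2 + m)" using n m by simp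
    moreover have "V / (n + 1) \<le> V / 1" using V n by (intro divide_left_mono) auto
    moreover have "0 \<le> V / (n + 1)" using V n by simp
    ultimately show ?thesis
      using V m by (simp add: drift_def Let_def abs_le_iff drift_bound_def flip: n_def V_def m_def)
  qed
  have dep: "V / (n - 1)\<^sup>2 \<le> b\<^sup>2" "V / (n - 1)\<^sup>2 * n \<le> 2 * b\<^sup>2"
  proof -
    have "V / (n - 1)\<^sup>2 \<le> b\<^sup>2 \<and> V / (n - 1)\<^sup>2 * n \<le> 2 * b\<^sup>2"
      using n_cases
    proof (elim disjE)
      assume "2 \<le> n"
      define q where "q = (n - 1)\<^sup>2"
      have "n - 1 \<le> q"
        unfolding q_def power2_eq_square using \<open>2 \<le> n\<close> mult_right_mono[of 1 "n - 1" "n - 1"] by simp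
      then have s: "1 \<le> (n - 1)\<^sup>2" "n \<le> 2 * (n - 1)\<^sup>2"
        using \<open>2 \<le> n\<close> unfolding q_def[symmetric] by linarith+
      have "V / (n - 1)\<^sup>2 \<le> V / 1" using s V by (intro divide_left_mono) auto
      moreover have "V / (n - 1)\<^sup>2 * n \<le> V / (n - 1)\<^sup>2 * (2 * (n - 1)\<^sup>2)"
        using s V by (intro mult_left_mono) auto
      moreover have "V / (n - 1)\<^sup>2 * (2 * (n - 1)\<^sup>2) = 2 * V" using \<open>2 \<le> n\<close> by simp
      ultimately show ?thesis using V by simp
    qed (use V0 V in auto)
    then show "V / (n - 1)\<^sup>2 \<le> b\<^sup>2" "V / (n - 1)\<^sup>2 * n \<le> 2 * b\<^sup>2" by auto
  qed
  have gos: "V / n \<le> b\<^sup>2" "V / n * n \<le> b\<^sup>2"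
  proof -
    show "V / n * n \<le> b\<^sup>2" using V0 V by auto
    show "V / n \<le> b\<^sup>2" using n_cases
    proof (elim disjE)
      assume "2 \<le> n"
      then have "V / n \<le> V / 1" using V by (intro divide_left_mono) auto
      then show ?thesis using V by simp
    qed (use V0 V in auto)
  qed
  show "\<bar>drift e w k\<bar> \<le> drift_bound"
    using arr dep gos V n b2 by (cases e) (auto simp: drift_def Let_def simp flip: n_def V_def)
  show "\<bar>drift e w k * rate e (size_of w k)\<bar> \<le> drift_bound * (la + 2 * ld + lg)"
  proof (cases e)
    case Arrival
    have "\<bar>drift Arrival w k\<bar> * la \<le> drift_bound * (la + 2 * ld + lg)"
      using arr rates_nonneg by (intro mult_mono) auto
    then show ?thesis using Arrival rates_nonneg by (simp add: abs_mult)
  next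
    case Departure
    have "\<bar>drift Departure w k * rate Departure (size_of w k)\<bar> = (V / (n - 1)\<^sup>2 * n) * ld"
      using V n rates_nonneg by (simp add: drift_def Let_def abs_mult flip: n_def V_def)
    also have "\<dots> \<le> (2 * b\<^sup>2) * ld"
      using dep(2) rates_nonneg by (intro mult_right_mono) auto
    also have "\<dots> = b\<^sup>2 * (2 * ld)" by simp
    also have "\<dots> \<le> drift_bound * (la + 2 * ld + lg)"
      using b2 rates_nonneg drift_bound_nonneg by (intro mult_mono) auto
    finally show ?thesis using Departure by simp
  next
    case Gossip
    have "\<bar>drift Gossip w k * rate Gossip (size_of w k)\<bar> = (V / n * n) * lg"
      using V n rates_nonneg by (simp add: drift_def Let_def abs_mult flip: n_def V_def)
    also have "\<dots> \<le> drift_bound * (la + 2 * ld + lg)"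
      using gos(2) b2 rates_nonneg drift_bound_nonneg V n by (intro mult_mono) auto
    finally show ?thesis using Gossip by simp
  qed
qed

lemma frozen_Arrival:
  assumes "ev w' k = Arrival"
  defines "S \<equiv> {New_Value k}" and "n \<equiv> real (size_of w' k)"
  shows "(\<integral>w. var (mix S w' w) (Suc k) \<partial>Q)
      = n / (n + 1) * var w' k + n / (n + 1)\<^sup>2 * (\<sigma>\<^sup>2 + (mean w' k)\<^sup>2)"
    "(\<integral>w. (mean (mix S w' w) (Suc k))\<^sup>2 \<partial>Q) = (n\<^sup>2 * (mean w' k)\<^sup>2 + \<sigma>\<^sup>2) / (n + 1)\<^sup>2"
proof -
  have S: "S \<subseteq> level_sources k" "S \<inter> history_sources = {}"
    using marks_subsets(1)[of k] by (auto simp: S_def marks_def)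
  have ev: "ev (mix S w' w) k = Arrival" for w
    by (simp add: level_mix_marks[OF S] assms(1))
  have chain: "present (mix S w' w) (Suc k) = insert (init_size w' + k) (present w' k)"
    "vals (mix S w' w) (Suc k) = (vals w' k)(init_size w' + k := new_value w k)" for w
    using chain_Arrival[OF ev[of w]] by (simp_all add: level_mix[OF S(1)]) (simp add: mix_def S_def)
  have "var (mix S w' w) (Suc k) = n / (n + 1) * var w' k + n / (n + 1)\<^sup>2 * (new_value w k + - mean w' k)\<^sup>2" for w
    unfolding var_def[of _ "Suc k"] chain
    by (subst emp_var_arrival) (simp_all add: fresh_name n_def size_of_def var_def mean_def)
  then show "(\<integral>w. var (mix S w' w) (Suc k) \<partial>Q)
      = n / (n + 1) * var w' k + n / (n + 1)\<^sup>2 * (\<sigma>\<^sup>2 + (mean w' k)\<^sup>2)"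
    using integral_affine_square[of "\<lambda>w. new_value w k" "n / (n + 1) * var w' k" "n / (n + 1)\<^sup>2" "- mean w' k"]
    by (simp add: new_value_law)
  have "(mean (mix S w' w) (Suc k))\<^sup>2 = 0 + 1 / (n + 1)\<^sup>2 * (new_value w k + n * mean w' k)\<^sup>2" for w
    unfolding mean_def[of _ "Suc k"] chain
    by (subst emp_mean_arrival[OF finite_present fresh_name])
       (simp add: n_def size_of_def mean_def power_divide add.commute)
  then show "(\<integral>w. (mean (mix S w' w) (Suc k))\<^sup>2 \<partial>Q) = (n\<^sup>2 * (mean w' k)\<^sup>2 + \<sigma>\<^sup>2) / (n + 1)\<^sup>2"
    using integral_affine_square[of "\<lambda>w. new_value w k" 0 "1 / (n + 1)\<^sup>2" "n * mean w' k"]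
    by (simp add: new_value_law power_mult_distrib add.commute)
qed

lemma frozen_Departure:
  assumes "ev w' k = Departure"
  defines "S \<equiv> range (Leaver k)" and "n \<equiv> real (size_of w' k)"
  shows "(\<integral>w. var (mix S w' w) (Suc k) \<partial>Q) = var w' k - var w' k / (n - 1)\<^sup>2"
    "2 \<le> size_of w' k \<Longrightarrow> (\<integral>w. (mean (mix S w' w) (Suc k))\<^sup>2 \<partial>Q) = (mean w' k)\<^sup>2 + var w' k / (n - 1)\<^sup>2"
proof -
  have S: "S \<subseteq> level_sources k" "S \<inter> history_sources = {}"
    using marks_subsets(2)[of k] by (auto simp: S_def marks_def)
  have A: "present w' k \<in> selection_sets"
    using present_nonempty[of w' k] assms(1) by simp
  have ev: "ev (mix S w' w) k = Departure" for w
    by (simp add: level_mix_marks[OF S] assms(1))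
  have chain: "present (mix S w' w) (Suc k) = present w' k - {leaver w k (present w' k)}"
    "vals (mix S w' w) (Suc k) = vals w' k" for w
    using chain_Departure[OF ev[of w]] by (simp_all add: level_mix[OF S(1)]) (simp add: mix_def S_def)
  show "(\<integral>w. var (mix S w' w) (Suc k) \<partial>Q) = var w' k - var w' k / (n - 1)\<^sup>2"
    unfolding var_def[of _ "Suc k"] chain integral_selections(1)[OF A, of "\<lambda>i. emp_var (present w' k - {i}) (vals w' k)"]
    by (subst avg_emp_var_departure) (simp_all add: var_def n_def size_of_def)
  show "(\<integral>w. (mean (mix S w' w) (Suc k))\<^sup>2 \<partial>Q) = (mean w' k)\<^sup>2 + var w' k / (n - 1)\<^sup>2"
    if "2 \<le> size_of w' k"
    unfolding mean_def[of _ "Suc k"] chain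
      integral_selections(1)[OF A, of "\<lambda>i. (emp_mean (present w' k - {i}) (vals w' k))\<^sup>2"]
    using that by (subst avg_emp_mean_departure) (simp_all add: var_def mean_def n_def size_of_def)
qed

lemma frozen_Gossip:
  assumes "ev w' k = Gossip"
  defines "S \<equiv> range (First_Agent k) \<union> range (Second_Agent k)"
  shows "(\<integral>w. var (mix S w' w) (Suc k) \<partial>Q) = var w' k - var w' k / real (size_of w' k)"
proof -
  have S: "S \<subseteq> level_sources k" "S \<inter> history_sources = {}"
    using marks_subsets(3)[of k] by (auto simp: S_def marks_def)
  have A: "present w' k \<in> selection_sets"
    using present_nonempty[of w' k] assms(1) by simp
  have ev: "ev (mix S w' w) k = Gossip" for w
    by (simp add: level_mix_marks[OF S] assms(1))
  have sel: "first_agent (mix S w' w) k = first_agent w k" "second_agent (mix S w' w) k = second_agent w k" for w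
    by (simp_all add: mix_def S_def)
  have chain: "var (mix S w' w) (Suc k) = (let i = first_agent w k (present w' k); j = second_agent w k (present w' k)
    in emp_var (present w' k) ((vals w' k)(i := (vals w' k i + vals w' k j) / 2, j := (vals w' k i + vals w' k j) / 2)))" for w
    using chain_Gossip[OF ev[of w]] by (simp add: var_def level_mix[OF S(1)] sel Let_def)
  show ?thesis
    unfolding chain Let_def integral_two_selections[OF A, of "\<lambda>i j. emp_var (present w' k)
      ((vals w' k)(i := (vals w' k i + vals w' k j) / 2, j := (vals w' k i + vals w' k j) / 2))"]
    using A by (subst avg_emp_var_gossip) (auto simp: selection_sets_def var_def size_of_def)
qed

lemma mean_Gossip:
  assumes "ev w k = Gossip" "good b w"
  shows "mean w (Suc k) = mean w k"
proof -
  have "present w k \<in> selection_sets"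
    using present_nonempty[of w k] assms(1) by simp
  then have "first_agent w k (present w k) \<in> present w k" "second_agent w k (present w k) \<in> present w k"
    using assms(2) by (auto simp: good_def)
  then show ?thesis
    using assms(1) by (simp add: mean_def chain_Gossip emp_mean_var_gossip(1))
qed

text \<open>The weight may see the time of event \<open>k\<close> but not the choices made by it.
  Only the choices belonging to type \<open>e\<close> are resampled.\<close>

theorem expected_jump:
  assumes [measurable]: "Z \<in> borel_measurable noise_space"
    and Z: "\<And>w. good b w \<Longrightarrow> \<bar>Z w\<bar> \<le> B"
      "\<And>S w w'. S \<subseteq> marks k \<Longrightarrow> good b w \<Longrightarrow> good b w' \<Longrightarrow> Z (mix S w' w) = Z w'"
  shows "(\<integral>w. Z w * of_bool (ev w k = e) * (var w (Suc k) - var w k) \<partial>Q)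
    = (\<integral>w. Z w * of_bool (ev w k = e) * drift e w k \<partial>Q)"
proof -
  define S where "S = (case e of Arrival \<Rightarrow> {New_Value k} | Departure \<Rightarrow> range (Leaver k)
    | Gossip \<Rightarrow> range (First_Agent k) \<union> range (Second_Agent k))"
  have S': "S \<subseteq> marks k" using marks_subsets[of k] by (cases e) (auto simp: S_def)
  then have S: "S \<subseteq> level_sources k" "S \<inter> history_sources = {}" by (auto simp: marks_def)
  show ?thesis
  proof (rule integral_by_resampling_marks[where S = S, OF S])
    show "\<bar>var w (Suc k) - var w k\<bar> \<le> drift_bound" if "good b w" for w
      using that by (rule abs_jump_le)
    show "\<bar>drift e w k\<bar> \<le> drift_bound" if "good b w" for w
      using abs_drift_le(1)[OF that] .
    show "drift e (mix S w' w) k = drift e w' k" for w w'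
      by (cases e) (simp_all add: drift_def level_mix[OF S(1)] level_mix_var_mean[OF S(1)])
    show "(\<integral>w. var (mix S w' w) (Suc k) - var (mix S w' w) k \<partial>Q) = drift e w' k"
      if "good b w'" "ev w' k = e" for w'
    proof -
      have "integrable Q (\<lambda>w. var (mix S w' w) (Suc k))"
        using var_nonneg var_le good_mix[OF that(1)] by (intro integrable_good[of _ "b\<^sup>2"]) auto
      then have "(\<integral>w. var (mix S w' w) (Suc k) - var (mix S w' w) k \<partial>Q)
          = (\<integral>w. var (mix S w' w) (Suc k) \<partial>Q) - var w' k"
        using prob_space by (simp add: level_mix_var_mean[OF S(1)])
      also have "\<dots> = drift e w' k"
      proof (cases e)
        case Arrival
        define n where "n = real (size_of w' k)"
        have "n + 1 \<noteq> 0" by (simp add: n_def add_nonneg_eq_0_iff)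
        then have "n / (n + 1) * var w' k - var w' k = - (var w' k / (n + 1))"
          by (simp add: field_simps)
        then show ?thesis
          using frozen_Arrival(1)[of w' k] Arrival that(2) by (simp add: S_def drift_def Let_def n_def)
      qed (use frozen_Departure(1)[of w' k] frozen_Gossip[of w' k] that(2) in \<open>simp_all add: S_def drift_def\<close>)
      finally show ?thesis .
    qed
  qed (use Z S' in auto)
qed

text \<open>The Markov generator applied to the empirical variance, evaluated at the configuration
  before event \<open>k\<close>.\<close>

definition generator :: "noise \<Rightarrow> nat \<Rightarrow> real" where
  "generator w k = (\<Sum>e\<in>UNIV. drift e w k * rate e (size_of w k))"

lemma measurable_generator [measurable]: "(\<lambda>w. generator w k) \<in> borel_measurable noise_space"
  unfolding generator_def by measurable

text \<open>One term for each of the three types of event.\<close>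

definition gen_bound :: real where
  "gen_bound = 3 * (drift_bound * (la + 2 * ld + lg))"

lemma abs_generator_le:
  assumes "good b w"
  shows "\<bar>generator w k\<bar> \<le> gen_bound"
proof -
  have "\<bar>generator w k\<bar> \<le> (\<Sum>e::event\<in>UNIV. drift_bound * (la + 2 * ld + lg))"
    unfolding generator_def using abs_drift_le(2)[OF assms] by (intro order_trans[OF sum_abs] sum_mono) auto
  then show ?thesis by (simp add: gen_bound_def UNIV_event)
qed

text \<open>Two successive averagings. The choices made by the event turn the jump into its drift,
  as the time of the event does not depend on them; then its clock turns the indicator into rate
  times waiting time, as the drift does not depend on the clock.\<close>

lemma expected_increment:
  assumes t: "0 \<le> t"
  shows "(\<integral>w. of_bool (T w (Suc k) \<le> ereal t) * (var w (Suc k) - var w k) \<partial>Q)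
    = (\<integral>w. generator w k * overlap w k t \<partial>Q)"
proof -
  have split: "of_bool (T w (Suc k) \<le> ereal t) * x = (\<Sum>e\<in>UNIV. of_bool (T w (Suc k) \<le> ereal t) * of_bool (ev w k = e) * x)"
    for w and x :: real
    by (cases "ev w k") (simp_all add: UNIV_event)
  let ?I = "\<lambda>w. of_bool (T w (Suc k) \<le> ereal t) :: real"
  have "(\<integral>w. ?I w * (var w (Suc k) - var w k) \<partial>Q)
      = (\<integral>w. (\<Sum>e\<in>UNIV. ?I w * of_bool (ev w k = e) * (var w (Suc k) - var w k)) \<partial>Q)"
    by (intro Bochner_Integration.integral_cong refl split)
  also have "\<dots> = (\<Sum>e\<in>UNIV. \<integral>w. ?I w * of_bool (ev w k = e) * (var w (Suc k) - var w k) \<partial>Q)"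
    using abs_jump_le by (intro Bochner_Integration.integral_sum integrable_good[of _ drift_bound])
       (auto simp: of_bool_def drift_bound_nonneg)
  also have "\<dots> = (\<Sum>e\<in>UNIV. \<integral>w. ?I w * of_bool (ev w k = e) * drift e w k \<partial>Q)"
  proof (intro sum.cong refl expected_jump)
    fix S w w' assume "S \<subseteq> marks k"
    then have S: "S \<subseteq> level_sources k" "S \<inter> history_sources = {}" by (auto simp: marks_def)
    show "of_bool (T (mix S w' w) (Suc k) \<le> ereal t) = (of_bool (T w' (Suc k) \<le> ereal t) :: real)"
      by (simp add: level_mix_marks[OF S])
  qed auto
  also have "\<dots> = (\<Sum>e\<in>UNIV. \<integral>w. drift e w k * rate e (size_of w k) * overlap w k t \<partial>Q)"
  proof (intro sum.cong refl)
    fix e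
    have lev: "{Clock e k} \<subseteq> level_sources k" for e by (auto simp: level_sources_def)
    have "(\<integral>w. ?I w * of_bool (ev w k = e) * drift e w k \<partial>Q)
        = (\<integral>w. drift e w k * of_bool (ev w k = e \<and> T w (Suc k) \<le> ereal t) \<partial>Q)"
      by (intro Bochner_Integration.integral_cong) (auto simp: of_bool_def)
    also have "\<dots> = (\<integral>w. drift e w k * rate e (size_of w k) * overlap w k t \<partial>Q)"
    proof (rule clock_identity[where B = "max drift_bound (drift_bound * (la + 2 * ld + lg))"])
      show "drift e (mix {Clock e k} w' w) k = drift e w' k" for w w'
        by (cases e) (simp_all add: drift_def level_mix[OF lev] level_mix_var_mean[OF lev])
    qed (use t abs_drift_le in \<open>auto simp: max.coboundedI1 max.coboundedI2\<close>)
    finally show "(\<integral>w. ?I w * of_bool (ev w k = e) * drift e w k \<partial>Q)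
        = (\<integral>w. drift e w k * rate e (size_of w k) * overlap w k t \<partial>Q)" .
  qed
  also have "\<dots> = (\<integral>w. generator w k * overlap w k t \<partial>Q)"
  proof -
    have "\<bar>drift e w k * rate e (size_of w k) * overlap w k t\<bar> \<le> drift_bound * (la + 2 * ld + lg) * t"
      if "good b w" for e w
      using abs_drift_le(2)[OF that, of e k] overlap_nonneg[OF that t, of k] overlap_le[OF that t, of k]
      unfolding abs_mult[of _ "overlap w k t"]
      by (intro mult_mono) (auto intro: order_trans[OF abs_ge_zero])
    then show ?thesis
      unfolding generator_def sum_distrib_right
      by (intro Bochner_Integration.integral_sum[symmetric] integrable_good) auto
  qed
  finally show ?thesis .
qed

section \<open>Event times have no atoms after time 0 and do not accumulate\<close>

section \<open>Non-explosion\<close>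

lemma overlap_eq_0: "good b w \<Longrightarrow> ereal t \<le> T w k \<Longrightarrow> overlap w k t = 0"
  using order_trans[of "ereal t" "T w k" "T w (Suc k)"] T_Suc_ge[of b w k]
  by (simp add: overlap_def min_absorb2)

lemma measurable_rate [measurable]: "(\<lambda>w. rate e (size_of w k)) \<in> borel_measurable noise_space"
  by measurable

definition total_rate :: "nat \<Rightarrow> real" where
  "total_rate n = la + (ld + lg) * real n"

lemma sum_rate: "(\<Sum>e\<in>UNIV. rate e n) = total_rate n"
  by (simp add: UNIV_event total_rate_def algebra_simps)

lemma total_rate_mono: "m \<le> n \<Longrightarrow> total_rate m \<le> total_rate n"
  using rates_nonneg by (simp add: total_rate_def mult_left_mono)

lemma total_rate_nonneg: "0 \<le> total_rate n"
  using rates_nonneg by (simp add: total_rate_def)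

lemma rate_le_total: "rate e n \<le> total_rate n"
  unfolding sum_rate[symmetric] using rate_nonneg by (intro member_le_sum) auto

text \<open>The cutoff on the initial size bounds the rate for each fixed \<open>k\<close>, the size
  after \<open>k\<close> events being at most m + k.\<close>

lemma weighted_rate_bounds:
  "0 \<le> of_bool (init_size w \<le> m) * rate e (size_of w k)"
  "of_bool (init_size w \<le> m) * rate e (size_of w k) \<le> total_rate (m + k)"
  using size_of_le[of w k] rate_le_total[of e "size_of w k"] total_rate_mono[of "size_of w k" "m + k"]
    total_rate_nonneg[of "m + k"] rate_nonneg[of e "size_of w k"] by (auto simp: of_bool_def)

lemma event_before_by_type:
  assumes t: "0 \<le> t"
  shows "(\<integral>w. of_bool (init_size w \<le> m) * of_bool (ev w k = e \<and> T w (Suc k) \<le> ereal t) \<partial>Q)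
    = (\<integral>w. of_bool (init_size w \<le> m) * rate e (size_of w k) * overlap w k t \<partial>Q)"
proof (rule clock_identity[where B = "max 1 (total_rate (m + k))"])
  fix w
  show "\<bar>of_bool (init_size w \<le> m) * rate e (size_of w k)\<bar> \<le> max 1 (total_rate (m + k))"
    unfolding abs_of_nonneg[OF weighted_rate_bounds(1)] using weighted_rate_bounds(2)
    by (rule max.coboundedI2)
  show "\<bar>of_bool (init_size w \<le> m) :: real\<bar> \<le> max 1 (total_rate (m + k))"
    by (simp add: le_max_iff_disj)
  fix w'
  show "of_bool (init_size (mix {Clock e k} w' w) \<le> m) = (of_bool (init_size w' \<le> m) :: real)"
    by (simp add: mix_def)
qed (use t in auto)

lemma integrable_rate_overlap:
  assumes t: "0 \<le> t" and f: "f \<in> borel_measurable noise_space" "\<And>w. good b w \<Longrightarrow> \<bar>f w\<bar> \<le> B"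
  shows "integrable Q (\<lambda>w. f w * overlap w k t)"
proof (rule integrable_good[of _ "B * t"])
  show "\<bar>f w * overlap w k t\<bar> \<le> B * t" if "good b w" for w
    using f(2)[OF that] overlap_nonneg[OF that t, of k] overlap_le[OF that t, of k]
    unfolding abs_mult by (intro mult_mono) (auto intro: order_trans[OF abs_ge_zero])
qed (use f in measurable)

text \<open>The waiting time before \<open>t\<close> exceeds that before \<open>s\<close> by at most
  t - s, and the clock identity turns this into a bound on the probability. The factor 3 counts the
  types of event.\<close>

lemma event_before_increment:
  assumes "0 \<le> s" "s \<le> t"
  shows "(\<integral>w. of_bool (init_size w \<le> m) * of_bool (ereal s < T w (Suc k) \<and> T w (Suc k) \<le> ereal t) \<partial>Q)
    \<le> 3 * (total_rate (m + k) * (t - s))"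
proof -
  let ?R = "total_rate (m + k)"
  have t: "0 \<le> t" using assms by simp
  define p where "p e u = (\<integral>w. of_bool (init_size w \<le> m) * of_bool (ev w k = e \<and> T w (Suc k) \<le> ereal u) \<partial>Q :: real)" for e u
  have int: "integrable Q (\<lambda>w. of_bool (init_size w \<le> m) * of_bool (ev w k = e \<and> T w (Suc k) \<le> ereal u) :: real)" for e u
    by (rule integrable_good[of _ 1]) auto
  note Rb = weighted_rate_bounds[of _ m _ k]
  have int': "integrable Q (\<lambda>w. of_bool (init_size w \<le> m) * rate e (size_of w k) * overlap w k u)" if "0 \<le> u" for e u
    using Rb by (intro integrable_rate_overlap[OF that, of _ ?R]) auto
  have diff: "p e t - p e s \<le> ?R * (t - s)" for e
  proof -
    have "p e t - p e s = (\<integral>w. of_bool (init_size w \<le> m) * rate e (size_of w k) * overlap w k t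
        - of_bool (init_size w \<le> m) * rate e (size_of w k) * overlap w k s \<partial>Q)"
      unfolding p_def event_before_by_type[OF t] event_before_by_type[OF assms(1)]
      using int'[OF t] int'[OF assms(1)] by simp
    also have "\<dots> \<le> (\<integral>w. ?R * (t - s) \<partial>Q)"
    proof (rule integral_good_mono)
      fix w assume w: "good b w"
      have "of_bool (init_size w \<le> m) * rate e (size_of w k) * (overlap w k t - overlap w k s) \<le> ?R * (t - s)"
        using Rb[of w e] overlap_mono[OF w assms] total_rate_nonneg[of "m + k"] by (intro mult_mono) auto
      then show "of_bool (init_size w \<le> m) * rate e (size_of w k) * overlap w k t
        - of_bool (init_size w \<le> m) * rate e (size_of w k) * overlap w k s \<le> ?R * (t - s)"
        by (simp add: algebra_simps)
    qed (use int'[OF t] int'[OF assms(1)] in auto)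
    finally show ?thesis using prob_space by simp
  qed
  have "(\<integral>w. of_bool (init_size w \<le> m) * of_bool (ereal s < T w (Suc k) \<and> T w (Suc k) \<le> ereal t) \<partial>Q :: real)
      = (\<integral>w. (\<Sum>e\<in>UNIV. of_bool (init_size w \<le> m) * of_bool (ev w k = e \<and> T w (Suc k) \<le> ereal t)
          - of_bool (init_size w \<le> m) * of_bool (ev w k = e \<and> T w (Suc k) \<le> ereal s)) \<partial>Q)"
  proof (intro Bochner_Integration.integral_cong refl)
    fix w
    have "ereal s \<le> ereal t" using assms by simp
    then have *: "T w (Suc k) \<le> ereal s \<Longrightarrow> T w (Suc k) \<le> ereal t" by (rule order_trans[rotated])
    show "of_bool (init_size w \<le> m) * of_bool (ereal s < T w (Suc k) \<and> T w (Suc k) \<le> ereal t)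
      = (\<Sum>e\<in>UNIV. of_bool (init_size w \<le> m) * of_bool (ev w k = e \<and> T w (Suc k) \<le> ereal t)
          - (of_bool (init_size w \<le> m) * of_bool (ev w k = e \<and> T w (Suc k) \<le> ereal s) :: real))"
      using * by (cases "ev w k") (auto simp: UNIV_event of_bool_def not_le)
  qed
  also have "\<dots> = (\<Sum>e\<in>UNIV. p e t - p e s)"
    unfolding p_def using int
    by (subst Bochner_Integration.integral_sum) (auto intro!: sum.cong Bochner_Integration.integral_diff)
  also have "\<dots> \<le> (\<Sum>e::event\<in>UNIV. ?R * (t - s))"
    by (intro sum_mono diff)
  finally show ?thesis by (simp add: UNIV_event)
qed

lemma AE_by_init_size:
  assumes "\<And>m. AE w in Q. init_size w \<le> m \<longrightarrow> P w"
  shows "AE w in Q. P w"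
proof -
  have "AE w in Q. \<forall>m. init_size w \<le> m \<longrightarrow> P w"
    unfolding AE_all_countable using assms by blast
  then show ?thesis by (rule eventually_mono) blast
qed

lemma AE_by_measure_0:
  assumes "{w \<in> space noise_space. P w} \<in> sets noise_space" and "(\<integral>w. of_bool (P w) \<partial>Q) \<le> (0::real)"
  shows "AE w in Q. \<not> P w"
proof -
  have P: "{w. P w} \<in> sets noise_space" using assms(1) by simp
  have "(\<integral>w. indicator {w. P w} w \<partial>Q) = measure Q {w. P w}"
    using P by (subst Bochner_Integration.integral_indicator) (simp_all add: sets_Q)
  moreover have "(\<integral>w. indicator {w. P w} w \<partial>Q) = (\<integral>w. of_bool (P w) \<partial>Q :: real)"
    by (intro Bochner_Integration.integral_cong) (simp_all add: indicator_def)
  ultimately have "measure Q {w. P w} = 0"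
    using assms(2) measure_nonneg[of Q "{w. P w}"] by linarith
  then have "{w. P w} \<in> null_sets Q"
    using P by (simp add: null_sets_def sets_Q emeasure_eq_measure)
  from AE_not_in[OF this] show ?thesis by simp
qed

text \<open>The interval bound shrinks to 0 as \<open>s\<close> approaches \<open>t\<close> from
  below. It is needed because the expected variance is to be differentiated at \<open>t\<close> from
  both sides.\<close>

lemma AE_jump_time_neq:
  assumes t: "0 < t"
  shows "AE w in Q. T w (Suc k) \<noteq> ereal t"
proof (rule AE_by_init_size)
  fix m
  let ?P = "\<lambda>w. init_size w \<le> m \<and> T w (Suc k) = ereal t"
  let ?R = "3 * total_rate (m + k)"
  have meas: "{w \<in> space noise_space. ?P w} \<in> sets noise_space" by measurable
  have [measurable]: "(\<lambda>w. of_bool (?P w) :: real) \<in> borel_measurable noise_space"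
    by measurable
  have le: "(\<integral>w. of_bool (?P w) \<partial>Q) \<le> ?R * (t - s)" if "0 \<le> s" "s < t" for s
  proof -
    have "(\<integral>w. of_bool (?P w) \<partial>Q :: real) \<le>
       (\<integral>w. of_bool (init_size w \<le> m) * of_bool (ereal s < T w (Suc k) \<and> T w (Suc k) \<le> ereal t) \<partial>Q)"
      using that by (intro integral_good_mono integrable_good[of _ 1]) (auto simp: of_bool_def)
    also have "\<dots> \<le> ?R * (t - s)"
      using event_before_increment[of s t m k] that by simp
    finally show ?thesis .
  qed
  have "(\<integral>w. of_bool (?P w) \<partial>Q) \<le> (0::real)"
  proof (rule field_le_epsilon)
    fix \<epsilon> :: real assume "0 < \<epsilon>"
    \<comment> \<open>Close enough to \<open>t\<close> for the bound to fall below \<epsilon>, and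
      clipped to stay nonnegative; the 1 in the denominator covers a vanishing rate.\<close>
    define s where "s = max 0 (t - \<epsilon> / (?R + 1))"
    have R: "0 \<le> ?R" using total_rate_nonneg by simp
    then have "0 < \<epsilon> / (?R + 1)" using \<open>0 < \<epsilon>\<close> by simp
    then have s: "0 \<le> s" "s < t" using t by (auto simp: s_def)
    have "?R * (t - s) \<le> ?R * (\<epsilon> / (?R + 1))"
      using R by (intro mult_left_mono) (auto simp: s_def)
    also have "\<dots> \<le> \<epsilon>"
      using R \<open>0 < \<epsilon>\<close> by (simp add: field_simps)
    finally show "(\<integral>w. of_bool (?P w) \<partial>Q) \<le> 0 + \<epsilon>"
      using le[OF s] by linarith
  qed
  from AE_by_measure_0[OF meas this]
  show "AE w in Q. init_size w \<le> m \<longrightarrow> T w (Suc k) \<noteq> ereal t"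
    by (rule eventually_mono) auto
qed

text \<open>If some of the waiting for event \<open>k\<close> lies before \<open>t\<close>, then all
  arrivals preceding it happened by \<open>t\<close>; otherwise both sides are 0.\<close>

lemma size_overlap_le:
  assumes w: "good b w" and t: "0 \<le> t" and k: "k < K" and m: "init_size w \<le> m"
  shows "real (size_of w k) * overlap w k t
    \<le> (real m + (\<Sum>j<K. of_bool (ev w j = Arrival \<and> T w (Suc j) \<le> ereal t))) * overlap w k t"
proof (cases "ereal t \<le> T w k")
  case True
  then show ?thesis using overlap_eq_0[OF w] by simp
next
  case False
  have "real (size_of w k) \<le> real m + (\<Sum>j<k. of_bool (ev w j = Arrival))"
  proof -
    have "(\<Sum>j<k. if ev w j = Arrival then 1 else 0) = (\<Sum>j<k. of_bool (ev w j = Arrival) :: nat)"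
      by (simp add: of_bool_def)
    then have "size_of w k \<le> m + (\<Sum>j<k. of_bool (ev w j = Arrival))"
      using size_of_le_arrivals[of w k] m by linarith
    from of_nat_mono[OF this, where 'a = real] show ?thesis
      by (simp only: of_nat_add of_nat_sum of_nat_of_bool)
  qed
  also have "(\<Sum>j<k. of_bool (ev w j = Arrival)) = (\<Sum>j<k. of_bool (ev w j = Arrival \<and> T w (Suc j) \<le> ereal t) :: real)"
  proof (intro sum.cong refl)
    fix j assume "j \<in> {..<k}"
    then have "T w (Suc j) \<le> T w k" using T_mono[OF w, of "Suc j" k] by simp
    also have "T w k \<le> ereal t" using False by simp
    finally show "of_bool (ev w j = Arrival) = (of_bool (ev w j = Arrival \<and> T w (Suc j) \<le> ereal t) :: real)"
      by simp
  qed
  also have "\<dots> \<le> (\<Sum>j<K. of_bool (ev w j = Arrival \<and> T w (Suc j) \<le> ereal t))"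
    using k by (intro sum_mono2) auto
  finally show ?thesis
    using overlap_nonneg[OF w t] by (intro mult_right_mono) auto
qed

text \<open>The arrivals up to time \<open>t\<close> have mean at most \<open>la * t\<close>, which bounds the mean size and
  hence the mean number of all events up to time \<open>t\<close>.\<close>

lemma expected_events_bounded:
  assumes t: "0 \<le> t"
  shows "(\<Sum>k<K. \<integral>w. of_bool (init_size w \<le> m) * of_bool (T w (Suc k) \<le> ereal t) \<partial>Q)
    \<le> la * t + (ld + lg) * (real m + la * t) * t"
proof -
  define arr where "arr w = (\<Sum>j<K. of_bool (ev w j = Arrival \<and> T w (Suc j) \<le> ereal t) :: real)" for w
  have [measurable]: "arr \<in> borel_measurable noise_space" unfolding arr_def by measurable
  have arr0: "0 \<le> arr w" "arr w \<le> real K" for w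
    using sum_mono[of "{..<K}" "\<lambda>j. of_bool (ev w j = Arrival \<and> T w (Suc j) \<le> ereal t)" "\<lambda>_. 1 :: real"]
    unfolding arr_def by (auto intro!: sum_nonneg simp del: sum_of_bool_eq)
  define Z where "Z w = (of_bool (init_size w \<le> m) :: real)" for w :: noise
  have [measurable]: "Z \<in> borel_measurable noise_space" unfolding Z_def by measurable
  have Z01: "0 \<le> Z w" "Z w \<le> 1" for w by (simp_all add: Z_def)
  have int_ov: "integrable Q (\<lambda>w. Z w * rate e (size_of w k) * overlap w k t)" for e k
  proof (rule integrable_rate_overlap[OF t, of _ "total_rate (m + k)"])
    fix w
    show "\<bar>Z w * rate e (size_of w k)\<bar> \<le> total_rate (m + k)"
      unfolding Z_def abs_of_nonneg[OF weighted_rate_bounds(1)] by (rule weighted_rate_bounds(2))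
  qed measurable
  \<comment> \<open>Arrivals have a constant rate, and the waiting times before \<open>t\<close> add
    up to at most \<open>t\<close>.\<close>
  have arrivals: "(\<integral>w. Z w * arr w \<partial>Q) \<le> la * t"
  proof -
    have "(\<integral>w. Z w * arr w \<partial>Q) = (\<Sum>j<K. \<integral>w. Z w * of_bool (ev w j = Arrival \<and> T w (Suc j) \<le> ereal t) \<partial>Q)"
      unfolding arr_def sum_distrib_left
      by (intro Bochner_Integration.integral_sum integrable_good[of _ 1]) (auto simp: Z_def)
    also have "\<dots> = (\<Sum>j<K. \<integral>w. Z w * la * overlap w j t \<partial>Q)"
      unfolding Z_def event_before_by_type[OF t] by simp
    also have "\<dots> = (\<integral>w. (\<Sum>j<K. Z w * la * overlap w j t) \<partial>Q)"
      using int_ov[of Arrival] by (intro Bochner_Integration.integral_sum[symmetric]) simp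
    also have "\<dots> \<le> (\<integral>w. la * t \<partial>Q)"
    proof (rule integral_good_mono)
      fix w assume w: "good b w"
      have "Z w * la * (\<Sum>j<K. overlap w j t) \<le> la * t"
      proof (rule mult_mono)
        show "Z w * la \<le> la" using Z01[of w] rates_nonneg(1) by (simp add: mult_left_le_one_le)
        show "0 \<le> (\<Sum>j<K. overlap w j t)" by (intro sum_nonneg overlap_nonneg[OF w t])
      qed (use sum_overlap_le[OF w t] rates_nonneg in auto)
      then show "(\<Sum>j<K. Z w * la * overlap w j t) \<le> la * t"
        by (simp add: sum_distrib_left)
    qed (use int_ov[of Arrival] in auto)
    finally show ?thesis using prob_space by simp
  qed
  have "(\<Sum>k<K. \<integral>w. Z w * of_bool (T w (Suc k) \<le> ereal t) \<partial>Q)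
      = (\<Sum>k<K. \<integral>w. (\<Sum>e\<in>UNIV. Z w * of_bool (ev w k = e \<and> T w (Suc k) \<le> ereal t)) \<partial>Q)"
  proof (intro sum.cong Bochner_Integration.integral_cong refl)
    fix w k
    show "Z w * of_bool (T w (Suc k) \<le> ereal t) = (\<Sum>e\<in>UNIV. Z w * of_bool (ev w k = e \<and> T w (Suc k) \<le> ereal t))"
      by (cases "ev w k") (simp_all add: UNIV_event)
  qed
  also have "\<dots> = (\<Sum>k<K. \<Sum>e\<in>UNIV. \<integral>w. Z w * of_bool (ev w k = e \<and> T w (Suc k) \<le> ereal t) \<partial>Q)"
    by (intro sum.cong refl Bochner_Integration.integral_sum integrable_good[of _ 1]) (auto simp: Z_def)
  also have "\<dots> = (\<Sum>k<K. \<Sum>e\<in>UNIV. \<integral>w. Z w * rate e (size_of w k) * overlap w k t \<partial>Q)"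
    unfolding Z_def event_before_by_type[OF t] ..
  also have "\<dots> = (\<integral>w. (\<Sum>k<K. \<Sum>e\<in>UNIV. Z w * rate e (size_of w k) * overlap w k t) \<partial>Q)"
    using int_ov by (subst Bochner_Integration.integral_sum) (auto intro!: sum.cong Bochner_Integration.integral_sum[symmetric])
  also have "\<dots> \<le> (\<integral>w. la * t + (ld + lg) * t * (real m + Z w * arr w) \<partial>Q)"
  proof (rule integral_good_mono)
    show "integrable Q (\<lambda>w. \<Sum>k<K. \<Sum>e\<in>UNIV. Z w * rate e (size_of w k) * overlap w k t)"
      using int_ov by auto
    have "integrable Q (\<lambda>w. Z w * arr w)"
      using arr0 by (intro integrable_good[of _ "real K"]) (auto simp: Z_def)
    then show "integrable Q (\<lambda>w. la * t + (ld + lg) * t * (real m + Z w * arr w))"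
      by auto
    fix w assume w: "good b w"
    show "(\<Sum>k<K. \<Sum>e\<in>UNIV. Z w * rate e (size_of w k) * overlap w k t)
      \<le> la * t + (ld + lg) * t * (real m + Z w * arr w)"
    proof (cases "init_size w \<le> m")
      case True
      \<comment> \<open>The size in each waiting period is replaced by the bound
        \<open>real m + arr w\<close>, the same for all \<open>k\<close>, which then factors out of
        the sum of waiting times.\<close>
      have "(\<Sum>e\<in>UNIV. Z w * rate e (size_of w k) * overlap w k t)
          \<le> (la + (ld + lg) * (real m + arr w)) * overlap w k t" if "k < K" for k
      proof -
        have "(\<Sum>e\<in>UNIV. Z w * rate e (size_of w k) * overlap w k t)
            = la * overlap w k t + (ld + lg) * (real (size_of w k) * overlap w k t)"
          using True by (simp add: Z_def UNIV_event algebra_simps)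
        also have "\<dots> \<le> la * overlap w k t + (ld + lg) * ((real m + arr w) * overlap w k t)"
          using size_overlap_le[OF w t that True] rates_nonneg
          unfolding arr_def by (intro add_left_mono mult_left_mono) auto
        finally show ?thesis by (simp add: algebra_simps)
      qed
      then have "(\<Sum>k<K. \<Sum>e\<in>UNIV. Z w * rate e (size_of w k) * overlap w k t)
          \<le> (\<Sum>k<K. (la + (ld + lg) * (real m + arr w)) * overlap w k t)"
        by (intro sum_mono) auto
      also have "\<dots> = (la + (ld + lg) * (real m + arr w)) * (\<Sum>k<K. overlap w k t)"
        by (simp add: sum_distrib_left)
      also have "\<dots> \<le> (la + (ld + lg) * (real m + arr w)) * t"
        using sum_overlap_le[OF w t] rates_nonneg arr0(1)[of w] by (intro mult_left_mono) auto
      finally show ?thesis using True by (simp add: Z_def algebra_simps)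
    next
      case False
      then show ?thesis using rates_nonneg t by (simp add: Z_def)
    qed
  qed
  also have "\<dots> = la * t + (ld + lg) * t * (real m + (\<integral>w. Z w * arr w \<partial>Q))"
  proof -
    have "integrable Q (\<lambda>w. Z w * arr w)"
      using arr0 by (intro integrable_good[of _ "real K"]) (auto simp: Z_def)
    then show ?thesis using prob_space by simp
  qed
  also have "\<dots> \<le> la * t + (ld + lg) * t * (real m + la * t)"
    using arrivals rates_nonneg t by (intro add_left_mono mult_left_mono) auto
  finally show ?thesis by (simp add: Z_def mult_ac)
qed

text \<open>The expected number of events counted is bounded uniformly in \<open>K\<close>, while it
  is at least \<open>K\<close> times the probability that all events happen by
  \<open>t\<close>.\<close>

lemma AE_event_after:
  assumes t: "0 \<le> t"
  shows "AE w in Q. \<exists>k. ereal t < T w k"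
proof (rule AE_by_init_size)
  fix m
  let ?P = "\<lambda>w. init_size w \<le> m \<and> (\<forall>k. T w (Suc k) \<le> ereal t)"
  define c where "c = la * t + (ld + lg) * (real m + la * t) * t"
  have meas: "{w \<in> space noise_space. ?P w} \<in> sets noise_space" by measurable
  have [measurable]: "(\<lambda>w. of_bool (?P w) :: real) \<in> borel_measurable noise_space"
    by measurable
  define p where "p = (\<integral>w. of_bool (?P w) \<partial>Q :: real)"
  have "real K * p \<le> c" for K
  proof -
    have "real K * p = (\<Sum>k<K. p)" by simp
    also have "\<dots> \<le> (\<Sum>k<K. \<integral>w. of_bool (init_size w \<le> m) * of_bool (T w (Suc k) \<le> ereal t) \<partial>Q)"
      unfolding p_def by (intro sum_mono integral_good_mono integrable_good[of _ 1]) (auto simp: of_bool_def)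
    also have "\<dots> \<le> c" unfolding c_def by (rule expected_events_bounded[OF t])
    finally show ?thesis .
  qed
  then have "p \<le> 0"
    using ex_less_of_nat_mult[of p c] by (metis not_le)
  from AE_by_measure_0[OF meas this[unfolded p_def]]
  show "AE w in Q. init_size w \<le> m \<longrightarrow> (\<exists>k. ereal t < T w k)"
    by (rule eventually_mono) (auto simp: not_le)
qed

text \<open>On a good path this says that only finitely many events happen in bounded time, so that
  \<open>num_events\<close> counts a finite set.\<close>

definition nonexplosive :: "noise \<Rightarrow> bool" where
  "nonexplosive w \<longleftrightarrow> (\<forall>t. \<exists>k. ereal t < T w k)"

lemma AE_nonexplosive: "AE w in Q. nonexplosive w"
proof -
  have "AE w in Q. \<forall>n::nat. \<exists>k. ereal (real n) < T w k"
    unfolding AE_all_countable using AE_event_after by simp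
  then show ?thesis
  proof eventually_elim
    case (elim w)
    show ?case
      unfolding nonexplosive_def
    proof
      fix t :: real
      obtain n :: nat where "t \<le> real n" using real_arch_simple by blast
      with elim show "\<exists>k. ereal t < T w k"
        by (meson ereal_less_eq(3) le_less_trans)
    qed
  qed
qed

section \<open>Dynkin's formula, and the slope of the compensator along almost every path\<close>

section \<open>The derivative of the expected variance\<close>

definition count :: "noise \<Rightarrow> real \<Rightarrow> nat" where
  "count w t = num_events rate w t"

lemma variance_at_eq: "variance_at rate w t = var w (count w t)"
  by (simp add: variance_at_def agents_at_def values_at_def config_at_def var_def present_def vals_def count_def)

lemma size_at_eq: "size_at rate w t = size_of w (count w t)"
  by (simp add: size_at_def agents_at_def config_at_def size_of_def present_def count_def)

lemma measurable_count [measurable]: "(\<lambda>w. count w t) \<in> noise_space \<rightarrow>\<^sub>M count_space UNIV"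
proof -
  have "(\<lambda>w. card {k. T w (Suc k) \<le> ereal t}) \<in> noise_space \<rightarrow>\<^sub>M count_space UNIV"
  proof (rule measurable_card)
    fix k
    have "{w \<in> space noise_space. T w (Suc k) \<le> ereal t} \<in> sets noise_space"
      by measurable
    then show "{w \<in> space noise_space. k \<in> {k. T w (Suc k) \<le> ereal t}} \<in> sets noise_space"
      by simp
  qed
  then show ?thesis by (simp add: count_def num_events_def T_def)
qed

lemma measurable_at_count:
  assumes "\<And>k. (\<lambda>w. f w k) \<in> noise_space \<rightarrow>\<^sub>M N"
  shows "(\<lambda>w. f w (count w t)) \<in> noise_space \<rightarrow>\<^sub>M N"
  by (rule measurable_compose_countable[where f = "\<lambda>k w. f w k", OF assms measurable_count])

lemma measurable_var_at_count [measurable]: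
  "(\<lambda>w. var w (count w t)) \<in> borel_measurable noise_space"
  "(\<lambda>w. generator w (count w t)) \<in> borel_measurable noise_space"
  "(\<lambda>w. size_of w (count w t)) \<in> noise_space \<rightarrow>\<^sub>M count_space UNIV"
  by (rule measurable_at_count, measurable)+

text \<open>By monotonicity of the event times, exactly the events 0, ..., n - 1 have happened by
  \<open>t\<close>.\<close>

lemma count_unique:
  assumes "good b w" "T w n \<le> ereal t" "ereal t < T w (Suc n)"
  shows "count w t = n"
proof -
  have "T w (Suc k) \<le> ereal t \<longleftrightarrow> k < n" for k
  proof
    assume "T w (Suc k) \<le> ereal t"
    then have "\<not> T w (Suc n) \<le> T w (Suc k)" using assms(3) by auto
    then show "k < n" using T_mono[OF assms(1), of "Suc n" "Suc k"] by (metis Suc_le_mono not_le)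
  next
    assume "k < n"
    then show "T w (Suc k) \<le> ereal t"
      using T_mono[OF assms(1), of "Suc k" n] assms(2) by simp
  qed
  then have "{k. T w (Suc k) \<le> ereal t} = {..<n}" by auto
  then show ?thesis by (simp add: count_def num_events_def T_def)
qed

lemma count_bounds:
  assumes w: "good b w" "nonexplosive w" and t: "0 \<le> t"
  shows "T w (count w t) \<le> ereal t" "ereal t < T w (Suc (count w t))"
proof -
  define K where "K = (LEAST k. ereal t < T w k)"
  have "\<exists>k. ereal t < T w k" using w(2) by (simp add: nonexplosive_def)
  then have K: "ereal t < T w K" unfolding K_def by (rule LeastI_ex)
  have "K \<noteq> 0"
  proof
    assume "K = 0"
    then show False using K t by (simp add: T_simps)
  qed
  then obtain n where n: "K = Suc n" by (cases K) auto
  have "\<not> ereal t < T w n" using not_less_Least[of n "\<lambda>k. ereal t < T w k"] n K_def by simp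
  then have "T w n \<le> ereal t" "ereal t < T w (Suc n)" using K n by auto
  with count_unique[OF w(1) this] show "T w (count w t) \<le> ereal t" "ereal t < T w (Suc (count w t))" by auto
qed

lemma event_before_iff:
  assumes "good b w" "nonexplosive w" "0 \<le> t"
  shows "T w (Suc k) \<le> ereal t \<longleftrightarrow> k < count w t"
proof
  assume "T w (Suc k) \<le> ereal t"
  then have "\<not> T w (Suc (count w t)) \<le> T w (Suc k)" using count_bounds(2)[OF assms] by auto
  then show "k < count w t" using T_mono[OF assms(1), of "Suc (count w t)" "Suc k"] by (metis Suc_le_mono not_le)
next
  assume "k < count w t"
  then show "T w (Suc k) \<le> ereal t"
    using T_mono[OF assms(1), of "Suc k" "count w t"] count_bounds(1)[OF assms] by simp
qed

text \<open>The integral of the generator along the path up to time \<open>t\<close>, written as a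
  sum over waiting periods. Periods beyond the current one begin after \<open>t\<close>.\<close>

definition compensator :: "noise \<Rightarrow> real \<Rightarrow> real" where
  "compensator w t = (\<Sum>k\<le>count w t. generator w k * overlap w k t)"

lemma measurable_compensator [measurable]: "(\<lambda>w. compensator w t) \<in> borel_measurable noise_space"
  unfolding compensator_def
  by (rule measurable_at_count[where f = "\<lambda>w n. \<Sum>k\<le>n. generator w k * overlap w k t"]) measurable

text \<open>The surplus terms vanish, so two different times can be compared over one common range
  of summation.\<close>

lemma compensator_eq:
  assumes w: "good b w" "nonexplosive w" and t: "0 \<le> t" and K: "count w t < K"
  shows "compensator w t = (\<Sum>k<K. generator w k * overlap w k t)"
  unfolding compensator_def
proof (rule sum.mono_neutral_left)
  show "\<forall>k\<in>{..<K} - {..count w t}. generator w k * overlap w k t = 0"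
  proof
    fix k assume "k \<in> {..<K} - {..count w t}"
    then have "ereal t \<le> T w k"
      using count_bounds(2)[OF w t] T_mono[OF w(1), of "Suc (count w t)" k] by (auto simp: Suc_le_eq)
    then show "generator w k * overlap w k t = 0" using overlap_eq_0[OF w(1)] by simp
  qed
qed (use K in auto)

lemma gen_bound_nonneg: "0 \<le> gen_bound"
  using rates_nonneg drift_bound_nonneg by (simp add: gen_bound_def)

text \<open>The generator is bounded and the total waiting time grows with slope at most 1. The
  constant does not depend on \<open>K\<close>, as dominated convergence requires.\<close>

lemma partial_compensator_lipschitz:
  assumes w: "good b w" and s: "0 \<le> s" "s \<le> t"
  shows "\<bar>(\<Sum>k<K. generator w k * overlap w k t) - (\<Sum>k<K. generator w k * overlap w k s)\<bar> \<le> gen_bound * (t - s)"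
proof -
  note mono = overlap_mono(1)[OF w s]
  have "\<bar>(\<Sum>k<K. generator w k * overlap w k t) - (\<Sum>k<K. generator w k * overlap w k s)\<bar>
      = \<bar>\<Sum>k<K. generator w k * (overlap w k t - overlap w k s)\<bar>"
    by (simp add: sum_subtractf right_diff_distrib)
  also have "\<dots> \<le> (\<Sum>k<K. gen_bound * (overlap w k t - overlap w k s))"
    using abs_generator_le[OF w] mono gen_bound_nonneg
    by (intro order_trans[OF sum_abs] sum_mono) (auto simp: abs_mult intro!: mult_mono)
  also have "\<dots> = gen_bound * ((\<Sum>k<K. overlap w k t) - (\<Sum>k<K. overlap w k s))"
    by (simp add: sum_subtractf sum_distrib_left right_diff_distrib)
  also have "\<dots> \<le> gen_bound * (t - s)"
  proof (rule mult_left_mono[OF _ gen_bound_nonneg])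
    show "(\<Sum>k<K. overlap w k t) - (\<Sum>k<K. overlap w k s) \<le> t - s"
      using T_nonneg[OF w, of K] s by (cases "T w K") (auto simp: sum_overlap[OF w] min_def)
  qed
  finally show ?thesis .
qed

lemma compensator_lipschitz:
  assumes w: "good b w" "nonexplosive w" and "0 \<le> s" "0 \<le> t"
  shows "\<bar>compensator w t - compensator w s\<bar> \<le> gen_bound * \<bar>t - s\<bar>"
proof -
  define K where "K = Suc (max (count w s) (count w t))"
  have "count w t < K" "count w s < K" by (simp_all add: K_def)
  then have "compensator w t = (\<Sum>k<K. generator w k * overlap w k t)"
    "compensator w s = (\<Sum>k<K. generator w k * overlap w k s)"
    using assms compensator_eq by blast+
  then show ?thesis
    using partial_compensator_lipschitz[OF w(1), of s t K] partial_compensator_lipschitz[OF w(1), of t s K] assms(3,4)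
    by (cases "s \<le> t") (auto simp: abs_minus_commute)
qed

lemma compensator_0: "good b w \<Longrightarrow> compensator w 0 = 0"
proof -
  assume w: "good b w"
  have "overlap w k 0 = 0" for k
    using T_nonneg[OF w, of k] by (intro overlap_eq_0[OF w]) (simp add: zero_ereal_def)
  then show ?thesis by (simp add: compensator_def)
qed

lemma abs_compensator_le:
  assumes "good b w" "nonexplosive w" "0 \<le> t"
  shows "\<bar>compensator w t\<bar> \<le> gen_bound * t"
  using compensator_lipschitz[OF assms(1,2), of 0 t] compensator_0[OF assms(1)] assms(3) by simp

lemma integrable_compensator:
  assumes "0 \<le> t"
  shows "integrable Q (\<lambda>w. compensator w t)"
proof (rule integrable_const_bound)
  show "AE w in Q. norm (compensator w t) \<le> gen_bound * t"
    using AE_good AE_nonexplosive by eventually_elim (simp add: abs_compensator_le assms)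
qed simp

text \<open>When the path is stopped after \<open>K\<close> events, the jumps telescope and their
  expectations are known. Then \<open>K\<close> tends to infinity, with b^2 dominating the variances
  and \<open>gen_bound * t\<close> the partial compensators.\<close>

lemma dynkin:
  assumes t: "0 \<le> t"
  shows "(\<integral>w. var w (count w t) \<partial>Q) = (\<integral>w. var w 0 \<partial>Q) + (\<integral>w. compensator w t \<partial>Q)"
proof -
  note ae = AE_good AE_nonexplosive
  have int_inc: "integrable Q (\<lambda>w. of_bool (T w (Suc k) \<le> ereal t) * (var w (Suc k) - var w k))" for k
    using abs_jump_le drift_bound_nonneg
    by (intro integrable_good[of _ drift_bound]) (auto simp: of_bool_def)
  have int_gen: "integrable Q (\<lambda>w. generator w k * overlap w k t)" for k
    using abs_generator_le by (intro integrable_rate_overlap[OF t]) auto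
  have telescope: "(\<Sum>k<K. of_bool (T w (Suc k) \<le> ereal t) * (var w (Suc k) - var w k)) = var w (min K (count w t)) - var w 0"
    if "good b w" "nonexplosive w" for K w
  proof (induction K)
    case (Suc K)
    then show ?case by (cases "K < count w t") (simp_all add: event_before_iff[OF that t] min_def)
  qed simp
  have partial: "(\<integral>w. var w (min K (count w t)) \<partial>Q) = (\<integral>w. var w 0 \<partial>Q) + (\<integral>w. (\<Sum>k<K. generator w k * overlap w k t) \<partial>Q)" for K
  proof -
    have [measurable]: "(\<lambda>w. var w (min K (count w t))) \<in> borel_measurable noise_space"
      by (rule measurable_at_count[where f = "\<lambda>w n. var w (min K n)"]) measurable
    have i: "integrable Q (\<lambda>w. var w (min K (count w t)))" "integrable Q (\<lambda>w. var w 0)"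
      using var_nonneg var_le by (auto intro!: integrable_good[of _ "b\<^sup>2"])
    have "(\<integral>w. var w (min K (count w t)) \<partial>Q) - (\<integral>w. var w 0 \<partial>Q) = (\<integral>w. var w (min K (count w t)) - var w 0 \<partial>Q)"
      using i by simp
    also have "\<dots> = (\<integral>w. (\<Sum>k<K. of_bool (T w (Suc k) \<le> ereal t) * (var w (Suc k) - var w k)) \<partial>Q)"
    proof (rule integral_cong_AE)
      show "AE w in Q. var w (min K (count w t)) - var w 0
          = (\<Sum>k<K. of_bool (T w (Suc k) \<le> ereal t) * (var w (Suc k) - var w k))"
        using ae by eventually_elim (simp only: telescope)
    qed (simp_all only: measurable_Q, measurable)
    also have "\<dots> = (\<Sum>k<K. \<integral>w. generator w k * overlap w k t \<partial>Q)"
      unfolding expected_increment[OF t, symmetric] by (intro Bochner_Integration.integral_sum int_inc)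
    also have "\<dots> = (\<integral>w. (\<Sum>k<K. generator w k * overlap w k t) \<partial>Q)"
      using int_gen by simp
    finally show ?thesis by simp
  qed
  have "(\<lambda>K. \<integral>w. var w (min K (count w t)) \<partial>Q) \<longlonglongrightarrow> (\<integral>w. var w (count w t) \<partial>Q)"
  proof (rule integral_dominated_convergence[where w = "\<lambda>_. b\<^sup>2"])
    show "AE w in Q. (\<lambda>K. var w (min K (count w t))) \<longlonglongrightarrow> var w (count w t)"
    proof (rule AE_I2)
      fix w
      have "\<forall>\<^sub>F K in sequentially. var w (min K (count w t)) = var w (count w t)"
        using eventually_ge_at_top[of "count w t"] by eventually_elim (simp add: min_absorb2)
      then show "(\<lambda>K. var w (min K (count w t))) \<longlonglongrightarrow> var w (count w t)"
        by (rule tendsto_eventually)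
    qed
    show "AE w in Q. norm (var w (min K (count w t))) \<le> b\<^sup>2" for K
      using AE_good var_nonneg var_le by (auto elim!: eventually_mono)
    show "(\<lambda>w. var w (min K (count w t))) \<in> borel_measurable Q" for K
      using measurable_at_count[where f = "\<lambda>w n. var w (min K n)"] by simp
  qed auto
  moreover have "(\<lambda>K. (\<integral>w. var w 0 \<partial>Q) + (\<integral>w. (\<Sum>k<K. generator w k * overlap w k t) \<partial>Q))
      \<longlonglongrightarrow> (\<integral>w. var w 0 \<partial>Q) + (\<integral>w. compensator w t \<partial>Q)"
  proof (rule tendsto_add[OF tendsto_const], rule integral_dominated_convergence[where w = "\<lambda>_. gen_bound * t"])
    show "AE w in Q. (\<lambda>K. \<Sum>k<K. generator w k * overlap w k t) \<longlonglongrightarrow> compensator w t"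
      using ae
    proof eventually_elim
      case (elim w)
      have "\<forall>\<^sub>F K in sequentially. (\<Sum>k<K. generator w k * overlap w k t) = compensator w t"
        using eventually_gt_at_top[of "count w t"]
        by eventually_elim (simp add: compensator_eq[OF elim t])
      then show ?case by (rule tendsto_eventually)
    qed
    show "AE w in Q. norm (\<Sum>k<K. generator w k * overlap w k t) \<le> gen_bound * t" for K
      using AE_good
    proof eventually_elim
      case (elim w)
      have "overlap w k 0 = 0" for k
        using T_nonneg[OF elim, of k] by (intro overlap_eq_0[OF elim]) (simp add: zero_ereal_def)
      then show ?case
        using partial_compensator_lipschitz[OF elim, of 0 t K] t by simp
    qed
  qed auto
  ultimately show ?thesis
    unfolding partial by (rule LIMSEQ_unique)
qed

text \<open>Between two events the compensator has the generator as its slope. A neighbourhood on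
  both sides of \<open>t\<close> lies in one such period unless \<open>t\<close> is an event time;
  at t = 0 the neighbourhood is one-sided and the period may start at \<open>t\<close>.\<close>

lemma compensator_locally_linear:
  assumes w: "good b w" "nonexplosive w" and t: "0 \<le> t"
    and no_jump: "0 < t \<Longrightarrow> \<forall>k. T w (Suc k) \<noteq> ereal t"
  shows "\<forall>\<^sub>F u in at t within {0..}. compensator w u - compensator w t = generator w (count w t) * (u - t)"
proof -
  define n where "n = count w t"
  note n_bounds = count_bounds[OF w t, folded n_def]
  obtain a where a: "T w n = ereal a" "0 \<le> a" "a \<le> t"
    using n_bounds(1) T_nonneg[OF w(1), of n] by (cases "T w n") auto
  \<comment> \<open>At t = 0 the bounds 0 <= a <= t leave only a = 0.\<close>
  have at: "a < t \<or> a = 0"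
  proof (cases n)
    case 0
    then show ?thesis using a by (simp add: T_simps zero_ereal_def)
  next
    case (Suc j)
    show ?thesis
    proof (cases "0 < t")
      case True
      then have "T w n \<noteq> ereal t" using no_jump Suc by simp
      then show ?thesis using a by auto
    qed (use a in auto)
  qed
  have "\<forall>\<^sub>F u in at t within {0..}. ereal u < T w (Suc n)"
  proof (cases "T w (Suc n)")
    case (real c)
    then have "t < c" using n_bounds(2) by simp
    then show ?thesis
      using real order_tendstoD(2)[OF tendsto_ident_at, of t c "{0..}"] by simp
  qed (use n_bounds(2) in auto)
  moreover have "\<forall>\<^sub>F u in at t within {0..}. a \<le> u"
    using at
  proof
    assume "a < t"
    from order_tendstoD(1)[OF tendsto_ident_at this] show ?thesis
      by (rule eventually_mono) simp
  qed (simp add: eventually_at_filter)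
  moreover have "\<forall>\<^sub>F u in at t within {0..}. 0 \<le> u"
    by (simp add: eventually_at_filter)
  ultimately show ?thesis
  proof eventually_elim
    case (elim u)
    have u: "count w u = n"
      using elim a by (intro count_unique[OF w(1)]) auto
    \<comment> \<open>Completed periods contribute constants that cancel in the difference; only the
      current period depends on the time.\<close>
    have *: "compensator w v = (\<Sum>k<n. generator w k * (real_of_ereal (T w (Suc k)) - real_of_ereal (T w k)))
        + generator w n * (v - a)" if v: "a \<le> v" "ereal v < T w (Suc n)" "count w v = n" for v
    proof -
      have "overlap w k v = real_of_ereal (T w (Suc k)) - real_of_ereal (T w k)" if "k < n" for k
      proof -
        have "T w (Suc k) \<le> T w n" "T w k \<le> T w n" using that T_mono[OF w(1)] by auto
        moreover have "T w n \<le> ereal v" using a(1) v(1) by simp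
        ultimately have "T w (Suc k) \<le> ereal v" "T w k \<le> ereal v"
          by (blast intro: order_trans)+
        then show ?thesis by (simp add: overlap_def min_absorb1)
      qed
      then have "(\<Sum>k<n. generator w k * overlap w k v)
          = (\<Sum>k<n. generator w k * (real_of_ereal (T w (Suc k)) - real_of_ereal (T w k)))"
        by (intro sum.cong) auto
      moreover have "overlap w n v = v - a"
        unfolding overlap_def a(1) using v(1) less_imp_le[OF v(2)] by (simp add: min_absorb2)
      ultimately show ?thesis
        unfolding compensator_def v(3) lessThan_Suc_atMost[symmetric] sum.lessThan_Suc by simp
    qed
    have ct: "count w t = n" by (simp only: n_def)
    show ?case
      unfolding *[OF elim(2,1) u] *[OF a(3) n_bounds(2) ct] ct by (simp add: algebra_simps)
  qed
qed

text \<open>Difference quotients of the compensator are bounded by \<open>gen_bound\<close> and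
  converge on almost every path, a time t > 0 being almost surely not an event time. The limit is
  tested along sequences so that dominated convergence applies.\<close>

theorem expected_variance_derivative:
  assumes t: "0 \<le> t"
  shows "((\<lambda>s. \<integral>w. var w (count w s) \<partial>Q) has_real_derivative (\<integral>w. generator w (count w t) \<partial>Q)) (at t within {0..})"
  unfolding has_field_derivative_iff tendsto_at_iff_sequentially
proof (intro allI impI)
  fix X assume X: "\<forall>i. X i \<in> {0..} - {t}" "X \<longlonglongrightarrow> t"
  have X0: "0 \<le> X i" "X i \<noteq> t" for i using X(1) by auto
  have "(\<lambda>i. \<integral>w. (compensator w (X i) - compensator w t) / (X i - t) \<partial>Q) \<longlonglongrightarrow> (\<integral>w. generator w (count w t) \<partial>Q)"
  proof (rule integral_dominated_convergence[where w = "\<lambda>_. gen_bound"])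
    have "AE w in Q. \<forall>k. 0 < t \<longrightarrow> T w (Suc k) \<noteq> ereal t"
      unfolding AE_all_countable using AE_jump_time_neq by auto
    with AE_good AE_nonexplosive
    show "AE w in Q. (\<lambda>i. (compensator w (X i) - compensator w t) / (X i - t)) \<longlonglongrightarrow> generator w (count w t)"
    proof eventually_elim
      case (elim w)
      have "filterlim X (at t within {0..}) sequentially"
        using X by (auto simp: filterlim_at)
      from eventually_compose_filterlim[OF compensator_locally_linear[OF elim(1,2) t] this] elim(3)
      have "\<forall>\<^sub>F i in sequentially. compensator w (X i) - compensator w t = generator w (count w t) * (X i - t)"
        by simp
      then have "\<forall>\<^sub>F i in sequentially. (compensator w (X i) - compensator w t) / (X i - t) = generator w (count w t)"
        by eventually_elim (use X0 in simp)
      then show ?case by (rule tendsto_eventually)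
    qed
    show "AE w in Q. norm ((compensator w (X i) - compensator w t) / (X i - t)) \<le> gen_bound" for i
      using AE_good AE_nonexplosive
    proof eventually_elim
      case (elim w)
      have "\<bar>compensator w (X i) - compensator w t\<bar> \<le> gen_bound * \<bar>X i - t\<bar>"
        by (rule compensator_lipschitz[OF elim t X0(1)])
      then show ?case using X0(2)[of i] by (simp add: divide_le_eq abs_divide)
    qed
  qed auto
  moreover have "((\<lambda>s. ((\<integral>w. var w (count w s) \<partial>Q) - (\<integral>w. var w (count w t) \<partial>Q)) / (s - t)) \<circ> X)
      = (\<lambda>i. \<integral>w. (compensator w (X i) - compensator w t) / (X i - t) \<partial>Q)"
    using integrable_compensator t X0(1) by (simp add: fun_eq_iff dynkin)
  ultimately show "((\<lambda>s. ((\<integral>w. var w (count w s) \<partial>Q) - (\<integral>w. var w (count w t) \<partial>Q)) / (s - t)) \<circ> X)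
      \<longlonglongrightarrow> (\<integral>w. generator w (count w t) \<partial>Q)"
    by simp
qed

section \<open>Conditional second moments of mean and variance, in weak form\<close>

section \<open>Second moments given the sizes and event times\<close>

text \<open>Bounded nonnegative test functions of the initial size and the clocks. Testing against
  all of them expresses inequalities between conditional expectations given this history. The
  dependence is required on good paths only, where it can be verified.\<close>

definition history_weight :: "(noise \<Rightarrow> real) \<Rightarrow> bool" where
  "history_weight Z \<longleftrightarrow> Z \<in> borel_measurable noise_space \<and> (\<exists>B. \<forall>w. good b w \<longrightarrow> 0 \<le> Z w \<and> Z w \<le> B) \<and>
     (\<forall>w w'. good b w \<longrightarrow> good b w' \<longrightarrow> init_size w = init_size w' \<longrightarrow> clock w = clock w' \<longrightarrow> Z w = Z w')"

lemma history_weightI: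
  assumes "Z \<in> borel_measurable noise_space" "\<And>w. good b w \<Longrightarrow> 0 \<le> Z w \<and> Z w \<le> B"
    and "\<And>w w'. good b w \<Longrightarrow> good b w' \<Longrightarrow> init_size w = init_size w' \<Longrightarrow> clock w = clock w' \<Longrightarrow> Z w = Z w'"
  shows "history_weight Z"
  unfolding history_weight_def using assms by blast

lemma history_weightD:
  assumes "history_weight Z"
  shows "Z \<in> borel_measurable noise_space" "\<exists>B. \<forall>w. good b w \<longrightarrow> 0 \<le> Z w \<and> Z w \<le> B"
    and "\<And>w w'. good b w \<Longrightarrow> good b w' \<Longrightarrow> init_size w = init_size w' \<Longrightarrow> clock w = clock w' \<Longrightarrow> Z w = Z w'"
  using assms unfolding history_weight_def by blast+

lemma history_weight_mult:
  assumes Y: "history_weight Y" and Z: "history_weight Z"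
  shows "history_weight (\<lambda>w. Y w * Z w)"
proof -
  obtain B where B: "\<And>w. good b w \<Longrightarrow> 0 \<le> Y w \<and> Y w \<le> B" using history_weightD(2)[OF Y] by blast
  obtain C where C: "\<And>w. good b w \<Longrightarrow> 0 \<le> Z w \<and> Z w \<le> C" using history_weightD(2)[OF Z] by blast
  show ?thesis
  proof (rule history_weightI[where B = "B * C"])
    show "(\<lambda>w. Y w * Z w) \<in> borel_measurable noise_space"
      by (intro borel_measurable_times history_weightD(1) Y Z)
    show "0 \<le> Y w * Z w \<and> Y w * Z w \<le> B * C" if "good b w" for w
    proof
      show "0 \<le> Y w * Z w" using B[OF that] C[OF that] by simp
      show "Y w * Z w \<le> B * C" using B[OF that] C[OF that] by (intro mult_mono) auto
    qed
    show "Y w * Z w = Y w' * Z w'"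
      if "good b w" "good b w'" "init_size w = init_size w'" "clock w = clock w'" for w w'
      using history_weightD(3)[OF Y that] history_weightD(3)[OF Z that] by simp
  qed
qed

lemma history_weight_size:
  assumes "\<And>n. 0 \<le> f n" "\<And>n. f n \<le> B"
  shows "history_weight (\<lambda>w. f (size_of w k))"
proof (rule history_weightI[where B = B])
  show "f (size_of w k) = f (size_of w' k)"
    if "good b w" "good b w'" "init_size w = init_size w'" "clock w = clock w'" for w w'
    using history_determined(1)[OF that] by simp
qed (use assms in auto)

lemma history_weight_event: "history_weight (\<lambda>w. of_bool (ev w k = e))"
proof (rule history_weightI[where B = 1])
  show "of_bool (ev w k = e) = (of_bool (ev w' k = e) :: real)"
    if "good b w" "good b w'" "init_size w = init_size w'" "clock w = clock w'" for w w'
    using history_determined(2)[OF that] by simp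
qed auto

text \<open>The end of the interval depends on the clocks of event \<open>k\<close>, hence on more
  than the first \<open>k\<close> steps. This is why weights may depend on all clocks.\<close>

lemma history_weight_interval: "history_weight (\<lambda>w. of_bool (T w k \<le> ereal t \<and> ereal t < T w (Suc k)))"
proof (rule history_weightI[where B = 1])
  show "of_bool (T w k \<le> ereal t \<and> ereal t < T w (Suc k)) = (of_bool (T w' k \<le> ereal t \<and> ereal t < T w' (Suc k)) :: real)"
    if "good b w" "good b w'" "init_size w = init_size w'" "clock w = clock w'" for w w'
    using history_determined(3)[OF that] by simp
qed auto

lemma history_weight_mix:
  assumes "history_weight Z" "S \<inter> history_sources = {}" "good b w" "good b w'"
  shows "Z (mix S w' w) = Z w'"
proof -
  have "Init_Size \<notin> S" "Clock e k \<notin> S" for e k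
    using assms(2) by (auto simp: history_sources_def)
  then have "init_size (mix S w' w) = init_size w'" "clock (mix S w' w) = clock w'"
    by (auto simp: mix_def)
  then show ?thesis
    by (rule history_weightD(3)[OF assms(1) good_mix[OF assms(4,3)] assms(4)])
qed

lemma integrable_weighted:
  assumes "history_weight Z" and [measurable]: "f \<in> borel_measurable noise_space"
    and f: "\<And>w. good b w \<Longrightarrow> \<bar>f w\<bar> \<le> B"
  shows "integrable Q (\<lambda>w. Z w * f w)"
proof -
  obtain C where C: "\<And>w. good b w \<Longrightarrow> 0 \<le> Z w \<and> Z w \<le> C" using history_weightD(2)[OF assms(1)] by blast
  have [measurable]: "Z \<in> borel_measurable noise_space" using assms(1) by (simp add: history_weight_def)
  have "\<bar>Z w * f w\<bar> \<le> C * B" if "good b w" for w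
    using C[OF that] f[OF that] unfolding abs_mult by (intro mult_mono) auto
  then show ?thesis by (intro integrable_good[of _ "C * B"]) auto
qed

text \<open>Mean square of the average of n independent draws from the distribution; the value 0 at
  n = 0 agrees with the convention for the empty mean.\<close>

definition mean_target :: "nat \<Rightarrow> real" where
  "mean_target n = \<sigma>\<^sup>2 / real n"

text \<open>Expected empirical variance of n independent draws; it is 0 for n = 1 and, by division
  by 0, for n = 0.\<close>

definition var_target :: "nat \<Rightarrow> real" where
  "var_target n = \<sigma>\<^sup>2 * (real n - 1) / real n"

lemma abs_targets: "\<bar>mean_target n\<bar> \<le> \<sigma>\<^sup>2" "\<bar>var_target n\<bar> \<le> \<sigma>\<^sup>2"
proof -
  show "\<bar>mean_target n\<bar> \<le> \<sigma>\<^sup>2"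
    by (cases n) (auto simp: mean_target_def divide_le_eq mult_le_cancel_left1)
  show "\<bar>var_target n\<bar> \<le> \<sigma>\<^sup>2"
    by (cases n) (auto simp: var_target_def abs_mult divide_le_eq intro: mult_left_mono)
qed

text \<open>Quantified over all weights because a step of the induction multiplies the given weight
  by functions of the size and of the event type.\<close>

definition moment_bounds :: "nat \<Rightarrow> bool" where
  "moment_bounds k \<longleftrightarrow> (\<forall>Z. history_weight Z \<longrightarrow>
     (\<integral>w. Z w * (mean w k)\<^sup>2 \<partial>Q) \<le> (\<integral>w. Z w * mean_target (size_of w k) \<partial>Q) \<and>
     (\<integral>w. Z w * var w k \<partial>Q) \<le> (\<integral>w. Z w * var_target (size_of w k) \<partial>Q))"

text \<open>Resampling the last value shows it to be orthogonal to the sum of the others, so the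
  mean squares add up.\<close>

lemma integral_init_values:
  "(\<integral>w. (\<Sum>i<n. init_value w i)\<^sup>2 \<partial>Q) = real n * \<sigma>\<^sup>2"
  "(\<integral>w. (\<Sum>i<n. (init_value w i)\<^sup>2) \<partial>Q) = real n * \<sigma>\<^sup>2"
  "integrable Q (\<lambda>w. (\<Sum>i<n. init_value w i)\<^sup>2)" "integrable Q (\<lambda>w. \<Sum>i<n. (init_value w i)\<^sup>2)"
proof -
  have int: "integrable Q (\<lambda>w. (\<Sum>i<n. init_value w i)\<^sup>2)" for n
  proof (rule integrable_good[of _ "(real n * b)\<^sup>2"])
    fix w assume w: "good b w"
    have "\<bar>\<Sum>i<n. init_value w i\<bar> \<le> (\<Sum>i<n. b)"
      using w by (intro order_trans[OF sum_abs] sum_mono) (auto simp: good_def)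
    then have "\<bar>\<Sum>i<n. init_value w i\<bar>\<^sup>2 \<le> (real n * b)\<^sup>2"
      by (intro power_mono) auto
    then show "\<bar>(\<Sum>i<n. init_value w i)\<^sup>2\<bar> \<le> (real n * b)\<^sup>2" by simp
  qed measurable
  have sq: "integrable Q (\<lambda>w. (init_value w i)\<^sup>2)" for i
  proof (rule integrable_good[of _ "b\<^sup>2"])
    fix w assume "good b w"
    then have "\<bar>init_value w i\<bar>\<^sup>2 \<le> b\<^sup>2" by (intro power_mono) (auto simp: good_def)
    then show "\<bar>(init_value w i)\<^sup>2\<bar> \<le> b\<^sup>2" by simp
  qed measurable
  show "integrable Q (\<lambda>w. (\<Sum>i<n. init_value w i)\<^sup>2)" "integrable Q (\<lambda>w. \<Sum>i<n. (init_value w i)\<^sup>2)"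
    using int sq by auto
  show "(\<integral>w. (\<Sum>i<n. (init_value w i)\<^sup>2) \<partial>Q) = real n * \<sigma>\<^sup>2"
    using sq integral_square_shift[OF measurable_noise(2) init_value_law, of _ 0] by simp
  show "(\<integral>w. (\<Sum>i<n. init_value w i)\<^sup>2 \<partial>Q) = real n * \<sigma>\<^sup>2"
  proof (induction n)
    case (Suc n)
    have "(\<Sum>i<Suc n. init_value (mix {Init_Value n} w' w) i) = init_value w n + (\<Sum>i<n. init_value w' i)" for w w'
      by (simp add: mix_def)
    note inner = this
    have "(\<integral>w. (\<Sum>i<Suc n. init_value w i)\<^sup>2 \<partial>Q)
        = (\<integral>w'. (\<integral>w. (\<Sum>i<Suc n. init_value (mix {Init_Value n} w' w) i)\<^sup>2 \<partial>Q) \<partial>Q)"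
      by (rule integral_mix[OF int, symmetric])
    also have "\<dots> = (\<integral>w'. (\<integral>w. (init_value w n + (\<Sum>i<n. init_value w' i))\<^sup>2 \<partial>Q) \<partial>Q)"
      by (simp only: inner)
    also have "\<dots> = (\<integral>w'. \<sigma>\<^sup>2 + (\<Sum>i<n. init_value w' i)\<^sup>2 \<partial>Q)"
      by (simp only: integral_square_shift[OF measurable_noise(2) init_value_law])
    also have "\<dots> = \<sigma>\<^sup>2 + real n * \<sigma>\<^sup>2"
      using int Suc prob_space by simp
    finally show ?case by (simp add: algebra_simps)
  qed simp
qed

text \<open>Given the history, the initial values are a known number of independent draws, and they
  are resampled together; both bounds are equalities here.\<close>

lemma moment_bounds_0: "moment_bounds 0"
  unfolding moment_bounds_def
proof (intro allI impI)
  fix Z assume Z: "history_weight Z"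
  define S where "S = range Init_Value"
  have S: "S \<inter> history_sources = {}" by (auto simp: S_def history_sources_def)
  have mix: "init_size (mix S w' w) = init_size w'" "init_value (mix S w' w) = init_value w" for w' w
    by (auto simp: mix_def S_def)
  have [measurable]: "Z \<in> borel_measurable noise_space" using Z by (simp add: history_weight_def)
  have eq: "(\<integral>w. Z w * f w \<partial>Q) = (\<integral>w. Z w * g (size_of w 0) \<partial>Q)"
    if [measurable]: "f \<in> borel_measurable noise_space" and f: "\<And>w. good b w \<Longrightarrow> \<bar>f w\<bar> \<le> b\<^sup>2"
      and g: "\<And>n. \<bar>g n\<bar> \<le> \<sigma>\<^sup>2" and frozen: "\<And>w'. (\<integral>w. f (mix S w' w) \<partial>Q) = g (init_size w')"
    for f and g :: "nat \<Rightarrow> real"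
  proof (rule integral_eq_by_resampling[where S = S])
    show "integrable Q (\<lambda>w. Z w * f w)" by (rule integrable_weighted[OF Z _ f]) measurable
    show "integrable Q (\<lambda>w. Z w * g (size_of w 0))" by (rule integrable_weighted[OF Z _ g]) measurable
    show "AE w' in Q. (\<integral>w. Z (mix S w' w) * f (mix S w' w) \<partial>Q) = (\<integral>w. Z (mix S w' w) * g (size_of (mix S w' w) 0) \<partial>Q)"
      using AE_good
    proof eventually_elim
      case (elim w')
      have "(\<integral>w. Z (mix S w' w) * f (mix S w' w) \<partial>Q) = (\<integral>w. Z w' * f (mix S w' w) \<partial>Q)"
        using history_weight_mix[OF Z S _ elim] by (intro integral_good_cong) auto
      also have "\<dots> = (\<integral>w. Z w' * g (init_size w') \<partial>Q)"
        using prob_space by (simp add: frozen)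
      also have "\<dots> = (\<integral>w. Z (mix S w' w) * g (size_of (mix S w' w) 0) \<partial>Q)"
        using history_weight_mix[OF Z S _ elim] by (intro integral_good_cong) (auto simp: chain_0 mix)
      finally show ?case .
    qed
  qed
  have m: "(mean (mix S w' w) 0)\<^sup>2 = (\<Sum>i<init_size w'. init_value w i)\<^sup>2 / (real (init_size w'))\<^sup>2" for w w'
    by (simp add: mean_def chain_0 mix emp_mean_def power_divide)
  have v: "var (mix S w' w) 0 = (\<Sum>i<init_size w'. (init_value w i)\<^sup>2) / real (init_size w')
      - (\<Sum>i<init_size w'. init_value w i)\<^sup>2 / (real (init_size w'))\<^sup>2" for w w'
    by (simp add: var_def chain_0 mix emp_var_eq emp_mean_def power_divide)
  have "(\<integral>w. Z w * (mean w 0)\<^sup>2 \<partial>Q) = (\<integral>w. Z w * mean_target (size_of w 0) \<partial>Q)"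
  proof (rule eq)
    show "(\<integral>w. (mean (mix S w' w) 0)\<^sup>2 \<partial>Q) = mean_target (init_size w')" for w'
    proof -
      have "(\<integral>w. (mean (mix S w' w) 0)\<^sup>2 \<partial>Q) = real (init_size w') * \<sigma>\<^sup>2 / (real (init_size w'))\<^sup>2"
        by (simp only: m integral_divide_zero integral_init_values)
      then show ?thesis
        by (cases "init_size w' = 0") (simp_all add: mean_target_def power2_eq_square)
    qed
  qed (use mean_square_le abs_targets in auto)
  moreover have "(\<integral>w. Z w * var w 0 \<partial>Q) = (\<integral>w. Z w * var_target (size_of w 0) \<partial>Q)"
  proof (rule eq)
    show "(\<integral>w. var (mix S w' w) 0 \<partial>Q) = var_target (init_size w')" for w'
    proof -
      have "(\<integral>w. var (mix S w' w) 0 \<partial>Q) = real (init_size w') * \<sigma>\<^sup>2 / real (init_size w')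
          - real (init_size w') * \<sigma>\<^sup>2 / (real (init_size w'))\<^sup>2"
        unfolding v
        by (subst Bochner_Integration.integral_diff)
           (auto simp only: integral_divide_zero integral_init_values intro!: integrable_divide_zero integral_init_values)
      then show ?thesis
        by (cases "init_size w' = 0") (simp_all add: var_target_def power2_eq_square field_simps)
    qed
  qed (use var_nonneg var_le abs_targets in auto)
  ultimately show "(\<integral>w. Z w * (mean w 0)\<^sup>2 \<partial>Q) \<le> (\<integral>w. Z w * mean_target (size_of w 0) \<partial>Q) \<and>
     (\<integral>w. Z w * var w 0 \<partial>Q) \<le> (\<integral>w. Z w * var_target (size_of w 0) \<partial>Q)"
    by simp
qed

text \<open>Common scheme for all events and both moments. Averaging the choices gives \<alpha> m^2
  + \<beta> V + \<gamma> with coefficients depending on the size. Absorbed into the weight, which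
  requires \<alpha> and \<beta> to be nonnegative, they let the induction hypothesis replace m^2 and
  V by their targets. \<open>R\<close> is the target after the event.\<close>

lemma moment_step:
  assumes IH: "moment_bounds k" and Z: "history_weight Z" and S: "S \<subseteq> marks k"
    and \<alpha>: "\<And>n. 0 \<le> \<alpha> n \<and> \<alpha> n \<le> 1" and \<beta>: "\<And>n. 0 \<le> \<beta> n \<and> \<beta> n \<le> (1 :: real)"
    and \<gamma>: "\<And>n. 0 \<le> \<gamma> n \<and> \<gamma> n \<le> \<sigma>\<^sup>2"
    and [measurable]: "F \<in> borel_measurable noise_space" and F: "\<And>w. good b w \<Longrightarrow> \<bar>F w\<bar> \<le> b\<^sup>2"
    and frozen: "\<And>w'. good b w' \<Longrightarrow> ev w' k = e \<Longrightarrow> (\<integral>w. F (mix S w' w) \<partial>Q)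
      = \<alpha> (size_of w' k) * (mean w' k)\<^sup>2 + \<beta> (size_of w' k) * var w' k + \<gamma> (size_of w' k)"
    and R: "\<And>n. \<bar>R n\<bar> \<le> \<sigma>\<^sup>2"
    and target: "\<And>w. good b w \<Longrightarrow> ev w k = e \<Longrightarrow> \<alpha> (size_of w k) * mean_target (size_of w k)
      + \<beta> (size_of w k) * var_target (size_of w k) + \<gamma> (size_of w k) \<le> R (size_of w (Suc k))"
  shows "(\<integral>w. Z w * of_bool (ev w k = e) * F w \<partial>Q) \<le> (\<integral>w. Z w * of_bool (ev w k = e) * R (size_of w (Suc k)) \<partial>Q)"
proof -
  define Y where "Y w = Z w * of_bool (ev w k = e)" for w
  have Y: "history_weight Y" unfolding Y_def by (intro history_weight_mult Z history_weight_event)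
  have Y0: "0 \<le> Y w" if "good b w" for w using history_weightD(2)[OF Y] that by blast
  have [measurable]: "Z \<in> borel_measurable noise_space" "Y \<in> borel_measurable noise_space"
    using Y Z by (simp_all add: history_weight_def)
  obtain B where B: "\<And>w. good b w \<Longrightarrow> 0 \<le> Z w \<and> Z w \<le> B" using history_weightD(2)[OF Z] by blast
  have S': "S \<subseteq> level_sources k" "S \<inter> history_sources = {}" using S by (auto simp: marks_def)
  define n where "n w = size_of w k" for w
  have [measurable]: "n \<in> noise_space \<rightarrow>\<^sub>M count_space UNIV" unfolding n_def by measurable
  have weights: "history_weight (\<lambda>w. Y w * \<alpha> (n w))" "history_weight (\<lambda>w. Y w * \<beta> (n w))"
    unfolding n_def using \<alpha> \<beta> by (auto intro!: history_weight_mult Y history_weight_size)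
  have int_\<gamma>: "integrable Q (\<lambda>w. Y w * \<gamma> (n w))"
    using \<gamma> by (intro integrable_weighted[OF Y, where B = "\<sigma>\<^sup>2"]) auto
  define G where "G w = \<alpha> (n w) * (mean w k)\<^sup>2 + \<beta> (n w) * var w k + \<gamma> (n w)" for w
  have [measurable]: "G \<in> borel_measurable noise_space" unfolding G_def by measurable
  have "(\<integral>w. Z w * of_bool (ev w k = e) * F w \<partial>Q) = (\<integral>w. Z w * of_bool (ev w k = e) * G w \<partial>Q)"
  proof (rule integral_by_resampling_marks[OF S', where B = B and B' = "2 * b\<^sup>2 + \<sigma>\<^sup>2"])
    show "\<bar>G w\<bar> \<le> 2 * b\<^sup>2 + \<sigma>\<^sup>2" if "good b w" for w
    proof -
      have "\<alpha> (n w) * (mean w k)\<^sup>2 \<le> 1 * b\<^sup>2"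
        using \<alpha>[of "n w"] mean_square_le[OF that, of k] by (intro mult_mono) auto
      moreover have "\<beta> (n w) * var w k \<le> 1 * b\<^sup>2"
        using \<beta>[of "n w"] var_le[OF that, of k] var_nonneg[of w k] by (intro mult_mono) auto
      moreover have "0 \<le> G w" unfolding G_def using \<alpha> \<beta> \<gamma> var_nonneg by auto
      ultimately show ?thesis using \<gamma>[of "n w"] unfolding G_def by linarith
    qed
    show "\<bar>F w\<bar> \<le> 2 * b\<^sup>2 + \<sigma>\<^sup>2" if "good b w" for w
    proof -
      have "0 \<le> b\<^sup>2" "0 \<le> \<sigma>\<^sup>2" by simp_all
      then show ?thesis using F[OF that] by linarith
    qed
    show "G (mix S w' w) = G w'" for w w'
      by (simp add: G_def n_def level_mix[OF S'(1)] level_mix_var_mean[OF S'(1)])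
  qed (use B history_weight_mix[OF Z S'(2)] frozen in \<open>auto simp: G_def n_def\<close>)
  also have "\<dots> = (\<integral>w. Y w * \<alpha> (n w) * (mean w k)\<^sup>2 + Y w * \<beta> (n w) * var w k + Y w * \<gamma> (n w) \<partial>Q)"
    by (simp add: Y_def G_def algebra_simps)
  also have "\<dots> = (\<integral>w. Y w * \<alpha> (n w) * (mean w k)\<^sup>2 \<partial>Q) + (\<integral>w. Y w * \<beta> (n w) * var w k \<partial>Q) + (\<integral>w. Y w * \<gamma> (n w) \<partial>Q)"
  proof -
    have "integrable Q (\<lambda>w. Y w * \<alpha> (n w) * (mean w k)\<^sup>2)" "integrable Q (\<lambda>w. Y w * \<beta> (n w) * var w k)"
      using weights mean_square_le var_le var_nonneg by (auto intro!: integrable_weighted[where B = "b\<^sup>2"])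
    with int_\<gamma> show ?thesis by simp
  qed
  also have "\<dots> \<le> (\<integral>w. Y w * \<alpha> (n w) * mean_target (n w) \<partial>Q) + (\<integral>w. Y w * \<beta> (n w) * var_target (n w) \<partial>Q) + (\<integral>w. Y w * \<gamma> (n w) \<partial>Q)"
    using IH weights unfolding moment_bounds_def n_def by (intro add_mono) auto
  also have "\<dots> = (\<integral>w. Y w * (\<alpha> (n w) * mean_target (n w) + \<beta> (n w) * var_target (n w) + \<gamma> (n w)) \<partial>Q)"
  proof -
    have "integrable Q (\<lambda>w. Y w * \<alpha> (n w) * mean_target (n w))" "integrable Q (\<lambda>w. Y w * \<beta> (n w) * var_target (n w))"
      using weights abs_targets by (auto intro!: integrable_weighted[where B = "\<sigma>\<^sup>2"])
    with int_\<gamma> have "(\<integral>w. Y w * \<alpha> (n w) * mean_target (n w) \<partial>Q) + (\<integral>w. Y w * \<beta> (n w) * var_target (n w) \<partial>Q) + (\<integral>w. Y w * \<gamma> (n w) \<partial>Q)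
      = (\<integral>w. Y w * \<alpha> (n w) * mean_target (n w) + Y w * \<beta> (n w) * var_target (n w) + Y w * \<gamma> (n w) \<partial>Q)"
      by simp
    then show ?thesis by (simp add: algebra_simps)
  qed
  also have "\<dots> \<le> (\<integral>w. Y w * R (size_of w (Suc k)) \<partial>Q)"
  proof (rule integral_good_mono)
    show "integrable Q (\<lambda>w. Y w * R (size_of w (Suc k)))"
      using R by (intro integrable_weighted[OF Y, where B = "\<sigma>\<^sup>2"]) auto
    have "\<bar>\<alpha> m * mean_target m + \<beta> m * var_target m + \<gamma> m\<bar> \<le> 3 * \<sigma>\<^sup>2" for m
    proof -
      have "\<bar>\<alpha> m * mean_target m\<bar> \<le> 1 * \<sigma>\<^sup>2"
        unfolding abs_mult using \<alpha>[of m] abs_targets(1)[of m] by (intro mult_mono) auto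
      moreover have "\<bar>\<beta> m * var_target m\<bar> \<le> 1 * \<sigma>\<^sup>2"
        unfolding abs_mult using \<beta>[of m] abs_targets(2)[of m] by (intro mult_mono) auto
      ultimately show ?thesis using \<gamma>[of m] by linarith
    qed
    then show "integrable Q (\<lambda>w. Y w * (\<alpha> (n w) * mean_target (n w) + \<beta> (n w) * var_target (n w) + \<gamma> (n w)))"
      by (intro integrable_weighted[OF Y, where B = "3 * \<sigma>\<^sup>2"]) auto
    fix w assume w: "good b w"
    show "Y w * (\<alpha> (n w) * mean_target (n w) + \<beta> (n w) * var_target (n w) + \<gamma> (n w)) \<le> Y w * R (size_of w (Suc k))"
    proof (cases "ev w k = e")
      case True
      from target[OF w this] show ?thesis
        unfolding n_def by (intro mult_left_mono Y0[OF w])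
    qed (simp add: Y_def)
  qed
  finally show ?thesis by (simp add: Y_def)
qed

text \<open>Both targets are reproduced exactly; for the mean, n^2/(n+1)^2 times \<sigma>^2/n plus
  \<sigma>^2/(n+1)^2 is \<sigma>^2/(n+1). For n = 0 the first term is 0 and the newcomer alone gives
  \<sigma>^2.\<close>

lemma moment_step_Arrival:
  assumes IH: "moment_bounds k" and Z: "history_weight Z"
  shows "(\<integral>w. Z w * of_bool (ev w k = Arrival) * (mean w (Suc k))\<^sup>2 \<partial>Q)
      \<le> (\<integral>w. Z w * of_bool (ev w k = Arrival) * mean_target (size_of w (Suc k)) \<partial>Q)"
    "(\<integral>w. Z w * of_bool (ev w k = Arrival) * var w (Suc k) \<partial>Q)
      \<le> (\<integral>w. Z w * of_bool (ev w k = Arrival) * var_target (size_of w (Suc k)) \<partial>Q)"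
proof -
  have le1: "x / (x + 1) \<le> 1" "x\<^sup>2 / (x + 1)\<^sup>2 \<le> 1" "1 / (x + 1)\<^sup>2 \<le> 1" if "0 \<le> x" for x :: real
    using that by (simp_all add: divide_le_eq_1 power2_eq_square algebra_simps add_pos_nonneg)
  have scale: "0 \<le> c * \<sigma>\<^sup>2 \<and> c * \<sigma>\<^sup>2 \<le> \<sigma>\<^sup>2" if "0 \<le> c" "c \<le> 1" for c
    using that mult_right_mono[of c 1 "\<sigma>\<^sup>2"] by simp
  show "(\<integral>w. Z w * of_bool (ev w k = Arrival) * (mean w (Suc k))\<^sup>2 \<partial>Q)
      \<le> (\<integral>w. Z w * of_bool (ev w k = Arrival) * mean_target (size_of w (Suc k)) \<partial>Q)"
  proof (rule moment_step[OF IH Z marks_subsets(1),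
      where \<alpha> = "\<lambda>n. (real n)\<^sup>2 / (real n + 1)\<^sup>2" and \<beta> = "\<lambda>n. 0" and \<gamma> = "\<lambda>n. 1 / (real n + 1)\<^sup>2 * \<sigma>\<^sup>2"])
    fix w' assume "ev w' k = Arrival"
    from frozen_Arrival(2)[OF this]
    show "(\<integral>w. (mean (mix {New_Value k} w' w) (Suc k))\<^sup>2 \<partial>Q)
      = (real (size_of w' k))\<^sup>2 / (real (size_of w' k) + 1)\<^sup>2 * (mean w' k)\<^sup>2 + 0 * var w' k
        + 1 / (real (size_of w' k) + 1)\<^sup>2 * \<sigma>\<^sup>2"
      by (simp add: add_divide_distrib)
  next
    fix w assume w: "good b w" "ev w k = Arrival"
    define x where "x = real (size_of w k)"
    have x: "x + 1 \<noteq> 0" by (simp add: x_def add_nonneg_eq_0_iff)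
    have "x\<^sup>2 / (x + 1)\<^sup>2 * (\<sigma>\<^sup>2 / x) + 1 / (x + 1)\<^sup>2 * \<sigma>\<^sup>2 = (x + 1) * \<sigma>\<^sup>2 / ((x + 1) * (x + 1))"
      by (cases "x = 0") (simp_all add: power2_eq_square add_divide_distrib[symmetric] algebra_simps)
    also have "\<dots> = \<sigma>\<^sup>2 / (x + 1)" using x by simp
    finally show "(real (size_of w k))\<^sup>2 / (real (size_of w k) + 1)\<^sup>2 * mean_target (size_of w k)
        + 0 * var_target (size_of w k) + 1 / (real (size_of w k) + 1)\<^sup>2 * \<sigma>\<^sup>2 \<le> mean_target (size_of w (Suc k))"
      using w by (simp add: size_of_Suc mean_target_def x_def add.commute)
  next
    show "0 \<le> 1 / (real n + 1)\<^sup>2 * \<sigma>\<^sup>2 \<and> 1 / (real n + 1)\<^sup>2 * \<sigma>\<^sup>2 \<le> \<sigma>\<^sup>2" for n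
      by (rule scale) (use le1(3)[of "real n"] in auto)
  qed (use le1 scale mean_square_le abs_targets in auto)
  show "(\<integral>w. Z w * of_bool (ev w k = Arrival) * var w (Suc k) \<partial>Q)
      \<le> (\<integral>w. Z w * of_bool (ev w k = Arrival) * var_target (size_of w (Suc k)) \<partial>Q)"
  proof (rule moment_step[OF IH Z marks_subsets(1),
      where \<alpha> = "\<lambda>n. real n / (real n + 1)\<^sup>2" and \<beta> = "\<lambda>n. real n / (real n + 1)"
        and \<gamma> = "\<lambda>n. real n / (real n + 1)\<^sup>2 * \<sigma>\<^sup>2"])
    fix w' assume "ev w' k = Arrival"
    from frozen_Arrival(1)[OF this]
    show "(\<integral>w. var (mix {New_Value k} w' w) (Suc k) \<partial>Q)
      = real (size_of w' k) / (real (size_of w' k) + 1)\<^sup>2 * (mean w' k)\<^sup>2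
        + real (size_of w' k) / (real (size_of w' k) + 1) * var w' k
        + real (size_of w' k) / (real (size_of w' k) + 1)\<^sup>2 * \<sigma>\<^sup>2"
      by (simp only: distrib_left add_ac)
  next
    fix w assume w: "good b w" "ev w k = Arrival"
    define x where "x = real (size_of w k)"
    have x: "x + 1 \<noteq> 0" by (simp add: x_def add_nonneg_eq_0_iff)
    have "x / (x + 1)\<^sup>2 * (\<sigma>\<^sup>2 / x) + x / (x + 1) * (\<sigma>\<^sup>2 * (x - 1) / x) + x / (x + 1)\<^sup>2 * \<sigma>\<^sup>2
        = x * \<sigma>\<^sup>2 / (x + 1)"
    proof (cases "x = 0")
      case False
      have "x / (x + 1)\<^sup>2 * (\<sigma>\<^sup>2 / x) + x / (x + 1)\<^sup>2 * \<sigma>\<^sup>2 = (x + 1) * \<sigma>\<^sup>2 / ((x + 1) * (x + 1))"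
        using False by (simp add: power2_eq_square add_divide_distrib[symmetric] algebra_simps)
      also have "\<dots> = \<sigma>\<^sup>2 / (x + 1)" using x by simp
      finally have 1: "x / (x + 1)\<^sup>2 * (\<sigma>\<^sup>2 / x) + x / (x + 1)\<^sup>2 * \<sigma>\<^sup>2 = \<sigma>\<^sup>2 / (x + 1)" .
      have 2: "x / (x + 1) * (\<sigma>\<^sup>2 * (x - 1) / x) = \<sigma>\<^sup>2 * (x - 1) / (x + 1)"
        using False by simp
      have "\<sigma>\<^sup>2 / (x + 1) + \<sigma>\<^sup>2 * (x - 1) / (x + 1) = x * \<sigma>\<^sup>2 / (x + 1)"
        by (simp add: add_divide_distrib[symmetric] algebra_simps)
      with 1 2 show ?thesis by linarith
    qed simp
    then show "real (size_of w k) / (real (size_of w k) + 1)\<^sup>2 * mean_target (size_of w k)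
        + real (size_of w k) / (real (size_of w k) + 1) * var_target (size_of w k)
        + real (size_of w k) / (real (size_of w k) + 1)\<^sup>2 * \<sigma>\<^sup>2 \<le> var_target (size_of w (Suc k))"
      using w by (simp add: size_of_Suc mean_target_def var_target_def x_def add.commute mult.commute)
  next
    show "0 \<le> real n / (real n + 1)\<^sup>2 * \<sigma>\<^sup>2 \<and> real n / (real n + 1)\<^sup>2 * \<sigma>\<^sup>2 \<le> \<sigma>\<^sup>2" for n
      by (rule scale) (use weight_le_1[of "real n"] in auto)
  qed (use le1 scale weight_le_1 var_nonneg var_le abs_targets in auto)
qed

text \<open>For n >= 2 both targets are met with equality, for the mean because \<sigma>^2/n +
  \<sigma>^2/(n (n-1)) = \<sigma>^2/(n-1). The last agent's departure is separate: the mean then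
  drops to 0 by convention.\<close>

lemma moment_step_Departure:
  assumes IH: "moment_bounds k" and Z: "history_weight Z"
  shows "(\<integral>w. Z w * of_bool (ev w k = Departure) * (mean w (Suc k))\<^sup>2 \<partial>Q)
      \<le> (\<integral>w. Z w * of_bool (ev w k = Departure) * mean_target (size_of w (Suc k)) \<partial>Q)"
    "(\<integral>w. Z w * of_bool (ev w k = Departure) * var w (Suc k) \<partial>Q)
      \<le> (\<integral>w. Z w * of_bool (ev w k = Departure) * var_target (size_of w (Suc k)) \<partial>Q)"
proof -
  \<comment> \<open>At n = 1 the quotient is 1/0 = 0.\<close>
  have inv_le: "1 / (real n - 1)\<^sup>2 \<le> 1" for n
  proof (cases "n = 1")
    case False
    then have "1 \<le> \<bar>real n - 1\<bar>" by (cases n) auto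
    then have "1\<^sup>2 \<le> \<bar>real n - 1\<bar>\<^sup>2" by (intro power_mono) auto
    then show ?thesis by (simp add: divide_le_eq_1)
  qed simp
  have S: "range (Leaver k) \<subseteq> level_sources k" "range (Leaver k) \<inter> history_sources = {}"
    using marks_subsets(2)[of k] by (auto simp: marks_def)
  have size_Suc: "size_of w (Suc k) = size_of w k - 1" "1 \<le> size_of w k" if "good b w" "ev w k = Departure" for w
  proof -
    show "size_of w (Suc k) = size_of w k - 1" using that by (simp add: size_of_Suc)
    have "present w k \<in> selection_sets" using that by (intro present_nonempty) simp
    then show "1 \<le> size_of w k" by (simp add: size_of_def selection_sets_def Suc_le_eq card_gt_0_iff)
  qed
  show "(\<integral>w. Z w * of_bool (ev w k = Departure) * (mean w (Suc k))\<^sup>2 \<partial>Q)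
      \<le> (\<integral>w. Z w * of_bool (ev w k = Departure) * mean_target (size_of w (Suc k)) \<partial>Q)"
  proof (rule moment_step[OF IH Z marks_subsets(2),
      where \<alpha> = "\<lambda>n. of_bool (2 \<le> n)" and \<beta> = "\<lambda>n. of_bool (2 \<le> n) * (1 / (real n - 1)\<^sup>2)" and \<gamma> = "\<lambda>n. 0"])
    fix w' assume w': "good b w'" "ev w' k = Departure"
    show "(\<integral>w. (mean (mix (range (Leaver k)) w' w) (Suc k))\<^sup>2 \<partial>Q)
      = of_bool (2 \<le> size_of w' k) * (mean w' k)\<^sup>2
        + of_bool (2 \<le> size_of w' k) * (1 / (real (size_of w' k) - 1)\<^sup>2) * var w' k + 0"
    proof (cases "2 \<le> size_of w' k")
      case True
      then show ?thesis using frozen_Departure(2)[OF w'(2) True] by simp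
    next
      case False
      have "(\<integral>w. (mean (mix (range (Leaver k)) w' w) (Suc k))\<^sup>2 \<partial>Q) = (\<integral>w. 0 \<partial>Q)"
      proof (rule integral_good_cong)
        fix w assume w: "good b w"
        have "size_of (mix (range (Leaver k)) w' w) (Suc k) = size_of (mix (range (Leaver k)) w' w) k - 1"
          using size_Suc(1)[OF good_mix[OF w'(1) w]] w'(2) by (simp add: level_mix_marks[OF S])
        also have "\<dots> = 0" using False by (simp add: level_mix[OF S(1)])
        finally show "(mean (mix (range (Leaver k)) w' w) (Suc k))\<^sup>2 = 0"
          by (simp add: mean_size_0)
      qed simp_all
      then show ?thesis using False by simp
    qed
  next
    fix w assume w: "good b w" "ev w k = Departure"
    show "of_bool (2 \<le> size_of w k) * mean_target (size_of w k)
        + of_bool (2 \<le> size_of w k) * (1 / (real (size_of w k) - 1)\<^sup>2) * var_target (size_of w k) + 0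
      \<le> mean_target (size_of w (Suc k))"
    proof (cases "2 \<le> size_of w k")
      case True
      define x where "x = real (size_of w k)"
      have x: "x \<noteq> 0" "x - 1 \<noteq> 0" using True by (auto simp: x_def)
      have "\<sigma>\<^sup>2 / x + 1 / (x - 1)\<^sup>2 * (\<sigma>\<^sup>2 * (x - 1) / x) = \<sigma>\<^sup>2 / (x - 1)"
        using x by (simp add: divide_simps power2_eq_square) (simp add: algebra_simps)
      moreover have "real (size_of w (Suc k)) = x - 1"
        using True by (simp add: size_Suc(1)[OF w] x_def of_nat_diff)
      ultimately show ?thesis
        using True by (simp add: mean_target_def var_target_def flip: x_def)
    qed (simp add: mean_target_def)
  qed (use inv_le mean_square_le abs_targets in auto)
  show "(\<integral>w. Z w * of_bool (ev w k = Departure) * var w (Suc k) \<partial>Q)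
      \<le> (\<integral>w. Z w * of_bool (ev w k = Departure) * var_target (size_of w (Suc k)) \<partial>Q)"
  proof (rule moment_step[OF IH Z marks_subsets(2),
      where \<alpha> = "\<lambda>n. 0" and \<beta> = "\<lambda>n. 1 - 1 / (real n - 1)\<^sup>2" and \<gamma> = "\<lambda>n. 0"])
    fix w' assume "ev w' k = Departure"
    from frozen_Departure(1)[OF this]
    show "(\<integral>w. var (mix (range (Leaver k)) w' w) (Suc k) \<partial>Q)
      = 0 * (mean w' k)\<^sup>2 + (1 - 1 / (real (size_of w' k) - 1)\<^sup>2) * var w' k + 0"
      by (simp add: algebra_simps)
  next
    fix w assume w: "good b w" "ev w k = Departure"
    show "0 * mean_target (size_of w k) + (1 - 1 / (real (size_of w k) - 1)\<^sup>2) * var_target (size_of w k) + 0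
      \<le> var_target (size_of w (Suc k))"
    proof (cases "2 \<le> size_of w k")
      case True
      define x where "x = real (size_of w k)"
      have x: "x \<noteq> 0" "x - 1 \<noteq> 0" using True by (auto simp: x_def)
      have "(1 - 1 / (x - 1)\<^sup>2) * (\<sigma>\<^sup>2 * (x - 1) / x) = \<sigma>\<^sup>2 * (x - 1 - 1) / (x - 1)"
        using x by (simp add: divide_simps power2_eq_square) (simp add: algebra_simps)
      moreover have "var_target (size_of w (Suc k)) = \<sigma>\<^sup>2 * (x - 1 - 1) / (x - 1)"
        using True by (simp add: size_Suc(1)[OF w] var_target_def x_def of_nat_diff)
      ultimately show ?thesis
        by (simp add: var_target_def x_def)
    next
      case False
      then have "size_of w k = 1" using size_Suc(2)[OF w] by simp
      then show ?thesis by (simp add: size_Suc(1)[OF w] var_target_def)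
    qed
  qed (use inv_le var_nonneg var_le abs_targets in auto)
qed

text \<open>Gossip preserves the mean on every good path, so nothing is resampled for it. It lowers
  the variance while the size, and with it the target, stays the same; this is the one step that
  makes the variance bound an inequality.\<close>

lemma moment_step_Gossip:
  assumes IH: "moment_bounds k" and Z: "history_weight Z"
  shows "(\<integral>w. Z w * of_bool (ev w k = Gossip) * (mean w (Suc k))\<^sup>2 \<partial>Q)
      \<le> (\<integral>w. Z w * of_bool (ev w k = Gossip) * mean_target (size_of w (Suc k)) \<partial>Q)"
    "(\<integral>w. Z w * of_bool (ev w k = Gossip) * var w (Suc k) \<partial>Q)
      \<le> (\<integral>w. Z w * of_bool (ev w k = Gossip) * var_target (size_of w (Suc k)) \<partial>Q)"
proof -
  show "(\<integral>w. Z w * of_bool (ev w k = Gossip) * (mean w (Suc k))\<^sup>2 \<partial>Q)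
      \<le> (\<integral>w. Z w * of_bool (ev w k = Gossip) * mean_target (size_of w (Suc k)) \<partial>Q)"
  proof (rule moment_step[OF IH Z, where S = "{}" and \<alpha> = "\<lambda>n. 1" and \<beta> = "\<lambda>n. 0" and \<gamma> = "\<lambda>n. 0"])
    fix w' assume w': "good b w'" "ev w' k = Gossip"
    have "mix {} w' w = w'" for w by (simp add: mix_def)
    then show "(\<integral>w. (mean (mix {} w' w) (Suc k))\<^sup>2 \<partial>Q) = 1 * (mean w' k)\<^sup>2 + 0 * var w' k + 0"
      using prob_space mean_Gossip[OF w'(2,1)] by simp
  qed (use mean_square_le abs_targets size_of_Suc in auto)
  show "(\<integral>w. Z w * of_bool (ev w k = Gossip) * var w (Suc k) \<partial>Q)
      \<le> (\<integral>w. Z w * of_bool (ev w k = Gossip) * var_target (size_of w (Suc k)) \<partial>Q)"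
  proof (rule moment_step[OF IH Z marks_subsets(3),
      where \<alpha> = "\<lambda>n. 0" and \<beta> = "\<lambda>n. 1 - 1 / real n" and \<gamma> = "\<lambda>n. 0"])
    show "0 \<le> 1 - 1 / real n \<and> 1 - 1 / real n \<le> 1" for n
      by (cases n) (auto simp: divide_le_eq_1)
    fix w' assume "ev w' k = Gossip"
    from frozen_Gossip[OF this]
    show "(\<integral>w. var (mix (range (First_Agent k) \<union> range (Second_Agent k)) w' w) (Suc k) \<partial>Q)
      = 0 * (mean w' k)\<^sup>2 + (1 - 1 / real (size_of w' k)) * var w' k + 0"
      by (simp add: algebra_simps)
  next
    fix w assume w: "good b w" "ev w k = Gossip"
    have "0 \<le> 1 / real (size_of w k) * var_target (size_of w k)"
      by (cases "size_of w k") (auto simp: var_target_def)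
    then show "0 * mean_target (size_of w k) + (1 - 1 / real (size_of w k)) * var_target (size_of w k) + 0
      \<le> var_target (size_of w (Suc k))"
      using w by (simp add: size_of_Suc algebra_simps)
  qed (use var_nonneg var_le abs_targets in auto)
qed

lemma integral_split_events:
  assumes Z: "history_weight Z" and F: "F \<in> borel_measurable noise_space" "\<And>w. good b w \<Longrightarrow> \<bar>F w\<bar> \<le> B"
  shows "(\<integral>w. Z w * F w \<partial>Q) = (\<Sum>e\<in>UNIV. \<integral>w. Z w * of_bool (ev w k = e) * F w \<partial>Q)"
proof -
  have "(\<integral>w. Z w * F w \<partial>Q) = (\<integral>w. (\<Sum>e\<in>UNIV. Z w * of_bool (ev w k = e) * F w) \<partial>Q)"
  proof (intro Bochner_Integration.integral_cong refl)
    fix w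
    show "Z w * F w = (\<Sum>e\<in>UNIV. Z w * of_bool (ev w k = e) * F w)"
      by (cases "ev w k") (simp_all add: UNIV_event)
  qed
  also have "\<dots> = (\<Sum>e\<in>UNIV. \<integral>w. Z w * of_bool (ev w k = e) * F w \<partial>Q)"
    by (intro Bochner_Integration.integral_sum integrable_weighted[where B = B]
        history_weight_mult history_weight_event Z F)
  finally show ?thesis .
qed

lemma moment_bounds: "moment_bounds k"
proof (induction k)
  case (Suc k)
  show ?case
    unfolding moment_bounds_def
  proof (intro allI impI conjI)
    fix Z assume Z: "history_weight Z"
    have m: "(\<integral>w. Z w * (mean w (Suc k))\<^sup>2 \<partial>Q)
        = (\<Sum>e\<in>UNIV. \<integral>w. Z w * of_bool (ev w k = e) * (mean w (Suc k))\<^sup>2 \<partial>Q)"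
      by (rule integral_split_events[OF Z, where B = "b\<^sup>2"]) (use mean_square_le in auto)
    have v: "(\<integral>w. Z w * var w (Suc k) \<partial>Q)
        = (\<Sum>e\<in>UNIV. \<integral>w. Z w * of_bool (ev w k = e) * var w (Suc k) \<partial>Q)"
      by (rule integral_split_events[OF Z, where B = "b\<^sup>2"]) (use var_nonneg var_le in auto)
    have t: "(\<integral>w. Z w * f (size_of w (Suc k)) \<partial>Q)
        = (\<Sum>e\<in>UNIV. \<integral>w. Z w * of_bool (ev w k = e) * f (size_of w (Suc k)) \<partial>Q)"
      if "\<And>n. \<bar>f n\<bar> \<le> \<sigma>\<^sup>2" for f
      by (rule integral_split_events[OF Z, where B = "\<sigma>\<^sup>2"]) (use that in auto)
    show "(\<integral>w. Z w * (mean w (Suc k))\<^sup>2 \<partial>Q) \<le> (\<integral>w. Z w * mean_target (size_of w (Suc k)) \<partial>Q)"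
      unfolding m t[of mean_target, OF abs_targets(1)]
    proof (rule sum_mono)
      fix e
      show "(\<integral>w. Z w * of_bool (ev w k = e) * (mean w (Suc k))\<^sup>2 \<partial>Q)
        \<le> (\<integral>w. Z w * of_bool (ev w k = e) * mean_target (size_of w (Suc k)) \<partial>Q)"
        using moment_step_Arrival(1)[OF Suc Z] moment_step_Departure(1)[OF Suc Z] moment_step_Gossip(1)[OF Suc Z]
        by (cases e) auto
    qed
    show "(\<integral>w. Z w * var w (Suc k) \<partial>Q) \<le> (\<integral>w. Z w * var_target (size_of w (Suc k)) \<partial>Q)"
      unfolding v t[of var_target, OF abs_targets(2)]
    proof (rule sum_mono)
      fix e
      show "(\<integral>w. Z w * of_bool (ev w k = e) * var w (Suc k) \<partial>Q)
        \<le> (\<integral>w. Z w * of_bool (ev w k = e) * var_target (size_of w (Suc k)) \<partial>Q)"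
        using moment_step_Arrival(2)[OF Suc Z] moment_step_Departure(2)[OF Suc Z] moment_step_Gossip(2)[OF Suc Z]
        by (cases e) auto
    qed
  qed
qed (rule moment_bounds_0)

section \<open>From the generator to the differential inequality\<close>

section \<open>The differential inequality\<close>

text \<open>The coefficient of the squared mean in the arrival drift.\<close>

definition weight :: "nat \<Rightarrow> real" where
  "weight n = real n / (real n + 1)\<^sup>2"

lemma weight_bounds: "0 \<le> weight n" "weight n \<le> 1"
  using weight_le_1[of "real n"] by (simp_all add: weight_def)

lemma measurable_mean_at_count [measurable]: "(\<lambda>w. mean w (count w t)) \<in> borel_measurable noise_space"
  by (rule measurable_at_count) measurable

text \<open>Sums the moment bounds over the number of events up to time \<open>t\<close>.\<close>

lemma weighted_mean_at:
  assumes t: "0 \<le> t"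
  shows "(\<integral>w. weight (size_of w (count w t)) * ((mean w (count w t))\<^sup>2 - mean_target (size_of w (count w t))) \<partial>Q) \<le> 0"
proof -
  define h where "h w k = weight (size_of w k) * ((mean w k)\<^sup>2 - mean_target (size_of w k))" for w k
  define I where "I w k = (of_bool (T w k \<le> ereal t \<and> ereal t < T w (Suc k)) :: real)" for w k
  have [measurable]: "(\<lambda>w. h w k) \<in> borel_measurable noise_space" "(\<lambda>w. I w k) \<in> borel_measurable noise_space" for k
    unfolding h_def I_def by measurable
  have [measurable]: "(\<lambda>w. h w (count w t)) \<in> borel_measurable noise_space"
    by (rule measurable_at_count) measurable
  have diff: "\<bar>(mean w k)\<^sup>2 - mean_target (size_of w k)\<bar> \<le> b\<^sup>2 + \<sigma>\<^sup>2" if "good b w" for w k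
    using mean_square_le[OF that, of k] abs_targets(1)[of "size_of w k"] zero_le_power2[of "mean w k"] by linarith
  have h: "\<bar>h w k\<bar> \<le> b\<^sup>2 + \<sigma>\<^sup>2" if "good b w" for w k
  proof -
    have "\<bar>h w k\<bar> \<le> 1 * (b\<^sup>2 + \<sigma>\<^sup>2)"
      unfolding h_def abs_mult using weight_bounds[of "size_of w k"] diff[OF that] by (intro mult_mono) auto
    then show ?thesis by simp
  qed
  have I: "I w k = of_bool (count w t = k)" if "good b w" "nonexplosive w" for w k
  proof -
    have "T w k \<le> ereal t \<and> ereal t < T w (Suc k) \<longleftrightarrow> count w t = k"
      using count_unique[OF that(1), of k t] count_bounds[OF that t] by (cases "count w t = k") blast+
    then show ?thesis unfolding I_def by (simp only:)
  qed
  have Ih: "(\<integral>w. I w k * h w k \<partial>Q) \<le> 0" "integrable Q (\<lambda>w. I w k * h w k)" for k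
  proof -
    have W: "history_weight (\<lambda>w. I w k)" unfolding I_def by (rule history_weight_interval)
    then show "integrable Q (\<lambda>w. I w k * h w k)" using h by (intro integrable_weighted) auto
    \<comment> \<open>The indicator that exactly \<open>k\<close> events have happened is a history
      weight, so the moment bound at the fixed index \<open>k\<close> applies under it.\<close>
    have Z: "history_weight (\<lambda>w. I w k * weight (size_of w k))"
      using weight_bounds by (intro history_weight_mult W history_weight_size) auto
    have "(\<integral>w. I w k * h w k \<partial>Q) = (\<integral>w. I w k * weight (size_of w k) * (mean w k)\<^sup>2
        - I w k * weight (size_of w k) * mean_target (size_of w k) \<partial>Q)"
      by (simp add: h_def algebra_simps)
    also have "\<dots> = (\<integral>w. I w k * weight (size_of w k) * (mean w k)\<^sup>2 \<partial>Q)
        - (\<integral>w. I w k * weight (size_of w k) * mean_target (size_of w k) \<partial>Q)"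
    proof (rule Bochner_Integration.integral_diff)
      show "integrable Q (\<lambda>w. I w k * weight (size_of w k) * (mean w k)\<^sup>2)"
        by (rule integrable_weighted[OF Z, where B = "b\<^sup>2"]) (use mean_square_le in auto)
      show "integrable Q (\<lambda>w. I w k * weight (size_of w k) * mean_target (size_of w k))"
        by (rule integrable_weighted[OF Z, where B = "\<sigma>\<^sup>2"]) (use abs_targets in auto)
    qed
    also have "\<dots> \<le> 0"
      using moment_bounds[of k] Z unfolding moment_bounds_def by auto
    finally show "(\<integral>w. I w k * h w k \<partial>Q) \<le> 0" .
  qed
  have sum: "(\<Sum>k<K. I w k * h w k) = of_bool (count w t < K) * h w (count w t)"
    if "good b w" "nonexplosive w" for w K
  proof -
    have "(\<Sum>k<K. I w k * h w k) = (\<Sum>k<K. if k = count w t then h w k else 0)"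
      by (intro sum.cong) (auto simp: I[OF that])
    then show ?thesis by simp
  qed
  \<comment> \<open>Summation over \<open>k\<close> recovers the random index; the partial sums are
    dominated since almost surely at most one indicator is nonzero.\<close>
  have "(\<lambda>K. \<integral>w. (\<Sum>k<K. I w k * h w k) \<partial>Q) \<longlonglongrightarrow> (\<integral>w. h w (count w t) \<partial>Q)"
  proof (rule integral_dominated_convergence[where w = "\<lambda>_. b\<^sup>2 + \<sigma>\<^sup>2"])
    show "AE w in Q. (\<lambda>K. \<Sum>k<K. I w k * h w k) \<longlonglongrightarrow> h w (count w t)"
      using AE_good AE_nonexplosive
    proof eventually_elim
      case (elim w)
      have "\<forall>\<^sub>F K in sequentially. (\<Sum>k<K. I w k * h w k) = h w (count w t)"
        using eventually_gt_at_top[of "count w t"] by eventually_elim (simp add: sum[OF elim])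
      then show ?case by (rule tendsto_eventually)
    qed
    show "AE w in Q. norm (\<Sum>k<K. I w k * h w k) \<le> b\<^sup>2 + \<sigma>\<^sup>2" for K
      using AE_good AE_nonexplosive
    proof eventually_elim
      case (elim w)
      show ?case using h[OF elim(1), of "count w t"] by (simp add: sum[OF elim] of_bool_def)
    qed
  qed auto
  moreover have "(\<integral>w. (\<Sum>k<K. I w k * h w k) \<partial>Q) \<le> 0" for K
  proof -
    have "(\<integral>w. (\<Sum>k<K. I w k * h w k) \<partial>Q) = (\<Sum>k<K. \<integral>w. I w k * h w k \<partial>Q)"
      using Ih(2) by (intro Bochner_Integration.integral_sum) auto
    then show ?thesis using Ih(1) by (simp add: sum_nonpos)
  qed
  ultimately have "(\<integral>w. h w (count w t) \<partial>Q) \<le> 0"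
    by (intro LIMSEQ_le_const2) auto
  then show ?thesis by (simp add: h_def)
qed

text \<open>A pathwise bound obtained by comparing the squared mean with its target: for n > 0,
  n/(n+1)^2 times (\<sigma>^2 + \<sigma>^2/n) is \<sigma>^2/(n+1), the arrival term of the theorem.
  The departure term and -V/(n+1) are dropped; the remainder has nonpositive mean by the moment
  bounds.\<close>

lemma generator_le:
  "generator w k \<le> - lg * var w k + la / (real (size_of w k) + 1) * \<sigma>\<^sup>2
    + la * (weight (size_of w k) * ((mean w k)\<^sup>2 - mean_target (size_of w k)))"
proof -
  define n where "n = real (size_of w k)"
  have n: "0 \<le> n" "n + 1 \<noteq> 0" by (simp_all add: n_def add_nonneg_eq_0_iff)
  \<comment> \<open>At size 0 both sides are 0, as the variance vanishes there.\<close>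
  have gos: "drift Gossip w k * rate Gossip (size_of w k) = - lg * var w k"
    using var_size_0[of w k] by (cases "size_of w k = 0") (simp_all add: drift_def)
  have dep: "drift Departure w k * rate Departure (size_of w k) \<le> 0"
    using rates_nonneg var_nonneg[of w k] by (simp add: drift_def Let_def)
  \<comment> \<open>An inequality rather than an equation only because of n = 0, where the left side
    is 0.\<close>
  have "n / (n + 1)\<^sup>2 * \<sigma>\<^sup>2 + n / (n + 1)\<^sup>2 * (\<sigma>\<^sup>2 / n) \<le> (n + 1) * \<sigma>\<^sup>2 / ((n + 1) * (n + 1))"
    by (cases "n = 0") (simp_all add: power2_eq_square add_divide_distrib[symmetric] algebra_simps)
  also have "\<dots> = 1 / (n + 1) * \<sigma>\<^sup>2" using n by simp
  finally have "n / (n + 1)\<^sup>2 * \<sigma>\<^sup>2 + n / (n + 1)\<^sup>2 * (\<sigma>\<^sup>2 / n) \<le> 1 / (n + 1) * \<sigma>\<^sup>2" .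
  moreover have "drift Arrival w k \<le> n / (n + 1)\<^sup>2 * (\<sigma>\<^sup>2 + (mean w k)\<^sup>2)"
    using var_nonneg[of w k] n by (simp add: drift_def Let_def flip: n_def)
  ultimately have "drift Arrival w k \<le> 1 / (n + 1) * \<sigma>\<^sup>2 + n / (n + 1)\<^sup>2 * ((mean w k)\<^sup>2 - \<sigma>\<^sup>2 / n)"
    unfolding right_diff_distrib distrib_left by linarith
  then have "drift Arrival w k * la \<le> (1 / (n + 1) * \<sigma>\<^sup>2 + n / (n + 1)\<^sup>2 * ((mean w k)\<^sup>2 - \<sigma>\<^sup>2 / n)) * la"
    using rates_nonneg by (intro mult_right_mono) auto
  also have "\<dots> = la / (n + 1) * \<sigma>\<^sup>2 + la * (weight (size_of w k) * ((mean w k)\<^sup>2 - mean_target (size_of w k)))"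
    unfolding weight_def mean_target_def n_def[symmetric] distrib_right by (simp add: mult.commute)
  finally show ?thesis
    using gos dep by (simp add: generator_def UNIV_event n_def)
qed

theorem expected_generator_le:
  assumes t: "0 \<le> t"
  shows "(\<integral>w. generator w (count w t) \<partial>Q) \<le> - lg * (\<integral>w. var w (count w t) \<partial>Q)
    + (\<integral>w. la / (real (size_of w (count w t)) + 1) \<partial>Q) * \<sigma>\<^sup>2"
proof -
  define n where "n w = size_of w (count w t)" for w
  have [measurable]: "n \<in> noise_space \<rightarrow>\<^sub>M count_space UNIV" unfolding n_def by measurable
  define g where "g w = weight (n w) * ((mean w (count w t))\<^sup>2 - mean_target (n w))" for w
  have [measurable]: "g \<in> borel_measurable noise_space" unfolding g_def by measurable
  have g: "integrable Q g"
  proof (rule integrable_good[of _ "1 * (b\<^sup>2 + \<sigma>\<^sup>2)"])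
    fix w assume w: "good b w"
    have "\<bar>(mean w (count w t))\<^sup>2 - mean_target (n w)\<bar> \<le> b\<^sup>2 + \<sigma>\<^sup>2"
      using mean_square_le[OF w, of "count w t"] abs_targets(1)[of "n w"] zero_le_power2[of "mean w (count w t)"] by linarith
    then show "\<bar>g w\<bar> \<le> 1 * (b\<^sup>2 + \<sigma>\<^sup>2)"
      unfolding g_def abs_mult using weight_bounds[of "n w"] by (intro mult_mono) auto
  qed measurable
  have v: "integrable Q (\<lambda>w. var w (count w t))"
    using var_nonneg var_le by (intro integrable_good[of _ "b\<^sup>2"]) auto
  have l: "integrable Q (\<lambda>w. la / (real (n w) + 1))"
  proof (rule integrable_good[of _ la])
    show "\<bar>la / (real (n w) + 1)\<bar> \<le> la" for w
      using rates_nonneg by (simp add: abs_divide divide_le_eq mult_le_cancel_left1)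
  qed measurable
  have i1: "integrable Q (\<lambda>w. - lg * var w (count w t))" and i3: "integrable Q (\<lambda>w. la * g w)"
    and i2: "integrable Q (\<lambda>w. la / (real (n w) + 1) * \<sigma>\<^sup>2)"
    by (intro integrable_mult_right integrable_mult_left g v l)+
  have "(\<integral>w. generator w (count w t) \<partial>Q) \<le> (\<integral>w. - lg * var w (count w t) + la / (real (n w) + 1) * \<sigma>\<^sup>2 + la * g w \<partial>Q)"
  proof (rule integral_good_mono)
    show "integrable Q (\<lambda>w. generator w (count w t))"
      using abs_generator_le by (intro integrable_good[of _ gen_bound]) auto
    show "integrable Q (\<lambda>w. - lg * var w (count w t) + la / (real (n w) + 1) * \<sigma>\<^sup>2 + la * g w)"
      by (intro Bochner_Integration.integrable_add i1 i2 i3)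
  qed (unfold g_def n_def, rule generator_le)
  also have "\<dots> = - lg * (\<integral>w. var w (count w t) \<partial>Q) + (\<integral>w. la / (real (n w) + 1) \<partial>Q) * \<sigma>\<^sup>2 + la * (\<integral>w. g w \<partial>Q)"
    by (simp only: Bochner_Integration.integral_add Bochner_Integration.integrable_add i1 i2 i3
        integral_mult_right_zero integral_mult_left_zero)
  also have "la * (\<integral>w. g w \<partial>Q) \<le> 0"
    using weighted_mean_at[OF t] rates_nonneg by (simp add: g_def n_def mult_nonneg_nonpos)
  finally show ?thesis by (simp add: n_def)
qed

end

text \<open>Variance and size depend on the sample point only through the noise, so the given
  probability space can be replaced by the law of \<open>W\<close>. Independence of the infinite
  family becomes the product form of the joint law.\<close>

lemma (in driving_noise) gossip_system_distr:
  assumes D: "value_distribution D \<sigma>" and "0 \<le> la" "0 \<le> ld" "0 \<le> lg"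
    and "0 \<le> b" "AE v in D. \<bar>v\<bar> \<le> b"
  shows "W \<in> M \<rightarrow>\<^sub>M noise_space" "gossip_system (distr M noise_space W) D \<sigma> la ld lg b"
proof -
  have rv: "(\<lambda>\<omega>. reading (W \<omega>) s) \<in> borel_measurable M" if "s \<in> sources" for s
    using independent that by (auto simp: indep_vars_def)
  show W: "W \<in> M \<rightarrow>\<^sub>M noise_space"
    using rv by (rule measurable_into_noise_space)
  have distr: "distr (distr M noise_space W) N f = distr M N (\<lambda>\<omega>. f (W \<omega>))" if "f \<in> noise_space \<rightarrow>\<^sub>M N" for N :: "'c measure" and f
    using distr_distr[OF that W] by (simp add: comp_def)
  interpret V: value_distribution D \<sigma> by (rule D)
  show "gossip_system (distr M noise_space W) D \<sigma> la ld lg b"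
  proof (intro gossip_system.intro noise_law.intro noise_law_axioms.intro event_rates.intro gossip_system_axioms.intro)
    show "prob_space (distr M noise_space W)" by (rule prob_space_distr[OF W])
    show "distr (distr M noise_space W) (PiM sources (\<lambda>_. borel)) readings
      = PiM sources (\<lambda>s. distr (distr M noise_space W) borel (\<lambda>w. reading w s))"
    proof -
      have "distr (distr M noise_space W) (PiM sources (\<lambda>_. borel)) readings
          = distr M (PiM sources (\<lambda>_. borel)) (\<lambda>\<omega>. \<lambda>s\<in>sources. reading (W \<omega>) s)"
        by (simp add: distr[OF measurable_readings] readings_def)
      also have "\<dots> = PiM sources (\<lambda>s. distr M borel (\<lambda>\<omega>. reading (W \<omega>) s))"
      proof -
        have "sources \<noteq> {}" using sources_simps(1) by blast
        from indep_vars_iff_distr_eq_PiM'[OF this rv, THEN iffD1, OF _ independent] show ?thesis .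
      qed
      also have "\<dots> = PiM sources (\<lambda>s. distr (distr M noise_space W) borel (\<lambda>w. reading w s))"
        by (intro PiM_cong refl) (simp add: distr[OF measurable_reading])
      finally show ?thesis .
    qed
    show "distr (distr M noise_space W) borel (\<lambda>w. init_value w i) = D" for i
      by (simp add: distr init_value_law)
    show "distr (distr M noise_space W) borel (\<lambda>w. new_value w k) = D" for k
      by (simp add: distr new_value_law)
    show "distributed (distr M noise_space W) lborel (\<lambda>w. clock w e k) (exponential_density 1)" for e k
      using clock_law[of e k] by (simp add: distributed_def distr)
    show "distr (distr M noise_space W) (count_space UNIV) (\<lambda>w. leaver w k A) = measure_pmf (pmf_of_set A)"
      "distr (distr M noise_space W) (count_space UNIV) (\<lambda>w. first_agent w k A) = measure_pmf (pmf_of_set A)"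
      "distr (distr M noise_space W) (count_space UNIV) (\<lambda>w. second_agent w k A) = measure_pmf (pmf_of_set A)"
      if "A \<in> selection_sets" for k A
      using that by (simp_all add: distr measurable_selections leaver_law first_agent_law second_agent_law)
  qed (use assms in auto)
qed

lemma (in value_distribution) bounded_by:
  obtains b where "0 \<le> b" "AE v in D. \<bar>v\<bar> \<le> b"
proof -
  obtain S where S: "bounded S" "AE v in D. v \<in> S" using bounded_support by blast
  then obtain b where "0 < b" "\<And>v. v \<in> S \<Longrightarrow> \<bar>v\<bar> \<le> b" by (auto simp: bounded_pos)
  then show ?thesis using S(2) by (intro that[of b]) (auto elim: eventually_mono)
qed

theorem theorem2:
  fixes M :: "'a measure" and D :: "real measure" and W :: "'a \<Rightarrow> noise"
    and \<sigma> la ld lg t :: real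
  assumes "value_distribution D \<sigma>"
    and "driving_noise M D W"
    and "la \<ge> 0" and "ld \<ge> 0" and "lg \<ge> 0"
    and "t \<ge> 0"
  defines "r \<equiv> event_rate la ld lg"
  shows "\<exists>d. ((\<lambda>s. \<integral>\<omega>. variance_at r (W \<omega>) s \<partial>M) has_real_derivative d) (at t within {0..}) \<and>
    d \<le> - lg * (\<integral>\<omega>. variance_at r (W \<omega>) t \<partial>M)
          + (\<integral>\<omega>. la / (real (size_at r (W \<omega>) t) + 1) \<partial>M) * \<sigma>\<^sup>2"
proof -
  obtain b where b: "0 \<le> b" "AE v in D. \<bar>v\<bar> \<le> b"
    using value_distribution.bounded_by[OF assms(1)] by blast
  interpret N: driving_noise M D W by (rule assms(2))
  note law = N.gossip_system_distr[OF assms(1,3,4,5) b]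
  interpret gossip_system "distr M noise_space W" D \<sigma> la ld lg b by (rule law(2))
  have var: "(\<integral>\<omega>. variance_at r (W \<omega>) s \<partial>M) = (\<integral>w. var w (count w s) \<partial>distr M noise_space W)" for s
    unfolding r_def variance_at_eq by (rule integral_distr[OF law(1), symmetric]) measurable
  have size: "(\<integral>\<omega>. la / (real (size_at r (W \<omega>) t) + 1) \<partial>M)
      = (\<integral>w. la / (real (size_of w (count w t)) + 1) \<partial>distr M noise_space W)"
    unfolding r_def size_at_eq by (rule integral_distr[OF law(1), symmetric]) measurable
  show ?thesis
    unfolding var size
    using expected_variance_derivative[OF assms(6)] expected_generator_le[OF assms(6)] by blast
qed

end
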